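(* $\mathbf N:\mathsf{Adj}\to\mathsf{Adj}$ is an idempotent monad: for every adjunction $F$, the unit component of $\mathbf N$ at $\mathbf N(F)$, namely the morphism of adjunctions $(\kappa^0,\kappa_1):\mathbf N(F)\to\mathbf N(\mathbf N(F))$ consisting of the comparison functors of the adjunction $\mathbf N(F)$, $$\kappa^0:\overline{\mathrm{Coalg}}(F)\to\overline{\mathrm{Coalg}}(\mathbf N(F)),\qquad \kappa_1:\overline{\mathrm{Alg}}(F)\to\overline{\mathrm{Alg}}(\mathbf N(F)),$$ is an equivalence of adjunctions $\mathbf N(F)\simeq\mathbf N(\mathbf N(F))$, naturally in $F$.
   Context: **Adjunctions.** An adjunction $F=(F^*\dashv F_*:\mathcal B\to\mathcal A)$ has left adjoint $F^*:\mathcal A\to\mathcal B$, right adjoint $F_*:\mathcal B\to\mathcal A$, unit $\eta$, counit $\varepsilon$. The category $\mathsf{Adj}$ has adjunctions as objects; a morphism $F\to G=(G^*\dashv G_*:\mathcal D\to\mathcal C)$ is $(H,K,\upsilon^*,\upsilon_* )$ with functors $H:\mathcal A\to\mathcal C$, $K:\mathcal B\to\mathcal D$ and natural isomorphisms $\upsilon^*:KF^*\cong G^*H$, $\upsilon_*:HF_*\cong G_*K$ with $G_*\upsilon^*\circ\upsilon_*F^*\circ H\eta^F=\eta^GH$ and $\varepsilon^GK\circ G^*\upsilon_*\circ\upsilon^*F_*=K\varepsilon^F$. When only $(H,K)$ is written the 2-cells are identities. An equivalence of adjunctions is a morphism with $H,K$ equivalences of categories. Two parallel morphisms are isomorphic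 if there are natural isomorphisms $\theta:H\cong H'$, $\varphi:K\cong K'$ with $\upsilon'^*\circ\varphi F^*=G^*\theta\circ\upsilon^*$, $\upsilon'_*\circ\theta F_*=G_*\varphi\circ\upsilon_*$. Naturality and the monad laws are understood up to such isomorphism, and an idempotent monad is one whose multiplication is invertible up to equivalence. **Absolute completion.** $\overline{\mathcal C}$ is the idempotent (Karoubi) completion of $\mathcal C$; adjunctions $F$ lift to $\overline F=(F^*\dashv F_*:\overline{\mathcal B}\to\overline{\mathcal A})$, and morphisms lift as well. If all idempotents of $\mathcal C$ already split, $\overline{\mathcal C}$ is identified with $\mathcal C$ (this applies to the categories occurring in $\mathbf N(F)$). **Nucleus.** $\overline{\mathrm{Alg}}(F)$ is the category of algebras for the monad $F_*F^*$ on $\overline{\mathcal A}$, with forgetful functor $U_F$; $\overline{\mathrm{Coalg}}(F)$ is the category of coalgebras for the comonad $F^*F_*$ on $\overline{\mathcal B}$, with forgetful functor $V^F$. Comparison functors: $\kappa^0:\overline{\mathcal A}\to\overline{\mathrm{Coalg}}(F)$, $a\mapsto(F^*\eta_a:F^*a\to F^*F_*F^*a)$, and $\kappa_1:\overline{\mathcal B}\to\overline{\mathrm{Alg}}(F)$, $b\mapsto(F_*\varepsilon_b:F_*F^*F_*b\to F_*b)$. The nucleus is $$\mathbf N(F)=(F^\sharp\dashv F_\sharp:\overline{\mathrm{Alg}}(F)\to\overline{\mathrm{Coalg}}(F)),\quad F_\sharp=\kappa^0U_F,\quad F^\sharp=\kappa_1V^F,$$ with hom-bijection sending an algebra homomorphism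 $f:F^\sharp\beta\to\alpha$ to $F^*f\circ\beta:\beta\to F_\sharp\alpha$. A morphism $(H,K,\upsilon^*,\upsilon_* ):F\to G$ is sent to $(K^\upsilon,H^\upsilon)$, where $K^\upsilon(\beta:b\to F^*F_*b)=(Kb\xrightarrow{K\beta}KF^*F_*b\cong G^*HF_*b\cong G^*G_*Kb)$ and $H^\upsilon(\alpha:F_*F^*a\to a)=(G_*G^*Ha\cong G_*KF^*a\cong HF_*F^*a\xrightarrow{H\alpha}Ha)$, with 2-cells $H^\upsilon F^\sharp\cong G^\sharp K^\upsilon$ given at $\beta:y\to F^*F_*y$ by $\upsilon_{*,y}$ and $K^\upsilon F_\sharp\cong G_\sharp H^\upsilon$ given at $\alpha:F_*F^*x\to x$ by $\upsilon^*_x$. The unit of $\mathbf N$ at $F$ is $(\kappa^0,\kappa_1):\overline F\to\mathbf N(F)$ precomposed with the embedding $F\to\overline F$. So $\overline{\mathrm{Coalg}}(\mathbf N(F))$ is the category of coalgebras for the comonad $F^\sharp F_\sharp$ on $\overline{\mathrm{Alg}}(F)$, and $\overline{\mathrm{Alg}}(\mathbf N(F))$ is the category of algebras for the monad $F_\sharp F^\sharp$ on $\overline{\mathrm{Coalg}}(F)$. *)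

theory Defs
  imports Main
begin

section \<open>Categories, functors, natural isomorphisms\<close>

record ('o, 'm) cat =
  Ob   :: "'o set"
  Arr  :: "'m set"
  Dom  :: "'m \<Rightarrow> 'o"
  Cod  :: "'m \<Rightarrow> 'o"
  Ide  :: "'o \<Rightarrow> 'm"
  Comp :: "'m \<Rightarrow> 'm \<Rightarrow> 'm"

abbreviation comp_syntax :: "'m \<Rightarrow> ('o, 'm) cat \<Rightarrow> 'm \<Rightarrow> 'm"  ("(_ \<cdot>\<^bsub>_\<^esub> _)" [66, 0, 65] 65)
  where "g \<cdot>\<^bsub>C\<^esub> f \<equiv> Comp C g f"

definition hom :: "('o, 'm) cat \<Rightarrow> 'o \<Rightarrow> 'o \<Rightarrow> 'm set" where
  "hom C x y = {f \<in> Arr C. Dom C f = x \<and> Cod C f = y}"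

definition is_category :: "('o, 'm) cat \<Rightarrow> bool" where
  "is_category C \<longleftrightarrow>
     (\<forall>f\<in>Arr C. Dom C f \<in> Ob C \<and> Cod C f \<in> Ob C) \<and>
     (\<forall>x\<in>Ob C. Ide C x \<in> hom C x x) \<and>
     (\<forall>x\<in>Ob C. \<forall>y\<in>Ob C. \<forall>z\<in>Ob C. \<forall>f\<in>hom C x y. \<forall>g\<in>hom C y z. g \<cdot>\<^bsub>C\<^esub> f \<in> hom C x z) \<and>
     (\<forall>x\<in>Ob C. \<forall>y\<in>Ob C. \<forall>f\<in>hom C x y. f \<cdot>\<^bsub>C\<^esub> Ide C x = f \<and> Ide C y \<cdot>\<^bsub>C\<^esub> f = f) \<and>
     (\<forall>w\<in>Ob C. \<forall>x\<in>Ob C. \<forall>y\<in>Ob C. \<forall>z\<in>Ob C. \<forall>f\<in>hom C w x. \<forall>g\<in>hom C x y. \<forall>h\<in>hom C y z.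
        h \<cdot>\<^bsub>C\<^esub> (g \<cdot>\<^bsub>C\<^esub> f) = (h \<cdot>\<^bsub>C\<^esub> g) \<cdot>\<^bsub>C\<^esub> f)"

definition inverse_arrows :: "('o, 'm) cat \<Rightarrow> 'm \<Rightarrow> 'm \<Rightarrow> bool" where
  "inverse_arrows C f g \<longleftrightarrow>
     f \<in> Arr C \<and> g \<in> hom C (Cod C f) (Dom C f) \<and>
     g \<cdot>\<^bsub>C\<^esub> f = Ide C (Dom C f) \<and> f \<cdot>\<^bsub>C\<^esub> g = Ide C (Cod C f)"

definition is_iso :: "('o, 'm) cat \<Rightarrow> 'm \<Rightarrow> bool" where
  "is_iso C f \<longleftrightarrow> (\<exists>g. inverse_arrows C f g)"

definition inv_arr :: "('o, 'm) cat \<Rightarrow> 'm \<Rightarrow> 'm" where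
  "inv_arr C f = (THE g. inverse_arrows C f g)"

record ('o, 'm, 'p, 'n) fctr =
  Fo :: "'o \<Rightarrow> 'p"
  Fa :: "'m \<Rightarrow> 'n"

definition is_functor :: "('o, 'm) cat \<Rightarrow> ('p, 'n) cat \<Rightarrow> ('o, 'm, 'p, 'n) fctr \<Rightarrow> bool" where
  "is_functor C D H \<longleftrightarrow>
     is_category C \<and> is_category D \<and>
     (\<forall>x\<in>Ob C. Fo H x \<in> Ob D) \<and>
     (\<forall>x\<in>Ob C. \<forall>y\<in>Ob C. \<forall>f\<in>hom C x y. Fa H f \<in> hom D (Fo H x) (Fo H y)) \<and>
     (\<forall>x\<in>Ob C. Fa H (Ide C x) = Ide D (Fo H x)) \<and>
     (\<forall>x\<in>Ob C. \<forall>y\<in>Ob C. \<forall>z\<in>Ob C. \<forall>f\<in>hom C x y. \<forall>g\<in>hom C y z.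
        Fa H (g \<cdot>\<^bsub>C\<^esub> f) = Fa H g \<cdot>\<^bsub>D\<^esub> Fa H f)"

definition fid :: "('o, 'm, 'o, 'm) fctr" where
  "fid = \<lparr>Fo = (\<lambda>x. x), Fa = (\<lambda>f. f)\<rparr>"

definition fcomp :: "('p, 'n, 'q, 'k) fctr \<Rightarrow> ('o, 'm, 'p, 'n) fctr \<Rightarrow> ('o, 'm, 'q, 'k) fctr"
  (infixr "\<bullet>" 70) where
  "K \<bullet> H = \<lparr>Fo = (\<lambda>x. Fo K (Fo H x)), Fa = (\<lambda>f. Fa K (Fa H f))\<rparr>"

definition nat_trans ::
  "('o, 'm) cat \<Rightarrow> ('p, 'n) cat \<Rightarrow> ('o, 'm, 'p, 'n) fctr \<Rightarrow> ('o, 'm, 'p, 'n) fctr \<Rightarrow> ('o \<Rightarrow> 'n) \<Rightarrow> bool"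
where
  "nat_trans C D H H' \<tau> \<longleftrightarrow>
     is_functor C D H \<and> is_functor C D H' \<and>
     (\<forall>x\<in>Ob C. \<tau> x \<in> hom D (Fo H x) (Fo H' x)) \<and>
     (\<forall>x\<in>Ob C. \<forall>y\<in>Ob C. \<forall>f\<in>hom C x y. \<tau> y \<cdot>\<^bsub>D\<^esub> Fa H f = Fa H' f \<cdot>\<^bsub>D\<^esub> \<tau> x)"

definition nat_iso ::
  "('o, 'm) cat \<Rightarrow> ('p, 'n) cat \<Rightarrow> ('o, 'm, 'p, 'n) fctr \<Rightarrow> ('o, 'm, 'p, 'n) fctr \<Rightarrow> ('o \<Rightarrow> 'n) \<Rightarrow> bool"
where
  "nat_iso C D H H' \<tau> \<longleftrightarrow> nat_trans C D H H' \<tau> \<and> (\<forall>x\<in>Ob C. is_iso D (\<tau> x))"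

definition is_equivalence :: "('o, 'm) cat \<Rightarrow> ('p, 'n) cat \<Rightarrow> ('o, 'm, 'p, 'n) fctr \<Rightarrow> bool" where
  "is_equivalence C D H \<longleftrightarrow>
     is_functor C D H \<and>
     (\<exists>K. is_functor D C K \<and> (\<exists>\<eta>. nat_iso C C fid (K \<bullet> H) \<eta>) \<and> (\<exists>\<epsilon>. nat_iso D D (H \<bullet> K) fid \<epsilon>))"


section \<open>The category of adjunctions\<close>

text \<open>
  An adjunction \<open>F\<^sup>* \<stileturn> F\<^sub>* : B \<rightarrow> A\<close>: \<open>left F\<close> is \<open>F\<^sup>* : A \<rightarrow> B\<close>, \<open>right F\<close> is \<open>F\<^sub>* : B \<rightarrow> A\<close>.
\<close>

record ('oa, 'ma, 'ob, 'mb) adj =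
  catA  :: "('oa, 'ma) cat"
  catB  :: "('ob, 'mb) cat"
  left  :: "('oa, 'ma, 'ob, 'mb) fctr"
  right :: "('ob, 'mb, 'oa, 'ma) fctr"
  aunit :: "'oa \<Rightarrow> 'ma"
  acounit :: "'ob \<Rightarrow> 'mb"

definition is_adjunction :: "('oa, 'ma, 'ob, 'mb) adj \<Rightarrow> bool" where
  "is_adjunction F \<longleftrightarrow>
     is_functor (catA F) (catB F) (left F) \<and>
     is_functor (catB F) (catA F) (right F) \<and>
     nat_trans (catA F) (catA F) fid (right F \<bullet> left F) (aunit F) \<and>
     nat_trans (catB F) (catB F) (left F \<bullet> right F) fid (acounit F) \<and>
     (\<forall>a\<in>Ob (catA F).
        acounit F (Fo (left F) a) \<cdot>\<^bsub>catB F\<^esub> Fa (left F) (aunit F a) = Ide (catB F) (Fo (left F) a)) \<and>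
     (\<forall>b\<in>Ob (catB F).
        Fa (right F) (acounit F b) \<cdot>\<^bsub>catA F\<^esub> aunit F (Fo (right F) b) = Ide (catA F) (Fo (right F) b))"

text \<open>
  A morphism \<open>(H, K, \<upsilon>\<^sup>*, \<upsilon>\<^sub>*) : F \<rightarrow> G\<close> with \<open>G = (G\<^sup>* \<stileturn> G\<^sub>* : D \<rightarrow> C)\<close>:
  \<open>mH : A \<rightarrow> C\<close>, \<open>mK : B \<rightarrow> D\<close>, \<open>upL a : K F\<^sup>* a \<rightarrow> G\<^sup>* H a\<close>, \<open>upR b : H F\<^sub>* b \<rightarrow> G\<^sub>* K b\<close>.
\<close>

record ('oa, 'ma, 'ob, 'mb, 'oc, 'mc, 'od, 'md) amor =
  mH  :: "('oa, 'ma, 'oc, 'mc) fctr"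
  mK  :: "('ob, 'mb, 'od, 'md) fctr"
  upL :: "'oa \<Rightarrow> 'md"
  upR :: "'ob \<Rightarrow> 'mc"

definition adj_morphism ::
  "('oa, 'ma, 'ob, 'mb) adj \<Rightarrow> ('oc, 'mc, 'od, 'md) adj \<Rightarrow>
   ('oa, 'ma, 'ob, 'mb, 'oc, 'mc, 'od, 'md) amor \<Rightarrow> bool"
where
  "adj_morphism F G \<Upsilon> \<longleftrightarrow>
     is_adjunction F \<and> is_adjunction G \<and>
     is_functor (catA F) (catA G) (mH \<Upsilon>) \<and>
     is_functor (catB F) (catB G) (mK \<Upsilon>) \<and>
     nat_iso (catA F) (catB G) (mK \<Upsilon> \<bullet> left F) (left G \<bullet> mH \<Upsilon>) (upL \<Upsilon>) \<and>
     nat_iso (catB F) (catA G) (mH \<Upsilon> \<bullet> right F) (right G \<bullet> mK \<Upsilon>) (upR \<Upsilon>) \<and>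
     (\<forall>a\<in>Ob (catA F).
        Fa (right G) (upL \<Upsilon> a) \<cdot>\<^bsub>catA G\<^esub> (upR \<Upsilon> (Fo (left F) a) \<cdot>\<^bsub>catA G\<^esub> Fa (mH \<Upsilon>) (aunit F a))
          = aunit G (Fo (mH \<Upsilon>) a)) \<and>
     (\<forall>b\<in>Ob (catB F).
        acounit G (Fo (mK \<Upsilon>) b) \<cdot>\<^bsub>catB G\<^esub> (Fa (left G) (upR \<Upsilon> b) \<cdot>\<^bsub>catB G\<^esub> upL \<Upsilon> (Fo (right F) b))
          = Fa (mK \<Upsilon>) (acounit F b))"

definition amor_id ::
  "('oa, 'ma, 'ob, 'mb) adj \<Rightarrow> ('oa, 'ma, 'ob, 'mb, 'oa, 'ma, 'ob, 'mb) amor"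
where
  "amor_id F =
     \<lparr>mH = fid, mK = fid,
      upL = (\<lambda>a. Ide (catB F) (Fo (left F) a)),
      upR = (\<lambda>b. Ide (catA F) (Fo (right F) b))\<rparr>"

text \<open>The first argument \<open>L\<close> of the composite is the target of \<open>\<Psi>\<close>.\<close>

definition amor_comp ::
  "('oe, 'me, 'of, 'mf) adj \<Rightarrow>
   ('oc, 'mc, 'od, 'md, 'oe, 'me, 'of, 'mf) amor \<Rightarrow>
   ('oa, 'ma, 'ob, 'mb, 'oc, 'mc, 'od, 'md) amor \<Rightarrow>
   ('oa, 'ma, 'ob, 'mb, 'oe, 'me, 'of, 'mf) amor"
where
  "amor_comp L \<Psi> \<Upsilon> =
     \<lparr>mH = mH \<Psi> \<bullet> mH \<Upsilon>, mK = mK \<Psi> \<bullet> mK \<Upsilon>,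
      upL = (\<lambda>a. upL \<Psi> (Fo (mH \<Upsilon>) a) \<cdot>\<^bsub>catB L\<^esub> Fa (mK \<Psi>) (upL \<Upsilon> a)),
      upR = (\<lambda>b. upR \<Psi> (Fo (mK \<Upsilon>) b) \<cdot>\<^bsub>catA L\<^esub> Fa (mH \<Psi>) (upR \<Upsilon> b))\<rparr>"

text \<open>
  Equality of morphisms with source \<open>F\<close>. Record equality would also compare the values of the
  underlying functions outside the carriers.
\<close>

definition amor_eq ::
  "('oa, 'ma, 'ob, 'mb) adj \<Rightarrow>
   ('oa, 'ma, 'ob, 'mb, 'oc, 'mc, 'od, 'md) amor \<Rightarrow>
   ('oa, 'ma, 'ob, 'mb, 'oc, 'mc, 'od, 'md) amor \<Rightarrow> bool"
where
  "amor_eq F \<Upsilon> \<Upsilon>' \<longleftrightarrow>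
     (\<forall>a\<in>Ob (catA F). Fo (mH \<Upsilon>) a = Fo (mH \<Upsilon>') a \<and> upL \<Upsilon> a = upL \<Upsilon>' a) \<and>
     (\<forall>f\<in>Arr (catA F). Fa (mH \<Upsilon>) f = Fa (mH \<Upsilon>') f) \<and>
     (\<forall>b\<in>Ob (catB F). Fo (mK \<Upsilon>) b = Fo (mK \<Upsilon>') b \<and> upR \<Upsilon> b = upR \<Upsilon>' b) \<and>
     (\<forall>g\<in>Arr (catB F). Fa (mK \<Upsilon>) g = Fa (mK \<Upsilon>') g)"

definition amor_iso ::
  "('oa, 'ma, 'ob, 'mb) adj \<Rightarrow> ('oc, 'mc, 'od, 'md) adj \<Rightarrow>
   ('oa, 'ma, 'ob, 'mb, 'oc, 'mc, 'od, 'md) amor \<Rightarrow>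
   ('oa, 'ma, 'ob, 'mb, 'oc, 'mc, 'od, 'md) amor \<Rightarrow> bool"
where
  "amor_iso F G \<Upsilon> \<Upsilon>' \<longleftrightarrow>
     adj_morphism F G \<Upsilon> \<and> adj_morphism F G \<Upsilon>' \<and>
     (\<exists>\<theta> \<phi>.
        nat_iso (catA F) (catA G) (mH \<Upsilon>) (mH \<Upsilon>') \<theta> \<and>
        nat_iso (catB F) (catB G) (mK \<Upsilon>) (mK \<Upsilon>') \<phi> \<and>
        (\<forall>a\<in>Ob (catA F).
           upL \<Upsilon>' a \<cdot>\<^bsub>catB G\<^esub> \<phi> (Fo (left F) a) = Fa (left G) (\<theta> a) \<cdot>\<^bsub>catB G\<^esub> upL \<Upsilon> a) \<and>
        (\<forall>b\<in>Ob (catB F).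
           upR \<Upsilon>' b \<cdot>\<^bsub>catA G\<^esub> \<theta> (Fo (right F) b) = Fa (right G) (\<phi> b) \<cdot>\<^bsub>catA G\<^esub> upR \<Upsilon> b))"

definition adj_equivalence ::
  "('oa, 'ma, 'ob, 'mb) adj \<Rightarrow> ('oc, 'mc, 'od, 'md) adj \<Rightarrow>
   ('oa, 'ma, 'ob, 'mb, 'oc, 'mc, 'od, 'md) amor \<Rightarrow> bool"
where
  "adj_equivalence F G \<Upsilon> \<longleftrightarrow>
     adj_morphism F G \<Upsilon> \<and>
     is_equivalence (catA F) (catA G) (mH \<Upsilon>) \<and>
     is_equivalence (catB F) (catB G) (mK \<Upsilon>)"


section \<open>Absolute completion\<close>

text \<open>
  The categories below have structured objects, and an underlying arrow of the base category can
  occur in several hom-sets; the datatype records source and target to keep hom-sets disjoint.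
\<close>

datatype ('x, 'm) arrow = Arrow (asrc: 'x) (base: 'm) (atgt: 'x)

definition structured_cat ::
  "'x set \<Rightarrow> ('x \<Rightarrow> 'x \<Rightarrow> 'm set) \<Rightarrow> ('x \<Rightarrow> 'm) \<Rightarrow> ('m \<Rightarrow> 'm \<Rightarrow> 'm) \<Rightarrow> ('x, ('x, 'm) arrow) cat"
where
  "structured_cat X h i c =
     \<lparr>Ob = X,
      Arr = {Arrow x f y | x f y. x \<in> X \<and> y \<in> X \<and> f \<in> h x y},
      Dom = asrc, Cod = atgt,
      Ide = (\<lambda>x. Arrow x (i x) x),
      Comp = (\<lambda>g f. Arrow (asrc f) (c (base g) (base f)) (atgt g))\<rparr>"

type_synonym ('o, 'm) kob = "'o \<times> 'm"
type_synonym ('o, 'm) karr = "('o \<times> 'm, 'm) arrow"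

definition karoubi :: "('o, 'm) cat \<Rightarrow> (('o, 'm) kob, ('o, 'm) karr) cat" where
  "karoubi C =
     structured_cat
       {(x, p). x \<in> Ob C \<and> p \<in> hom C x x \<and> p \<cdot>\<^bsub>C\<^esub> p = p}
       (\<lambda>(x, p) (y, q). {f \<in> hom C x y. q \<cdot>\<^bsub>C\<^esub> (f \<cdot>\<^bsub>C\<^esub> p) = f})
       snd
       (Comp C)"

definition karoubi_fctr ::
  "('o, 'm, 'p, 'n) fctr \<Rightarrow> (('o, 'm) kob, ('o, 'm) karr, ('p, 'n) kob, ('p, 'n) karr) fctr"
where
  "karoubi_fctr H =
     (let ho = (\<lambda>(x, p). (Fo H x, Fa H p))
      in \<lparr>Fo = ho, Fa = (\<lambda>f. Arrow (ho (asrc f)) (Fa H (base f)) (ho (atgt f)))\<rparr>)"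

text \<open>
  The lift of \<open>\<tau> : H \<rightarrow> H' : C \<rightarrow> D\<close>. The component at \<open>(x, p)\<close> is \<open>\<tau>\<^sub>x\<close> cut down by the idempotents
  of its source and target; by naturality one of them suffices.
\<close>

definition karoubi_trans ::
  "('p, 'n) cat \<Rightarrow> ('o, 'm, 'p, 'n) fctr \<Rightarrow> ('o, 'm, 'p, 'n) fctr \<Rightarrow> ('o \<Rightarrow> 'n) \<Rightarrow>
   ('o, 'm) kob \<Rightarrow> ('p, 'n) karr"
where
  "karoubi_trans D H H' \<tau> =
     (\<lambda>(x, p). Arrow (Fo (karoubi_fctr H) (x, p)) (\<tau> x \<cdot>\<^bsub>D\<^esub> Fa H p) (Fo (karoubi_fctr H') (x, p)))"

definition karoubi_adj ::
  "('oa, 'ma, 'ob, 'mb) adj \<Rightarrow>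
   (('oa, 'ma) kob, ('oa, 'ma) karr, ('ob, 'mb) kob, ('ob, 'mb) karr) adj"
where
  "karoubi_adj F =
     \<lparr>catA = karoubi (catA F), catB = karoubi (catB F),
      left = karoubi_fctr (left F), right = karoubi_fctr (right F),
      aunit = karoubi_trans (catA F) fid (right F \<bullet> left F) (aunit F),
      acounit = karoubi_trans (catB F) (left F \<bullet> right F) fid (acounit F)\<rparr>"

definition karoubi_amor ::
  "('oa, 'ma, 'ob, 'mb) adj \<Rightarrow> ('oc, 'mc, 'od, 'md) adj \<Rightarrow>
   ('oa, 'ma, 'ob, 'mb, 'oc, 'mc, 'od, 'md) amor \<Rightarrow>
   (('oa, 'ma) kob, ('oa, 'ma) karr, ('ob, 'mb) kob, ('ob, 'mb) karr,
    ('oc, 'mc) kob, ('oc, 'mc) karr, ('od, 'md) kob, ('od, 'md) karr) amor"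
where
  "karoubi_amor F G \<Upsilon> =
     \<lparr>mH = karoubi_fctr (mH \<Upsilon>), mK = karoubi_fctr (mK \<Upsilon>),
      upL = karoubi_trans (catB G) (mK \<Upsilon> \<bullet> left F) (left G \<bullet> mH \<Upsilon>) (upL \<Upsilon>),
      upR = karoubi_trans (catA G) (mH \<Upsilon> \<bullet> right F) (right G \<bullet> mK \<Upsilon>) (upR \<Upsilon>)\<rparr>"

definition karoubi_embed :: "('o, 'm) cat \<Rightarrow> ('o, 'm, ('o, 'm) kob, ('o, 'm) karr) fctr" where
  "karoubi_embed C =
     (let e = (\<lambda>x. (x, Ide C x))
      in \<lparr>Fo = e, Fa = (\<lambda>f. Arrow (e (Dom C f)) f (e (Cod C f)))\<rparr>)"

text \<open>The embedding of \<open>F\<close> into its completion; the 2-cells are identities.\<close>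

definition adj_embed ::
  "('oa, 'ma, 'ob, 'mb) adj \<Rightarrow>
   ('oa, 'ma, 'ob, 'mb, ('oa, 'ma) kob, ('oa, 'ma) karr, ('ob, 'mb) kob, ('ob, 'mb) karr) amor"
where
  "adj_embed F =
     \<lparr>mH = karoubi_embed (catA F), mK = karoubi_embed (catB F),
      upL = (\<lambda>a. Ide (karoubi (catB F)) (Fo (karoubi_embed (catB F)) (Fo (left F) a))),
      upR = (\<lambda>b. Ide (karoubi (catA F)) (Fo (karoubi_embed (catA F)) (Fo (right F) b)))\<rparr>"


section \<open>Algebras and coalgebras\<close>

record ('o, 'm) monad =
  mon_cat  :: "('o, 'm) cat"
  mon_fun  :: "('o, 'm, 'o, 'm) fctr"
  mon_unit :: "'o \<Rightarrow> 'm"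
  mon_mult :: "'o \<Rightarrow> 'm"

record ('o, 'm) comonad =
  com_cat    :: "('o, 'm) cat"
  com_fun    :: "('o, 'm, 'o, 'm) fctr"
  com_counit :: "'o \<Rightarrow> 'm"
  com_comult :: "'o \<Rightarrow> 'm"

definition adj_monad :: "('oa, 'ma, 'ob, 'mb) adj \<Rightarrow> ('oa, 'ma) monad" where
  "adj_monad F =
     \<lparr>mon_cat = catA F, mon_fun = right F \<bullet> left F, mon_unit = aunit F,
      mon_mult = (\<lambda>a. Fa (right F) (acounit F (Fo (left F) a)))\<rparr>"

definition adj_comonad :: "('oa, 'ma, 'ob, 'mb) adj \<Rightarrow> ('ob, 'mb) comonad" where
  "adj_comonad F =
     \<lparr>com_cat = catB F, com_fun = left F \<bullet> right F, com_counit = acounit F,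
      com_comult = (\<lambda>b. Fa (left F) (aunit F (Fo (right F) b)))\<rparr>"

definition algebras :: "('o, 'm) monad \<Rightarrow> ('o \<times> 'm, ('o \<times> 'm, 'm) arrow) cat" where
  "algebras T =
     (let C = mon_cat T; t = mon_fun T in
      structured_cat
        {(x, \<alpha>). x \<in> Ob C \<and> \<alpha> \<in> hom C (Fo t x) x \<and>
                 \<alpha> \<cdot>\<^bsub>C\<^esub> mon_unit T x = Ide C x \<and>
                 \<alpha> \<cdot>\<^bsub>C\<^esub> Fa t \<alpha> = \<alpha> \<cdot>\<^bsub>C\<^esub> mon_mult T x}
        (\<lambda>(x, \<alpha>) (y, \<beta>). {f \<in> hom C x y. f \<cdot>\<^bsub>C\<^esub> \<alpha> = \<beta> \<cdot>\<^bsub>C\<^esub> Fa t f})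
        (\<lambda>(x, \<alpha>). Ide C x)
        (Comp C))"

definition coalgebras :: "('o, 'm) comonad \<Rightarrow> ('o \<times> 'm, ('o \<times> 'm, 'm) arrow) cat" where
  "coalgebras W =
     (let C = com_cat W; w = com_fun W in
      structured_cat
        {(x, \<beta>). x \<in> Ob C \<and> \<beta> \<in> hom C x (Fo w x) \<and>
                 com_counit W x \<cdot>\<^bsub>C\<^esub> \<beta> = Ide C x \<and>
                 Fa w \<beta> \<cdot>\<^bsub>C\<^esub> \<beta> = com_comult W x \<cdot>\<^bsub>C\<^esub> \<beta>}
        (\<lambda>(x, \<alpha>) (y, \<beta>). {f \<in> hom C x y. \<beta> \<cdot>\<^bsub>C\<^esub> f = Fa w f \<cdot>\<^bsub>C\<^esub> \<alpha>})
        (\<lambda>(x, \<beta>). Ide C x)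
        (Comp C))"

definition Alg :: "('oa, 'ma, 'ob, 'mb) adj \<Rightarrow> ('oa \<times> 'ma, ('oa \<times> 'ma, 'ma) arrow) cat" where
  "Alg F = algebras (adj_monad F)"

definition Coalg :: "('oa, 'ma, 'ob, 'mb) adj \<Rightarrow> ('ob \<times> 'mb, ('ob \<times> 'mb, 'mb) arrow) cat" where
  "Coalg F = coalgebras (adj_comonad F)"

text \<open>The functor forgetting the structure; it serves as \<open>U\<^sub>F\<close> on algebras and \<open>V\<^sup>F\<close> on coalgebras.\<close>

definition forget :: "('o \<times> 'm, ('o \<times> 'm, 'm) arrow, 'o, 'm) fctr" where
  "forget = \<lparr>Fo = fst, Fa = base\<rparr>"

definition kappa0 ::
  "('oa, 'ma, 'ob, 'mb) adj \<Rightarrow> ('oa, 'ma, 'ob \<times> 'mb, ('ob \<times> 'mb, 'mb) arrow) fctr"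
where
  "kappa0 F =
     (let k = (\<lambda>a. (Fo (left F) a, Fa (left F) (aunit F a)))
      in \<lparr>Fo = k, Fa = (\<lambda>f. Arrow (k (Dom (catA F) f)) (Fa (left F) f) (k (Cod (catA F) f)))\<rparr>)"

definition kappa1 ::
  "('oa, 'ma, 'ob, 'mb) adj \<Rightarrow> ('ob, 'mb, 'oa \<times> 'ma, ('oa \<times> 'ma, 'ma) arrow) fctr"
where
  "kappa1 F =
     (let k = (\<lambda>b. (Fo (right F) b, Fa (right F) (acounit F b)))
      in \<lparr>Fo = k, Fa = (\<lambda>g. Arrow (k (Dom (catB F) g)) (Fa (right F) g) (k (Cod (catB F) g)))\<rparr>)"


section \<open>The nucleus\<close>

text \<open>
  \<open>nuc F\<close> is the nucleus construction without prior completion; it is \<open>\<^bold>N(F)\<close> when all idempotents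
  split, the convention identifying a category having split idempotents with its completion being
  in force. The adjunction is determined by the hom-bijection sending \<open>f : F\<^sup>\<sharp>\<beta> \<rightarrow> \<alpha>\<close> to
  \<open>F\<^sup>*f \<cdot> \<beta>\<close>: the unit at \<open>\<beta>\<close> is the transpose of the identity, with underlying arrow \<open>\<beta>\<close>
  itself, and the counit at \<open>\<alpha>\<close> is the arrow whose transpose is the identity, namely \<open>\<alpha>\<close>
  (as \<open>F\<^sup>*\<alpha> \<cdot> F\<^sup>*\<eta> = id\<close>).
\<close>

type_synonym ('o, 'm) str = "'o \<times> 'm"
type_synonym ('o, 'm) sarr = "('o \<times> 'm, 'm) arrow"

definition nuc ::
  "('oa, 'ma, 'ob, 'mb) adj \<Rightarrow>
   (('ob, 'mb) str, ('ob, 'mb) sarr, ('oa, 'ma) str, ('oa, 'ma) sarr) adj"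
where
  "nuc F =
     (let sharpL = kappa1 F \<bullet> forget; sharpR = kappa0 F \<bullet> forget in
      \<lparr>catA = Coalg F, catB = Alg F, left = sharpL, right = sharpR,
       aunit = (\<lambda>(b, \<beta>). Arrow (b, \<beta>) \<beta> (Fo sharpR (Fo sharpL (b, \<beta>)))),
       acounit = (\<lambda>(a, \<alpha>). Arrow (Fo sharpL (Fo sharpR (a, \<alpha>))) \<alpha> (a, \<alpha>))\<rparr>)"

definition coalg_lift ::
  "('oa, 'ma, 'ob, 'mb) adj \<Rightarrow> ('oc, 'mc, 'od, 'md) adj \<Rightarrow>
   ('oa, 'ma, 'ob, 'mb, 'oc, 'mc, 'od, 'md) amor \<Rightarrow>
   (('ob, 'mb) str, ('ob, 'mb) sarr, ('od, 'md) str, ('od, 'md) sarr) fctr"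
where
  "coalg_lift F G \<Upsilon> =
     (let K = mK \<Upsilon>;
          k = (\<lambda>(b, \<beta>). (Fo K b,
                 Fa (left G) (upR \<Upsilon> b) \<cdot>\<^bsub>catB G\<^esub> (upL \<Upsilon> (Fo (right F) b) \<cdot>\<^bsub>catB G\<^esub> Fa K \<beta>)))
      in \<lparr>Fo = k, Fa = (\<lambda>g. Arrow (k (asrc g)) (Fa K (base g)) (k (atgt g)))\<rparr>)"

definition alg_lift ::
  "('oa, 'ma, 'ob, 'mb) adj \<Rightarrow> ('oc, 'mc, 'od, 'md) adj \<Rightarrow>
   ('oa, 'ma, 'ob, 'mb, 'oc, 'mc, 'od, 'md) amor \<Rightarrow>
   (('oa, 'ma) str, ('oa, 'ma) sarr, ('oc, 'mc) str, ('oc, 'mc) sarr) fctr"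
where
  "alg_lift F G \<Upsilon> =
     (let H = mH \<Upsilon>;
          h = (\<lambda>(a, \<alpha>). (Fo H a,
                 Fa H \<alpha> \<cdot>\<^bsub>catA G\<^esub>
                   (inv_arr (catA G) (upR \<Upsilon> (Fo (left F) a)) \<cdot>\<^bsub>catA G\<^esub>
                    Fa (right G) (inv_arr (catB G) (upL \<Upsilon> a)))))
      in \<lparr>Fo = h, Fa = (\<lambda>f. Arrow (h (asrc f)) (Fa H (base f)) (h (atgt f)))\<rparr>)"

definition nuc_amor ::
  "('oa, 'ma, 'ob, 'mb) adj \<Rightarrow> ('oc, 'mc, 'od, 'md) adj \<Rightarrow>
   ('oa, 'ma, 'ob, 'mb, 'oc, 'mc, 'od, 'md) amor \<Rightarrow>
   (('ob, 'mb) str, ('ob, 'mb) sarr, ('oa, 'ma) str, ('oa, 'ma) sarr,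
    ('od, 'md) str, ('od, 'md) sarr, ('oc, 'mc) str, ('oc, 'mc) sarr) amor"
where
  "nuc_amor F G \<Upsilon> =
     (let K = coalg_lift F G \<Upsilon>; H = alg_lift F G \<Upsilon> in
      \<lparr>mH = K, mK = H,
       upL = (\<lambda>(b, \<beta>). Arrow (Fo H (Fo (left (nuc F)) (b, \<beta>))) (upR \<Upsilon> b)
                             (Fo (left (nuc G)) (Fo K (b, \<beta>)))),
       upR = (\<lambda>(a, \<alpha>). Arrow (Fo K (Fo (right (nuc F)) (a, \<alpha>))) (upL \<Upsilon> a)
                             (Fo (right (nuc G)) (Fo H (a, \<alpha>))))\<rparr>)"

text \<open>The comparison morphism \<open>(\<kappa>\<^sup>0, \<kappa>\<^sub>1) : F \<rightarrow> nuc F\<close>; its 2-cells are identities.\<close>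

definition comparison ::
  "('oa, 'ma, 'ob, 'mb) adj \<Rightarrow>
   ('oa, 'ma, 'ob, 'mb, ('ob, 'mb) str, ('ob, 'mb) sarr, ('oa, 'ma) str, ('oa, 'ma) sarr) amor"
where
  "comparison F =
     \<lparr>mH = kappa0 F, mK = kappa1 F,
      upL = (\<lambda>a. Ide (Alg F) (Fo (kappa1 F) (Fo (left F) a))),
      upR = (\<lambda>b. Ide (Coalg F) (Fo (kappa0 F) (Fo (right F) b)))\<rparr>"

type_synonym ('o, 'm) nob = "(('o, 'm) kob, ('o, 'm) karr) str"
type_synonym ('o, 'm) narr = "(('o, 'm) kob, ('o, 'm) karr) sarr"

definition Nuc ::
  "('oa, 'ma, 'ob, 'mb) adj \<Rightarrow>
   (('ob, 'mb) nob, ('ob, 'mb) narr, ('oa, 'ma) nob, ('oa, 'ma) narr) adj"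
where
  "Nuc F = nuc (karoubi_adj F)"

definition Nuc_amor ::
  "('oa, 'ma, 'ob, 'mb) adj \<Rightarrow> ('oc, 'mc, 'od, 'md) adj \<Rightarrow>
   ('oa, 'ma, 'ob, 'mb, 'oc, 'mc, 'od, 'md) amor \<Rightarrow>
   (('ob, 'mb) nob, ('ob, 'mb) narr, ('oa, 'ma) nob, ('oa, 'ma) narr,
    ('od, 'md) nob, ('od, 'md) narr, ('oc, 'mc) nob, ('oc, 'mc) narr) amor"
where
  "Nuc_amor F G \<Upsilon> = nuc_amor (karoubi_adj F) (karoubi_adj G) (karoubi_amor F G \<Upsilon>)"

definition Nuc_unit ::
  "('oa, 'ma, 'ob, 'mb) adj \<Rightarrow>
   ('oa, 'ma, 'ob, 'mb, ('ob, 'mb) nob, ('ob, 'mb) narr, ('oa, 'ma) nob, ('oa, 'ma) narr) amor"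
where
  "Nuc_unit F = amor_comp (Nuc F) (comparison (karoubi_adj F)) (adj_embed F)"

text \<open>
  The multiplication is defined as a chosen quasi-inverse of the unit component at \<open>Nuc F\<close>, and
  is thereby unique up to isomorphism. That a quasi-inverse exists and that the monad laws hold is
  not part of the definition.
\<close>

definition Nuc_mult ::
  "('oa, 'ma, 'ob, 'mb) adj \<Rightarrow>
   ((('oa, 'ma) nob, ('oa, 'ma) narr) nob, (('oa, 'ma) nob, ('oa, 'ma) narr) narr,
    (('ob, 'mb) nob, ('ob, 'mb) narr) nob, (('ob, 'mb) nob, ('ob, 'mb) narr) narr,
    ('ob, 'mb) nob, ('ob, 'mb) narr, ('oa, 'ma) nob, ('oa, 'ma) narr) amor"
where
  "Nuc_mult F =
     (SOME M. adj_morphism (Nuc (Nuc F)) (Nuc F) M \<and>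
        amor_iso (Nuc F) (Nuc F) (amor_comp (Nuc F) M (Nuc_unit (Nuc F))) (amor_id (Nuc F)) \<and>
        amor_iso (Nuc (Nuc F)) (Nuc (Nuc F))
          (amor_comp (Nuc (Nuc F)) (Nuc_unit (Nuc F)) M) (amor_id (Nuc (Nuc F))))"

end

theory Submission
  imports Defs
begin

text \<open>
  An object of \<open>Coalg (nuc F)\<close> is an algebra \<open>\<alpha> : RLa \<rightarrow> a\<close> together with a coassociative section
  \<open>\<gamma> : a \<rightarrow> RLa\<close> of \<open>\<alpha>\<close> that is a homomorphism of algebras. Then \<open>\<epsilon> \<cdot> L\<gamma>\<close> is an idempotent on \<open>La\<close>
  lying over \<open>\<gamma> \<cdot> \<alpha>\<close>, and splitting it yields a coalgebra \<open>(b, \<beta>)\<close> with \<open>Rb \<cong> a\<close>; hence the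
  comparison functors of a nucleus are equivalences as soon as idempotents split. So the unit at a
  nucleus has a quasi-inverse in the 2-category of adjunctions. As the nucleus functor sends the
  comparison of \<open>F\<close> to the comparison of \<open>nuc F\<close>, the monad is well-pointed, and its laws reduce to
  the uniqueness of quasi-inverses.
\<close>

section \<open>Categories, functors and natural transformations\<close>

text \<open>The idempotent on \<open>La\<close> is the transpose of
  \<open>\<gamma> : a -> RLa\<close>. That \<open>\<gamma>\<close> is a homomorphism says exactly
  that \<open>R\<close> sends this idempotent to \<open>\<gamma> \<alpha>\<close>, which already
  splits through \<open>a\<close>. This is why the coalgebra is sought among the retracts of
  \<open>La\<close>, and why splitting idempotents is the right amount of completeness. Two
  obstacles shape the rest. The unit of \<open>Nuc\<close> at a nucleus still embeds categories with
  split idempotents into their completions; that embedding is an equivalence and not an identity, so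
  it has to be carried through every law. Completion is itself well-pointed, but only up to an
  isomorphism, because the two embeddings of a completion into its own completion differ. Moreover,
  an equivalence of adjunctions asks only for two equivalences of categories, whereas the
  multiplication must be a morphism of adjunctions; its 2-cells are therefore constructed by lifting
  along fully faithful functors, and all equations are tested after applying those functors.\<close>

lemma in_hom [simp]: "f \<in> hom C x y \<longleftrightarrow> f \<in> Arr C \<and> Dom C f = x \<and> Cod C f = y"
  by (simp add: hom_def)

text \<open>The definition quantifies over hom-sets and their objects. Here composability is a
  single equation between \<open>Dom\<close> and \<open>Cod\<close>, which the simplifier can
  discharge; the introduction rules for functors and transformations follow the same
  pattern.\<close>

lemma is_categoryI:
  assumes "\<And>f. f \<in> Arr C \<Longrightarrow> Dom C f \<in> Ob C" "\<And>f. f \<in> Arr C \<Longrightarrow> Cod C f \<in> Ob C"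
    "\<And>x. x \<in> Ob C \<Longrightarrow> Ide C x \<in> Arr C \<and> Dom C (Ide C x) = x \<and> Cod C (Ide C x) = x"
    "\<And>f g. \<lbrakk>f \<in> Arr C; g \<in> Arr C; Dom C g = Cod C f\<rbrakk>
       \<Longrightarrow> g \<cdot>\<^bsub>C\<^esub> f \<in> Arr C \<and> Dom C (g \<cdot>\<^bsub>C\<^esub> f) = Dom C f \<and> Cod C (g \<cdot>\<^bsub>C\<^esub> f) = Cod C g"
    "\<And>f. f \<in> Arr C \<Longrightarrow> f \<cdot>\<^bsub>C\<^esub> Ide C (Dom C f) = f \<and> Ide C (Cod C f) \<cdot>\<^bsub>C\<^esub> f = f"
    "\<And>f g h. \<lbrakk>f \<in> Arr C; g \<in> Arr C; h \<in> Arr C; Dom C g = Cod C f; Dom C h = Cod C g\<rbrakk>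
       \<Longrightarrow> h \<cdot>\<^bsub>C\<^esub> g \<cdot>\<^bsub>C\<^esub> f = (h \<cdot>\<^bsub>C\<^esub> g) \<cdot>\<^bsub>C\<^esub> f"
  shows "is_category C"
  unfolding is_category_def using assms by auto

context
  fixes C :: "('o, 'm) cat"
  assumes C: "is_category C"
begin

lemma Dom_Ob [simp]: "f \<in> Arr C \<Longrightarrow> Dom C f \<in> Ob C"
  and Cod_Ob [simp]: "f \<in> Arr C \<Longrightarrow> Cod C f \<in> Ob C"
  and Ide_Arr [simp]: "x \<in> Ob C \<Longrightarrow> Ide C x \<in> Arr C"
  and Dom_Ide [simp]: "x \<in> Ob C \<Longrightarrow> Dom C (Ide C x) = x"
  and Cod_Ide [simp]: "x \<in> Ob C \<Longrightarrow> Cod C (Ide C x) = x"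
  using C unfolding is_category_def by simp_all

lemma Comp_all:
  assumes "f \<in> Arr C" "g \<in> Arr C" "Dom C g = Cod C f"
  shows "g \<cdot>\<^bsub>C\<^esub> f \<in> Arr C \<and> Dom C (g \<cdot>\<^bsub>C\<^esub> f) = Dom C f \<and> Cod C (g \<cdot>\<^bsub>C\<^esub> f) = Cod C g"
proof -
  have "\<forall>x\<in>Ob C. \<forall>y\<in>Ob C. \<forall>z\<in>Ob C. \<forall>f\<in>hom C x y. \<forall>g\<in>hom C y z. g \<cdot>\<^bsub>C\<^esub> f \<in> hom C x z"
    using C unfolding is_category_def by blast
  from this[rule_format, of "Dom C f" "Cod C f" "Cod C g" f g] show ?thesis
    using assms by simp
qed

lemma Comp_Arr [simp]: "\<lbrakk>f \<in> Arr C; g \<in> Arr C; Dom C g = Cod C f\<rbrakk> \<Longrightarrow> g \<cdot>\<^bsub>C\<^esub> f \<in> Arr C"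
  and Dom_Comp [simp]: "\<lbrakk>f \<in> Arr C; g \<in> Arr C; Dom C g = Cod C f\<rbrakk> \<Longrightarrow> Dom C (g \<cdot>\<^bsub>C\<^esub> f) = Dom C f"
  and Cod_Comp [simp]: "\<lbrakk>f \<in> Arr C; g \<in> Arr C; Dom C g = Cod C f\<rbrakk> \<Longrightarrow> Cod C (g \<cdot>\<^bsub>C\<^esub> f) = Cod C g"
  using Comp_all by blast+

lemma Comp_Ide [simp]: "\<lbrakk>f \<in> Arr C; Dom C f = x\<rbrakk> \<Longrightarrow> f \<cdot>\<^bsub>C\<^esub> Ide C x = f"
  and Ide_Comp [simp]: "\<lbrakk>f \<in> Arr C; Cod C f = y\<rbrakk> \<Longrightarrow> Ide C y \<cdot>\<^bsub>C\<^esub> f = f"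
proof -
  have *: "\<forall>x\<in>Ob C. \<forall>y\<in>Ob C. \<forall>f\<in>hom C x y. f \<cdot>\<^bsub>C\<^esub> Ide C x = f \<and> Ide C y \<cdot>\<^bsub>C\<^esub> f = f"
    using C unfolding is_category_def by blast
  show "\<lbrakk>f \<in> Arr C; Dom C f = x\<rbrakk> \<Longrightarrow> f \<cdot>\<^bsub>C\<^esub> Ide C x = f"
    using *[rule_format, of "Dom C f" "Cod C f" f] by auto
  show "\<lbrakk>f \<in> Arr C; Cod C f = y\<rbrakk> \<Longrightarrow> Ide C y \<cdot>\<^bsub>C\<^esub> f = f"
    using *[rule_format, of "Dom C f" "Cod C f" f] by auto
qed

lemma Comp_assoc [simp]:
  assumes "f \<in> Arr C" "g \<in> Arr C" "h \<in> Arr C" "Dom C g = Cod C f" "Dom C h = Cod C g"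
  shows "(h \<cdot>\<^bsub>C\<^esub> g) \<cdot>\<^bsub>C\<^esub> f = h \<cdot>\<^bsub>C\<^esub> g \<cdot>\<^bsub>C\<^esub> f"
proof -
  have "\<forall>w\<in>Ob C. \<forall>x\<in>Ob C. \<forall>y\<in>Ob C. \<forall>z\<in>Ob C. \<forall>f\<in>hom C w x. \<forall>g\<in>hom C x y. \<forall>h\<in>hom C y z.
        h \<cdot>\<^bsub>C\<^esub> (g \<cdot>\<^bsub>C\<^esub> f) = (h \<cdot>\<^bsub>C\<^esub> g) \<cdot>\<^bsub>C\<^esub> f"
    using C unfolding is_category_def by blast
  from this[rule_format, of "Dom C f" "Cod C f" "Cod C g" "Cod C h" f g h] show ?thesis
    using assms by simp
qed

text \<open>Since \<open>Comp_assoc\<close> nests composites to the right, the left side of an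
  equation \<open>a b = c\<close> is no longer a subterm once a further arrow \<open>k\<close>
  stands behind it. This lemma and its variants supply the equation with such a tail.\<close>

lemma Comp_reduce:
  assumes "a \<cdot>\<^bsub>C\<^esub> b = c" "a \<in> Arr C" "b \<in> Arr C" "k \<in> Arr C" "Dom C a = Cod C b" "Dom C b = Cod C k"
  shows "a \<cdot>\<^bsub>C\<^esub> b \<cdot>\<^bsub>C\<^esub> k = c \<cdot>\<^bsub>C\<^esub> k"
  using assms Comp_assoc by metis

lemma Comp_reduce3:
  assumes "a \<cdot>\<^bsub>C\<^esub> b \<cdot>\<^bsub>C\<^esub> c = d" "a \<in> Arr C" "b \<in> Arr C" "c \<in> Arr C" "k \<in> Arr C"
    "Dom C a = Cod C b" "Dom C b = Cod C c" "Dom C c = Cod C k"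
  shows "a \<cdot>\<^bsub>C\<^esub> b \<cdot>\<^bsub>C\<^esub> c \<cdot>\<^bsub>C\<^esub> k = d \<cdot>\<^bsub>C\<^esub> k"
  using assms Comp_assoc[of k c b] Comp_reduce[of a "b \<cdot>\<^bsub>C\<^esub> c" d k] by simp

lemma Comp_reduce2:
  assumes "a \<cdot>\<^bsub>C\<^esub> b = c \<cdot>\<^bsub>C\<^esub> d" "a \<in> Arr C" "b \<in> Arr C" "c \<in> Arr C" "d \<in> Arr C" "k \<in> Arr C"
    "Dom C a = Cod C b" "Dom C b = Cod C k" "Dom C c = Cod C d" "Dom C d = Cod C k"
  shows "a \<cdot>\<^bsub>C\<^esub> b \<cdot>\<^bsub>C\<^esub> k = c \<cdot>\<^bsub>C\<^esub> d \<cdot>\<^bsub>C\<^esub> k"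
  using assms Comp_assoc by metis

text \<open>In \<open>Comp_reduce\<close> the arrow \<open>c\<close> does not occur in the left
  side, so its equation must be supplied by hand. When \<open>c\<close> is one of the two factors,
  as with idempotents, the rule can rewrite unaided.\<close>

lemma Comp_absorb:
  "\<lbrakk>a \<cdot>\<^bsub>C\<^esub> b = a; a \<in> Arr C; b \<in> Arr C; k \<in> Arr C; Dom C a = Cod C b; Dom C b = Cod C k\<rbrakk>
    \<Longrightarrow> a \<cdot>\<^bsub>C\<^esub> b \<cdot>\<^bsub>C\<^esub> k = a \<cdot>\<^bsub>C\<^esub> k"
  "\<lbrakk>a \<cdot>\<^bsub>C\<^esub> b = b; a \<in> Arr C; b \<in> Arr C; k \<in> Arr C; Dom C a = Cod C b; Dom C b = Cod C k\<rbrakk>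
    \<Longrightarrow> a \<cdot>\<^bsub>C\<^esub> b \<cdot>\<^bsub>C\<^esub> k = b \<cdot>\<^bsub>C\<^esub> k"
  by (rule Comp_reduce; assumption)+

lemma inverse_arrows_unique:
  assumes "inverse_arrows C f g" "inverse_arrows C f h"
  shows "g = h"
proof -
  have "g = g \<cdot>\<^bsub>C\<^esub> f \<cdot>\<^bsub>C\<^esub> h" using assms by (simp add: inverse_arrows_def)
  also have "\<dots> = (g \<cdot>\<^bsub>C\<^esub> f) \<cdot>\<^bsub>C\<^esub> h" using assms by (subst Comp_assoc) (auto simp: inverse_arrows_def)
  also have "\<dots> = h" using assms by (simp add: inverse_arrows_def)
  finally show ?thesis .
qed

lemma inv_arrI: "inverse_arrows C f g \<Longrightarrow> inv_arr C f = g"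
  unfolding inv_arr_def using inverse_arrows_unique by blast

lemma inverse_arrows_inv: "is_iso C f \<Longrightarrow> inverse_arrows C f (inv_arr C f)"
  unfolding is_iso_def using inv_arrI by blast

lemma is_iso_Arr: "is_iso C f \<Longrightarrow> f \<in> Arr C"
  by (auto simp: is_iso_def inverse_arrows_def)

lemma inv_Arr [simp]: "is_iso C f \<Longrightarrow> inv_arr C f \<in> Arr C"
  and Dom_inv [simp]: "is_iso C f \<Longrightarrow> Dom C (inv_arr C f) = Cod C f"
  and Cod_inv [simp]: "is_iso C f \<Longrightarrow> Cod C (inv_arr C f) = Dom C f"
  and inv_Comp [simp]: "is_iso C f \<Longrightarrow> inv_arr C f \<cdot>\<^bsub>C\<^esub> f = Ide C (Dom C f)"
  and Comp_inv [simp]: "is_iso C f \<Longrightarrow> f \<cdot>\<^bsub>C\<^esub> inv_arr C f = Ide C (Cod C f)"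
  using inverse_arrows_inv[of f] by (auto simp: inverse_arrows_def)

lemma inv_Comp_reduce [simp]:
    "\<lbrakk>is_iso C f; k \<in> Arr C; Cod C k = Dom C f\<rbrakk> \<Longrightarrow> inv_arr C f \<cdot>\<^bsub>C\<^esub> f \<cdot>\<^bsub>C\<^esub> k = k"
  and Comp_inv_reduce [simp]:
    "\<lbrakk>is_iso C f; k \<in> Arr C; Cod C k = Cod C f\<rbrakk> \<Longrightarrow> f \<cdot>\<^bsub>C\<^esub> inv_arr C f \<cdot>\<^bsub>C\<^esub> k = k"
  using Comp_reduce[OF inv_Comp, of f k] Comp_reduce[OF Comp_inv, of f k] is_iso_Arr[of f] by auto

lemma is_iso_inv [simp]: "is_iso C f \<Longrightarrow> is_iso C (inv_arr C f)"
  using inverse_arrows_inv[of f] unfolding is_iso_def inverse_arrows_def by fastforce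

lemma is_isoI:
  assumes "f \<in> Arr C" "g \<in> Arr C" "Dom C g = Cod C f" "Cod C g = Dom C f"
    "g \<cdot>\<^bsub>C\<^esub> f = Ide C (Dom C f)" "f \<cdot>\<^bsub>C\<^esub> g = Ide C (Cod C f)"
  shows "is_iso C f" "inv_arr C f = g"
proof -
  have *: "inverse_arrows C f g" using assms by (simp add: inverse_arrows_def)
  then show "is_iso C f" unfolding is_iso_def by blast
  from * show "inv_arr C f = g" by (rule inv_arrI)
qed

lemma iso_Ide [simp]: "x \<in> Ob C \<Longrightarrow> is_iso C (Ide C x)"
  and inv_Ide [simp]: "x \<in> Ob C \<Longrightarrow> inv_arr C (Ide C x) = Ide C x"
  by (rule is_isoI[of _ "Ide C x"]; simp)+

lemma iso_Comp:
  assumes "is_iso C f" "is_iso C g" "Dom C g = Cod C f"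
  shows "is_iso C (g \<cdot>\<^bsub>C\<^esub> f)" "inv_arr C (g \<cdot>\<^bsub>C\<^esub> f) = inv_arr C f \<cdot>\<^bsub>C\<^esub> inv_arr C g"
  by (rule is_isoI[of _ "inv_arr C f \<cdot>\<^bsub>C\<^esub> inv_arr C g"]; use assms in \<open>simp add: is_iso_Arr\<close>)+

lemma iso_mono:
  assumes "is_iso C f" "g \<in> Arr C" "h \<in> Arr C" "Cod C g = Dom C f" "Cod C h = Dom C f"
    "f \<cdot>\<^bsub>C\<^esub> g = f \<cdot>\<^bsub>C\<^esub> h"
  shows "g = h"
  using assms inv_Comp_reduce by metis

lemma iso_epi:
  assumes "is_iso C f" "g \<in> Arr C" "h \<in> Arr C" "Dom C g = Cod C f" "Dom C h = Cod C f"
    "g \<cdot>\<^bsub>C\<^esub> f = h \<cdot>\<^bsub>C\<^esub> f"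
  shows "g = h"
proof -
  have "g = (g \<cdot>\<^bsub>C\<^esub> f) \<cdot>\<^bsub>C\<^esub> inv_arr C f" "h = (h \<cdot>\<^bsub>C\<^esub> f) \<cdot>\<^bsub>C\<^esub> inv_arr C f"
    using assms(1-5) by (simp_all add: is_iso_Arr)
  then show ?thesis using assms(6) by simp
qed

end

section \<open>Functors and natural transformations\<close>

lemma is_functorI:
  assumes "is_category C" "is_category D"
    "\<And>x. x \<in> Ob C \<Longrightarrow> Fo H x \<in> Ob D"
    "\<And>f. f \<in> Arr C \<Longrightarrow> Fa H f \<in> Arr D \<and> Dom D (Fa H f) = Fo H (Dom C f) \<and> Cod D (Fa H f) = Fo H (Cod C f)"
    "\<And>x. x \<in> Ob C \<Longrightarrow> Fa H (Ide C x) = Ide D (Fo H x)"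
    "\<And>f g. \<lbrakk>f \<in> Arr C; g \<in> Arr C; Dom C g = Cod C f\<rbrakk> \<Longrightarrow> Fa H (g \<cdot>\<^bsub>C\<^esub> f) = Fa H g \<cdot>\<^bsub>D\<^esub> Fa H f"
  shows "is_functor C D H"
  unfolding is_functor_def using assms by auto

lemma nat_transI:
  assumes "is_functor C D H" "is_functor C D H'"
    "\<And>x. x \<in> Ob C \<Longrightarrow> \<tau> x \<in> Arr D \<and> Dom D (\<tau> x) = Fo H x \<and> Cod D (\<tau> x) = Fo H' x"
    "\<And>f. f \<in> Arr C \<Longrightarrow> \<tau> (Cod C f) \<cdot>\<^bsub>D\<^esub> Fa H f = Fa H' f \<cdot>\<^bsub>D\<^esub> \<tau> (Dom C f)"
  shows "nat_trans C D H H' \<tau>"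
  unfolding nat_trans_def using assms by auto

lemma nat_isoI:
  assumes "is_functor C D H" "is_functor C D H'"
    "\<And>x. x \<in> Ob C \<Longrightarrow> \<tau> x \<in> Arr D \<and> Dom D (\<tau> x) = Fo H x \<and> Cod D (\<tau> x) = Fo H' x"
    "\<And>f. f \<in> Arr C \<Longrightarrow> \<tau> (Cod C f) \<cdot>\<^bsub>D\<^esub> Fa H f = Fa H' f \<cdot>\<^bsub>D\<^esub> \<tau> (Dom C f)"
    "\<And>x. x \<in> Ob C \<Longrightarrow> is_iso D (\<tau> x)"
  shows "nat_iso C D H H' \<tau>"
  unfolding nat_iso_def using assms nat_transI by blast

lemma fid_simps [simp]: "Fo fid x = x" "Fa fid f = f"
  by (simp_all add: fid_def)

lemma fcomp_simps [simp]: "Fo (K \<bullet> H) x = Fo K (Fo H x)" "Fa (K \<bullet> H) f = Fa K (Fa H f)"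
  by (simp_all add: fcomp_def)

locale cat_functor =
  fixes C :: "('o, 'm) cat" and D :: "('p, 'n) cat" and H :: "('o, 'm, 'p, 'n) fctr"
  assumes is_functor: "is_functor C D H"
begin

lemma cats [simp]: "is_category C" "is_category D"
  using is_functor by (auto simp: is_functor_def)

lemma Fo_Ob [simp]: "x \<in> Ob C \<Longrightarrow> Fo H x \<in> Ob D"
  using is_functor by (auto simp: is_functor_def)

lemma Fa_all: "f \<in> Arr C \<Longrightarrow> Fa H f \<in> hom D (Fo H (Dom C f)) (Fo H (Cod C f))"
proof -
  assume f: "f \<in> Arr C"
  have "\<forall>x\<in>Ob C. \<forall>y\<in>Ob C. \<forall>f\<in>hom C x y. Fa H f \<in> hom D (Fo H x) (Fo H y)"
    using is_functor unfolding is_functor_def by blast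
  from this[rule_format, of "Dom C f" "Cod C f" f] show ?thesis
    using f by simp
qed

lemma Fa_Arr [simp]: "f \<in> Arr C \<Longrightarrow> Fa H f \<in> Arr D"
  and Dom_Fa [simp]: "f \<in> Arr C \<Longrightarrow> Dom D (Fa H f) = Fo H (Dom C f)"
  and Cod_Fa [simp]: "f \<in> Arr C \<Longrightarrow> Cod D (Fa H f) = Fo H (Cod C f)"
  using Fa_all by auto

lemma Fa_Ide [simp]: "x \<in> Ob C \<Longrightarrow> Fa H (Ide C x) = Ide D (Fo H x)"
  using is_functor by (auto simp: is_functor_def)

lemma Fa_Comp [simp]:
  assumes "f \<in> Arr C" "g \<in> Arr C" "Dom C g = Cod C f"
  shows "Fa H (g \<cdot>\<^bsub>C\<^esub> f) = Fa H g \<cdot>\<^bsub>D\<^esub> Fa H f"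
proof -
  have "\<forall>x\<in>Ob C. \<forall>y\<in>Ob C. \<forall>z\<in>Ob C. \<forall>f\<in>hom C x y. \<forall>g\<in>hom C y z.
        Fa H (g \<cdot>\<^bsub>C\<^esub> f) = Fa H g \<cdot>\<^bsub>D\<^esub> Fa H f"
    using is_functor unfolding is_functor_def by blast
  from this[rule_format, of "Dom C f" "Cod C f" "Cod C g" f g] show ?thesis
    using assms by simp
qed

text \<open>\<open>Fa_Comp\<close> distributes a functor over composites, so an equation of
  \<open>C\<close> is met in \<open>D\<close> only with \<open>Fa H\<close> applied to each factor.
  This lemma and its variants transport equations into that shape, with and without a tail.\<close>

lemma Fa_eq:
  assumes "f \<cdot>\<^bsub>C\<^esub> g = h" "f \<in> Arr C" "g \<in> Arr C" "Dom C f = Cod C g"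
  shows "Fa H f \<cdot>\<^bsub>D\<^esub> Fa H g = Fa H h"
    "\<lbrakk>k \<in> Arr D; Cod D k = Fo H (Dom C g)\<rbrakk> \<Longrightarrow> Fa H f \<cdot>\<^bsub>D\<^esub> Fa H g \<cdot>\<^bsub>D\<^esub> k = Fa H h \<cdot>\<^bsub>D\<^esub> k"
proof -
  show 1: "Fa H f \<cdot>\<^bsub>D\<^esub> Fa H g = Fa H h"
    using assms Fa_Comp by metis
  show "Fa H f \<cdot>\<^bsub>D\<^esub> Fa H g \<cdot>\<^bsub>D\<^esub> k = Fa H h \<cdot>\<^bsub>D\<^esub> k" if "k \<in> Arr D" "Cod D k = Fo H (Dom C g)"
    by (rule Comp_reduce[OF cats(2) 1]) (use assms that in simp_all)
qed

lemma Fa_absorb: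
  "\<lbrakk>f \<cdot>\<^bsub>C\<^esub> g = f; f \<in> Arr C; g \<in> Arr C; Dom C f = Cod C g\<rbrakk> \<Longrightarrow> Fa H f \<cdot>\<^bsub>D\<^esub> Fa H g = Fa H f"
  "\<lbrakk>f \<cdot>\<^bsub>C\<^esub> g = g; f \<in> Arr C; g \<in> Arr C; Dom C f = Cod C g\<rbrakk> \<Longrightarrow> Fa H f \<cdot>\<^bsub>D\<^esub> Fa H g = Fa H g"
  "\<lbrakk>f \<cdot>\<^bsub>C\<^esub> g = f; f \<in> Arr C; g \<in> Arr C; Dom C f = Cod C g; k \<in> Arr D; Cod D k = Fo H (Dom C g)\<rbrakk>
    \<Longrightarrow> Fa H f \<cdot>\<^bsub>D\<^esub> Fa H g \<cdot>\<^bsub>D\<^esub> k = Fa H f \<cdot>\<^bsub>D\<^esub> k"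
  "\<lbrakk>f \<cdot>\<^bsub>C\<^esub> g = g; f \<in> Arr C; g \<in> Arr C; Dom C f = Cod C g; k \<in> Arr D; Cod D k = Fo H (Dom C g)\<rbrakk>
    \<Longrightarrow> Fa H f \<cdot>\<^bsub>D\<^esub> Fa H g \<cdot>\<^bsub>D\<^esub> k = Fa H g \<cdot>\<^bsub>D\<^esub> k"
  by (rule Fa_eq; assumption)+

lemma Fa_eq2:
  assumes "f \<cdot>\<^bsub>C\<^esub> g = f' \<cdot>\<^bsub>C\<^esub> g'" "f \<in> Arr C" "g \<in> Arr C" "f' \<in> Arr C" "g' \<in> Arr C"
    "Dom C f = Cod C g" "Dom C f' = Cod C g'"
  shows "Fa H f \<cdot>\<^bsub>D\<^esub> Fa H g = Fa H f' \<cdot>\<^bsub>D\<^esub> Fa H g'"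
    "\<lbrakk>k \<in> Arr D; Cod D k = Fo H (Dom C g)\<rbrakk>
      \<Longrightarrow> Fa H f \<cdot>\<^bsub>D\<^esub> Fa H g \<cdot>\<^bsub>D\<^esub> k = Fa H f' \<cdot>\<^bsub>D\<^esub> Fa H g' \<cdot>\<^bsub>D\<^esub> k"
proof -
  show 1: "Fa H f \<cdot>\<^bsub>D\<^esub> Fa H g = Fa H f' \<cdot>\<^bsub>D\<^esub> Fa H g'"
    using assms Fa_Comp by metis
  have "Dom C g' = Dom C g"
    using assms Dom_Comp[OF cats(1)] by metis
  then show "Fa H f \<cdot>\<^bsub>D\<^esub> Fa H g \<cdot>\<^bsub>D\<^esub> k = Fa H f' \<cdot>\<^bsub>D\<^esub> Fa H g' \<cdot>\<^bsub>D\<^esub> k"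
    if "k \<in> Arr D" "Cod D k = Fo H (Dom C g)"
    by (intro Comp_reduce2[OF cats(2) 1]) (use assms that in simp_all)
qed

lemma Fa_eq3:
  assumes "f \<cdot>\<^bsub>C\<^esub> g \<cdot>\<^bsub>C\<^esub> h = e" "f \<in> Arr C" "g \<in> Arr C" "h \<in> Arr C"
    "Dom C f = Cod C g" "Dom C g = Cod C h"
  shows "Fa H f \<cdot>\<^bsub>D\<^esub> Fa H g \<cdot>\<^bsub>D\<^esub> Fa H h = Fa H e"
    "\<lbrakk>k \<in> Arr D; Cod D k = Fo H (Dom C h)\<rbrakk>
      \<Longrightarrow> Fa H f \<cdot>\<^bsub>D\<^esub> Fa H g \<cdot>\<^bsub>D\<^esub> Fa H h \<cdot>\<^bsub>D\<^esub> k = Fa H e \<cdot>\<^bsub>D\<^esub> k"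
proof -
  show 1: "Fa H f \<cdot>\<^bsub>D\<^esub> Fa H g \<cdot>\<^bsub>D\<^esub> Fa H h = Fa H e"
    using assms by (simp flip: assms(1))
  show "Fa H f \<cdot>\<^bsub>D\<^esub> Fa H g \<cdot>\<^bsub>D\<^esub> Fa H h \<cdot>\<^bsub>D\<^esub> k = Fa H e \<cdot>\<^bsub>D\<^esub> k"
    if "k \<in> Arr D" "Cod D k = Fo H (Dom C h)"
    by (rule Comp_reduce3[OF cats(2) 1]) (use assms that in simp_all)
qed

lemma Fa_iso [simp]: "is_iso C f \<Longrightarrow> is_iso D (Fa H f)"
  and Fa_inv: "is_iso C f \<Longrightarrow> inv_arr D (Fa H f) = Fa H (inv_arr C f)"
  by (rule is_isoI[of _ _ "Fa H (inv_arr C f)"]; simp add: is_iso_Arr flip: Fa_Comp)+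

lemma Fa_inv_cancel [simp]:
  assumes "is_iso C f"
  shows "Fa H f \<cdot>\<^bsub>D\<^esub> Fa H (inv_arr C f) = Ide D (Fo H (Cod C f))"
    "Fa H (inv_arr C f) \<cdot>\<^bsub>D\<^esub> Fa H f = Ide D (Fo H (Dom C f))"
    "\<lbrakk>k \<in> Arr D; Cod D k = Fo H (Cod C f)\<rbrakk> \<Longrightarrow> Fa H f \<cdot>\<^bsub>D\<^esub> Fa H (inv_arr C f) \<cdot>\<^bsub>D\<^esub> k = k"
    "\<lbrakk>k \<in> Arr D; Cod D k = Fo H (Dom C f)\<rbrakk> \<Longrightarrow> Fa H (inv_arr C f) \<cdot>\<^bsub>D\<^esub> Fa H f \<cdot>\<^bsub>D\<^esub> k = k"
proof -
  have f: "f \<in> Arr C" using assms by (rule is_iso_Arr[OF cats(1)])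
  show 1: "Fa H f \<cdot>\<^bsub>D\<^esub> Fa H (inv_arr C f) = Ide D (Fo H (Cod C f))"
    and 2: "Fa H (inv_arr C f) \<cdot>\<^bsub>D\<^esub> Fa H f = Ide D (Fo H (Dom C f))"
    using assms f by (simp_all flip: Fa_Comp)
  show "\<lbrakk>k \<in> Arr D; Cod D k = Fo H (Cod C f)\<rbrakk> \<Longrightarrow> Fa H f \<cdot>\<^bsub>D\<^esub> Fa H (inv_arr C f) \<cdot>\<^bsub>D\<^esub> k = k"
    using Comp_reduce[OF cats(2) 1, of k] assms f by simp
  show "\<lbrakk>k \<in> Arr D; Cod D k = Fo H (Dom C f)\<rbrakk> \<Longrightarrow> Fa H (inv_arr C f) \<cdot>\<^bsub>D\<^esub> Fa H f \<cdot>\<^bsub>D\<^esub> k = k"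
    using Comp_reduce[OF cats(2) 2, of k] assms f by simp
qed

end

lemma is_functor_fid [simp]: "is_category C \<Longrightarrow> is_functor C C fid"
  by (rule is_functorI) auto

lemma is_functor_fcomp:
  assumes "is_functor C D H" "is_functor D E K"
  shows "is_functor C E (K \<bullet> H)"
proof -
  interpret H: cat_functor C D H by unfold_locales fact
  interpret K: cat_functor D E K by unfold_locales fact
  show ?thesis by (rule is_functorI) auto
qed

locale natural_trans =
  fixes C :: "('o, 'm) cat" and D :: "('p, 'n) cat" and H H' \<tau>
  assumes nat_trans: "nat_trans C D H H' \<tau>"
begin

sublocale H: cat_functor C D H
  using nat_trans by unfold_locales (auto simp: nat_trans_def)

sublocale H': cat_functor C D H'
  using nat_trans by unfold_locales (auto simp: nat_trans_def)

lemma \<tau>_Arr [simp]: "x \<in> Ob C \<Longrightarrow> \<tau> x \<in> Arr D"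
  and Dom_\<tau> [simp]: "x \<in> Ob C \<Longrightarrow> Dom D (\<tau> x) = Fo H x"
  and Cod_\<tau> [simp]: "x \<in> Ob C \<Longrightarrow> Cod D (\<tau> x) = Fo H' x"
  using nat_trans by (auto simp: nat_trans_def)

lemma \<tau>_nat: "f \<in> Arr C \<Longrightarrow> \<tau> (Cod C f) \<cdot>\<^bsub>D\<^esub> Fa H f = Fa H' f \<cdot>\<^bsub>D\<^esub> \<tau> (Dom C f)"
proof -
  assume f: "f \<in> Arr C"
  have "\<forall>x\<in>Ob C. \<forall>y\<in>Ob C. \<forall>f\<in>hom C x y. \<tau> y \<cdot>\<^bsub>D\<^esub> Fa H f = Fa H' f \<cdot>\<^bsub>D\<^esub> \<tau> x"
    using nat_trans unfolding nat_trans_def by (elim conjE)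
  from this[rule_format, of "Dom C f" "Cod C f" f] show ?thesis
    using f by simp
qed

text \<open>Components move to the right past images of arrows. The object \<open>y\<close> is a
  variable of its own because in actual terms it rarely has the form \<open>Cod C f\<close>.\<close>

lemma \<tau>_nat_simp [simp]:
  "\<lbrakk>f \<in> Arr C; Cod C f = y\<rbrakk> \<Longrightarrow> \<tau> y \<cdot>\<^bsub>D\<^esub> Fa H f = Fa H' f \<cdot>\<^bsub>D\<^esub> \<tau> (Dom C f)"
  "\<lbrakk>f \<in> Arr C; Cod C f = y; k \<in> Arr D; Cod D k = Fo H (Dom C f)\<rbrakk>
    \<Longrightarrow> \<tau> y \<cdot>\<^bsub>D\<^esub> Fa H f \<cdot>\<^bsub>D\<^esub> k = Fa H' f \<cdot>\<^bsub>D\<^esub> \<tau> (Dom C f) \<cdot>\<^bsub>D\<^esub> k"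
  using \<tau>_nat[of f] Comp_reduce2[OF H.cats(2) \<tau>_nat[of f], of k] by auto

end

locale natural_iso =
  fixes C :: "('o, 'm) cat" and D :: "('p, 'n) cat" and H H' \<tau>
  assumes nat_iso: "nat_iso C D H H' \<tau>"
begin

sublocale natural_trans C D H H' \<tau>
  using nat_iso by unfold_locales (simp add: nat_iso_def)

lemma \<tau>_iso [simp]: "x \<in> Ob C \<Longrightarrow> is_iso D (\<tau> x)"
  using nat_iso by (simp add: nat_iso_def)

lemma inv_nat:
  assumes "f \<in> Arr C"
  shows "inv_arr D (\<tau> (Cod C f)) \<cdot>\<^bsub>D\<^esub> Fa H' f = Fa H f \<cdot>\<^bsub>D\<^esub> inv_arr D (\<tau> (Dom C f))"
proof (rule iso_mono[of D "\<tau> (Cod C f)"])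
  have "\<tau> (Cod C f) \<cdot>\<^bsub>D\<^esub> Fa H f \<cdot>\<^bsub>D\<^esub> inv_arr D (\<tau> (Dom C f))
      = Fa H' f \<cdot>\<^bsub>D\<^esub> \<tau> (Dom C f) \<cdot>\<^bsub>D\<^esub> inv_arr D (\<tau> (Dom C f))"
    by (rule Comp_reduce2[OF H.cats(2) \<tau>_nat[OF assms]]) (simp_all add: assms)
  then show "\<tau> (Cod C f) \<cdot>\<^bsub>D\<^esub> inv_arr D (\<tau> (Cod C f)) \<cdot>\<^bsub>D\<^esub> Fa H' f =
     \<tau> (Cod C f) \<cdot>\<^bsub>D\<^esub> Fa H f \<cdot>\<^bsub>D\<^esub> inv_arr D (\<tau> (Dom C f))"
    by (simp add: assms)
qed (use assms in simp_all)

lemma nat_iso_inv: "nat_iso C D H' H (\<lambda>x. inv_arr D (\<tau> x))"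
  by (rule nat_isoI) (simp_all add: inv_nat H.is_functor H'.is_functor)

end

section \<open>Adjunctions and their morphisms\<close>

locale adjunction =
  fixes F :: "('oa, 'ma, 'ob, 'mb) adj"
  assumes is_adjunction: "is_adjunction F"
begin

abbreviation "A \<equiv> catA F"
abbreviation "B \<equiv> catB F"
abbreviation "Lo \<equiv> Fo (left F)"
abbreviation "La \<equiv> Fa (left F)"
abbreviation "Ro \<equiv> Fo (right F)"
abbreviation "Ra \<equiv> Fa (right F)"
abbreviation "\<eta> \<equiv> aunit F"
abbreviation "\<epsilon> \<equiv> acounit F"

sublocale L: cat_functor "catA F" "catB F" "left F"
  using is_adjunction by unfold_locales (auto simp: is_adjunction_def)

sublocale R: cat_functor "catB F" "catA F" "right F"
  using is_adjunction by unfold_locales (auto simp: is_adjunction_def)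

lemma \<eta>_Arr [simp]: "a \<in> Ob A \<Longrightarrow> \<eta> a \<in> Arr A"
  and Dom_\<eta> [simp]: "a \<in> Ob A \<Longrightarrow> Dom A (\<eta> a) = a"
  and Cod_\<eta> [simp]: "a \<in> Ob A \<Longrightarrow> Cod A (\<eta> a) = Ro (Lo a)"
  and \<epsilon>_Arr [simp]: "b \<in> Ob B \<Longrightarrow> \<epsilon> b \<in> Arr B"
  and Dom_\<epsilon> [simp]: "b \<in> Ob B \<Longrightarrow> Dom B (\<epsilon> b) = Lo (Ro b)"
  and Cod_\<epsilon> [simp]: "b \<in> Ob B \<Longrightarrow> Cod B (\<epsilon> b) = b"
  using is_adjunction by (auto simp: is_adjunction_def nat_trans_def)

lemma \<eta>_nat [simp]: "\<lbrakk>f \<in> Arr A; Cod A f = a\<rbrakk> \<Longrightarrow> \<eta> a \<cdot>\<^bsub>A\<^esub> f = Ra (La f) \<cdot>\<^bsub>A\<^esub> \<eta> (Dom A f)"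
  and \<epsilon>_nat [simp]: "\<lbrakk>g \<in> Arr B; Cod B g = b\<rbrakk> \<Longrightarrow> \<epsilon> b \<cdot>\<^bsub>B\<^esub> La (Ra g) = g \<cdot>\<^bsub>B\<^esub> \<epsilon> (Dom B g)"
  using is_adjunction by (auto simp: is_adjunction_def nat_trans_def)

lemma \<epsilon>_nat2 [simp]: "\<lbrakk>g \<in> Arr B; Cod B g = b; k \<in> Arr B; Cod B k = Lo (Ro (Dom B g))\<rbrakk>
    \<Longrightarrow> \<epsilon> b \<cdot>\<^bsub>B\<^esub> La (Ra g) \<cdot>\<^bsub>B\<^esub> k = g \<cdot>\<^bsub>B\<^esub> \<epsilon> (Dom B g) \<cdot>\<^bsub>B\<^esub> k"
  by (rule Comp_reduce2) auto

lemma triangle_L [simp]: "a \<in> Ob A \<Longrightarrow> \<epsilon> (Lo a) \<cdot>\<^bsub>B\<^esub> La (\<eta> a) = Ide B (Lo a)"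
  and triangle_R [simp]: "b \<in> Ob B \<Longrightarrow> Ra (\<epsilon> b) \<cdot>\<^bsub>A\<^esub> \<eta> (Ro b) = Ide A (Ro b)"
  using is_adjunction by (auto simp: is_adjunction_def)

lemma triangle_L2 [simp]:
  assumes "a \<in> Ob A" "k \<in> Arr B" "Cod B k = Lo a"
  shows "\<epsilon> (Lo a) \<cdot>\<^bsub>B\<^esub> La (\<eta> a) \<cdot>\<^bsub>B\<^esub> k = k"
  using Comp_reduce[OF _ triangle_L[OF assms(1)], of k] assms by simp

end

lemma is_adjunctionI:
  assumes "is_functor (catA F) (catB F) (left F)" "is_functor (catB F) (catA F) (right F)"
    "\<And>a. a \<in> Ob (catA F) \<Longrightarrow> aunit F a \<in> Arr (catA F) \<and> Dom (catA F) (aunit F a) = a \<and>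
        Cod (catA F) (aunit F a) = Fo (right F) (Fo (left F) a)"
    "\<And>f. f \<in> Arr (catA F) \<Longrightarrow> aunit F (Cod (catA F) f) \<cdot>\<^bsub>catA F\<^esub> f
        = Fa (right F) (Fa (left F) f) \<cdot>\<^bsub>catA F\<^esub> aunit F (Dom (catA F) f)"
    "\<And>b. b \<in> Ob (catB F) \<Longrightarrow> acounit F b \<in> Arr (catB F) \<and>
        Dom (catB F) (acounit F b) = Fo (left F) (Fo (right F) b) \<and> Cod (catB F) (acounit F b) = b"
    "\<And>g. g \<in> Arr (catB F) \<Longrightarrow> acounit F (Cod (catB F) g) \<cdot>\<^bsub>catB F\<^esub> Fa (left F) (Fa (right F) g)
        = g \<cdot>\<^bsub>catB F\<^esub> acounit F (Dom (catB F) g)"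
    "\<And>a. a \<in> Ob (catA F) \<Longrightarrow>
        acounit F (Fo (left F) a) \<cdot>\<^bsub>catB F\<^esub> Fa (left F) (aunit F a) = Ide (catB F) (Fo (left F) a)"
    "\<And>b. b \<in> Ob (catB F) \<Longrightarrow>
        Fa (right F) (acounit F b) \<cdot>\<^bsub>catA F\<^esub> aunit F (Fo (right F) b) = Ide (catA F) (Fo (right F) b)"
  shows "is_adjunction F"
proof -
  have "is_category (catA F)" "is_category (catB F)"
    using assms(1) by (auto simp: is_functor_def)
  moreover have "is_functor (catA F) (catA F) (right F \<bullet> left F)"
    "is_functor (catB F) (catB F) (left F \<bullet> right F)"
    using assms(1,2) by (auto intro: is_functor_fcomp)
  ultimately show ?thesis
    unfolding is_adjunction_def using assms
    by (auto intro!: nat_transI)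
qed

locale adj_mor = F: adjunction F + G: adjunction G
  for F :: "('oa, 'ma, 'ob, 'mb) adj" and G :: "('oc, 'mc, 'od, 'md) adj" +
  fixes \<Upsilon> :: "('oa, 'ma, 'ob, 'mb, 'oc, 'mc, 'od, 'md) amor"
  assumes adj_morphism: "adj_morphism F G \<Upsilon>"
begin

abbreviation "Ho \<equiv> Fo (mH \<Upsilon>)"
abbreviation "Ha \<equiv> Fa (mH \<Upsilon>)"
abbreviation "Ko \<equiv> Fo (mK \<Upsilon>)"
abbreviation "Ka \<equiv> Fa (mK \<Upsilon>)"
abbreviation "l \<equiv> upL \<Upsilon>"
abbreviation "r \<equiv> upR \<Upsilon>"
abbreviation "l' a \<equiv> inv_arr G.B (upL \<Upsilon> a)"
abbreviation "r' b \<equiv> inv_arr G.A (upR \<Upsilon> b)"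

sublocale H: cat_functor "catA F" "catA G" "mH \<Upsilon>"
  using adj_morphism by unfold_locales (auto simp: adj_morphism_def)

sublocale K: cat_functor "catB F" "catB G" "mK \<Upsilon>"
  using adj_morphism by unfold_locales (auto simp: adj_morphism_def)

lemma nat_iso_l: "nat_iso F.A G.B (mK \<Upsilon> \<bullet> left F) (left G \<bullet> mH \<Upsilon>) (upL \<Upsilon>)"
  and nat_iso_r: "nat_iso F.B G.A (mH \<Upsilon> \<bullet> right F) (right G \<bullet> mK \<Upsilon>) (upR \<Upsilon>)"
  using adj_morphism by (auto simp: adj_morphism_def)

interpretation nl: natural_iso F.A G.B "mK \<Upsilon> \<bullet> left F" "left G \<bullet> mH \<Upsilon>" "upL \<Upsilon>"
  by unfold_locales (rule nat_iso_l)

interpretation nr: natural_iso F.B G.A "mH \<Upsilon> \<bullet> right F" "right G \<bullet> mK \<Upsilon>" "upR \<Upsilon>"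
  by unfold_locales (rule nat_iso_r)

lemma l_Arr [simp]: "a \<in> Ob F.A \<Longrightarrow> l a \<in> Arr G.B"
  and Dom_l [simp]: "a \<in> Ob F.A \<Longrightarrow> Dom G.B (l a) = Ko (F.Lo a)"
  and Cod_l [simp]: "a \<in> Ob F.A \<Longrightarrow> Cod G.B (l a) = G.Lo (Ho a)"
  and l_iso [simp]: "a \<in> Ob F.A \<Longrightarrow> is_iso G.B (l a)"
  and r_Arr [simp]: "b \<in> Ob F.B \<Longrightarrow> r b \<in> Arr G.A"
  and Dom_r [simp]: "b \<in> Ob F.B \<Longrightarrow> Dom G.A (r b) = Ho (F.Ro b)"
  and Cod_r [simp]: "b \<in> Ob F.B \<Longrightarrow> Cod G.A (r b) = G.Ro (Ko b)"
  and r_iso [simp]: "b \<in> Ob F.B \<Longrightarrow> is_iso G.A (r b)"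
  by simp_all

lemma l_nat [simp]: "\<lbrakk>f \<in> Arr F.A; Cod F.A f = a\<rbrakk>
    \<Longrightarrow> l a \<cdot>\<^bsub>G.B\<^esub> Ka (F.La f) = G.La (Ha f) \<cdot>\<^bsub>G.B\<^esub> l (Dom F.A f)"
  and r_nat [simp]: "\<lbrakk>g \<in> Arr F.B; Cod F.B g = b\<rbrakk>
    \<Longrightarrow> r b \<cdot>\<^bsub>G.A\<^esub> Ha (F.Ra g) = G.Ra (Ka g) \<cdot>\<^bsub>G.A\<^esub> r (Dom F.B g)"
  using nl.\<tau>_nat nr.\<tau>_nat by auto

lemma l'_nat [simp]: "\<lbrakk>f \<in> Arr F.A; Cod F.A f = a\<rbrakk>
    \<Longrightarrow> l' a \<cdot>\<^bsub>G.B\<^esub> G.La (Ha f) = Ka (F.La f) \<cdot>\<^bsub>G.B\<^esub> l' (Dom F.A f)"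
  and r'_nat [simp]: "\<lbrakk>g \<in> Arr F.B; Cod F.B g = b\<rbrakk>
    \<Longrightarrow> r' b \<cdot>\<^bsub>G.A\<^esub> G.Ra (Ka g) = Ha (F.Ra g) \<cdot>\<^bsub>G.A\<^esub> r' (Dom F.B g)"
  using nl.inv_nat nr.inv_nat by auto

lemma l_nat2 [simp]: "\<lbrakk>f \<in> Arr F.A; Cod F.A f = a; k \<in> Arr G.B; Cod G.B k = Ko (F.Lo (Dom F.A f))\<rbrakk>
    \<Longrightarrow> l a \<cdot>\<^bsub>G.B\<^esub> Ka (F.La f) \<cdot>\<^bsub>G.B\<^esub> k = G.La (Ha f) \<cdot>\<^bsub>G.B\<^esub> l (Dom F.A f) \<cdot>\<^bsub>G.B\<^esub> k"
  and r_nat2 [simp]: "\<lbrakk>g \<in> Arr F.B; Cod F.B g = b; m \<in> Arr G.A; Cod G.A m = Ho (F.Ro (Dom F.B g))\<rbrakk>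
    \<Longrightarrow> r b \<cdot>\<^bsub>G.A\<^esub> Ha (F.Ra g) \<cdot>\<^bsub>G.A\<^esub> m = G.Ra (Ka g) \<cdot>\<^bsub>G.A\<^esub> r (Dom F.B g) \<cdot>\<^bsub>G.A\<^esub> m"
  and l'_nat2 [simp]: "\<lbrakk>f \<in> Arr F.A; Cod F.A f = a; k \<in> Arr G.B; Cod G.B k = G.Lo (Ho (Dom F.A f))\<rbrakk>
    \<Longrightarrow> l' a \<cdot>\<^bsub>G.B\<^esub> G.La (Ha f) \<cdot>\<^bsub>G.B\<^esub> k = Ka (F.La f) \<cdot>\<^bsub>G.B\<^esub> l' (Dom F.A f) \<cdot>\<^bsub>G.B\<^esub> k"
  and r'_nat2 [simp]: "\<lbrakk>g \<in> Arr F.B; Cod F.B g = b; m \<in> Arr G.A; Cod G.A m = G.Ro (Ko (Dom F.B g))\<rbrakk>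
    \<Longrightarrow> r' b \<cdot>\<^bsub>G.A\<^esub> G.Ra (Ka g) \<cdot>\<^bsub>G.A\<^esub> m = Ha (F.Ra g) \<cdot>\<^bsub>G.A\<^esub> r' (Dom F.B g) \<cdot>\<^bsub>G.A\<^esub> m"
  by (rule Comp_reduce2; auto)+

lemma unit_law: "a \<in> Ob F.A \<Longrightarrow> G.Ra (l a) \<cdot>\<^bsub>G.A\<^esub> r (F.Lo a) \<cdot>\<^bsub>G.A\<^esub> Ha (F.\<eta> a) = G.\<eta> (Ho a)"
  and counit_law: "b \<in> Ob F.B \<Longrightarrow> G.\<epsilon> (Ko b) \<cdot>\<^bsub>G.B\<^esub> G.La (r b) \<cdot>\<^bsub>G.B\<^esub> l (F.Ro b) = Ka (F.\<epsilon> b)"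
  using adj_morphism by (auto simp: adj_morphism_def)

end

lemma adj_mor_intro: "adj_morphism F G \<Upsilon> \<Longrightarrow> adj_mor F G \<Upsilon>"
  by unfold_locales (auto simp: adj_morphism_def)

lemma adj_morphismI:
  assumes "is_adjunction F" "is_adjunction G"
    "is_functor (catA F) (catA G) (mH \<Upsilon>)" "is_functor (catB F) (catB G) (mK \<Upsilon>)"
    "\<And>a. a \<in> Ob (catA F) \<Longrightarrow> is_iso (catB G) (upL \<Upsilon> a) \<and> Dom (catB G) (upL \<Upsilon> a) = Fo (mK \<Upsilon>) (Fo (left F) a)
        \<and> Cod (catB G) (upL \<Upsilon> a) = Fo (left G) (Fo (mH \<Upsilon>) a)"
    "\<And>b. b \<in> Ob (catB F) \<Longrightarrow> is_iso (catA G) (upR \<Upsilon> b) \<and> Dom (catA G) (upR \<Upsilon> b) = Fo (mH \<Upsilon>) (Fo (right F) b)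
        \<and> Cod (catA G) (upR \<Upsilon> b) = Fo (right G) (Fo (mK \<Upsilon>) b)"
    "\<And>f. f \<in> Arr (catA F) \<Longrightarrow> upL \<Upsilon> (Cod (catA F) f) \<cdot>\<^bsub>catB G\<^esub> Fa (mK \<Upsilon>) (Fa (left F) f)
        = Fa (left G) (Fa (mH \<Upsilon>) f) \<cdot>\<^bsub>catB G\<^esub> upL \<Upsilon> (Dom (catA F) f)"
    "\<And>g. g \<in> Arr (catB F) \<Longrightarrow> upR \<Upsilon> (Cod (catB F) g) \<cdot>\<^bsub>catA G\<^esub> Fa (mH \<Upsilon>) (Fa (right F) g)
        = Fa (right G) (Fa (mK \<Upsilon>) g) \<cdot>\<^bsub>catA G\<^esub> upR \<Upsilon> (Dom (catB F) g)"
    "\<And>a. a \<in> Ob (catA F) \<Longrightarrow>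
        Fa (right G) (upL \<Upsilon> a) \<cdot>\<^bsub>catA G\<^esub> (upR \<Upsilon> (Fo (left F) a) \<cdot>\<^bsub>catA G\<^esub> Fa (mH \<Upsilon>) (aunit F a))
          = aunit G (Fo (mH \<Upsilon>) a)"
    "\<And>b. b \<in> Ob (catB F) \<Longrightarrow>
        acounit G (Fo (mK \<Upsilon>) b) \<cdot>\<^bsub>catB G\<^esub> (Fa (left G) (upR \<Upsilon> b) \<cdot>\<^bsub>catB G\<^esub> upL \<Upsilon> (Fo (right F) b))
          = Fa (mK \<Upsilon>) (acounit F b)"
  shows "adj_morphism F G \<Upsilon>"
proof -
  interpret F: adjunction F by unfold_locales fact
  interpret G: adjunction G by unfold_locales fact
  note c = is_functor_fcomp[OF F.L.is_functor assms(4)] is_functor_fcomp[OF assms(3) G.L.is_functor]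
    is_functor_fcomp[OF F.R.is_functor assms(3)] is_functor_fcomp[OF assms(4) G.R.is_functor]
  have "\<And>a. a \<in> Ob F.A \<Longrightarrow> upL \<Upsilon> a \<in> Arr G.B" "\<And>b. b \<in> Ob F.B \<Longrightarrow> upR \<Upsilon> b \<in> Arr G.A"
    using assms(5,6) is_iso_Arr[OF G.L.cats(2)] is_iso_Arr[OF G.L.cats(1)] by blast+
  then show ?thesis
    unfolding adj_morphism_def
    by (intro conjI ballI nat_isoI c) (simp_all add: assms)
qed

context adj_mor
begin

lemma unit_law_simp [simp]:
  "\<lbrakk>a \<in> Ob F.A; b = F.Lo a\<rbrakk> \<Longrightarrow> G.Ra (l a) \<cdot>\<^bsub>G.A\<^esub> r b \<cdot>\<^bsub>G.A\<^esub> Ha (F.\<eta> a) = G.\<eta> (Ho a)"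
  "\<lbrakk>a \<in> Ob F.A; b = F.Lo a; k \<in> Arr G.A; Cod G.A k = Ho a\<rbrakk>
    \<Longrightarrow> G.Ra (l a) \<cdot>\<^bsub>G.A\<^esub> r b \<cdot>\<^bsub>G.A\<^esub> Ha (F.\<eta> a) \<cdot>\<^bsub>G.A\<^esub> k = G.\<eta> (Ho a) \<cdot>\<^bsub>G.A\<^esub> k"
  using unit_law[of a] Comp_reduce3[OF _ unit_law, of a k] by simp_all

lemma counit_law_simp [simp]:
  "\<lbrakk>b \<in> Ob F.B; a = F.Ro b\<rbrakk> \<Longrightarrow> G.\<epsilon> (Ko b) \<cdot>\<^bsub>G.B\<^esub> G.La (r b) \<cdot>\<^bsub>G.B\<^esub> l a = Ka (F.\<epsilon> b)"
  "\<lbrakk>b \<in> Ob F.B; a = F.Ro b; k \<in> Arr G.B; Cod G.B k = Ko (F.Lo a)\<rbrakk>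
    \<Longrightarrow> G.\<epsilon> (Ko b) \<cdot>\<^bsub>G.B\<^esub> G.La (r b) \<cdot>\<^bsub>G.B\<^esub> l a \<cdot>\<^bsub>G.B\<^esub> k = Ka (F.\<epsilon> b) \<cdot>\<^bsub>G.B\<^esub> k"
  using counit_law[of b] Comp_reduce3[OF _ counit_law, of b k] by simp_all

text \<open>Invertibility of \<open>l\<close> and \<open>r\<close> allows the two laws to be solved
  for the other side. In this form they are the counit and unit laws of the opposite
  morphism.\<close>

lemma unit_law': "a \<in> Ob F.A \<Longrightarrow> r' (F.Lo a) \<cdot>\<^bsub>G.A\<^esub> G.Ra (l' a) \<cdot>\<^bsub>G.A\<^esub> G.\<eta> (Ho a) = Ha (F.\<eta> a)"
  by (simp flip: unit_law del: unit_law_simp)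

lemma counit_law': "b \<in> Ob F.B \<Longrightarrow> Ka (F.\<epsilon> b) \<cdot>\<^bsub>G.B\<^esub> l' (F.Ro b) \<cdot>\<^bsub>G.B\<^esub> G.La (r' b) = G.\<epsilon> (Ko b)"
  by (simp flip: counit_law del: counit_law_simp)

text \<open>Used with \<open>r'_nat\<close> removed, against whose direction it runs: it serves when
  an arrow of \<open>F\<close> is known only through its image under \<open>mK\<close>, as are the
  liftings that make up a quasi-inverse.\<close>

lemma Ha_Ra: "g \<in> Arr F.B \<Longrightarrow>
    Ha (F.Ra g) = r' (Cod F.B g) \<cdot>\<^bsub>G.A\<^esub> G.Ra (Ka g) \<cdot>\<^bsub>G.A\<^esub> r (Dom F.B g)"
  by simp

lemma Ka_La: "f \<in> Arr F.A \<Longrightarrow>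
    Ka (F.La f) = l' (Cod F.A f) \<cdot>\<^bsub>G.B\<^esub> G.La (Ha f) \<cdot>\<^bsub>G.B\<^esub> l (Dom F.A f)"
  by simp

end

section \<open>Identities and composites of morphisms\<close>

lemma amor_id_simps [simp]:
  "mH (amor_id F) = fid" "mK (amor_id F) = fid"
  "upL (amor_id F) a = Ide (catB F) (Fo (left F) a)" "upR (amor_id F) b = Ide (catA F) (Fo (right F) b)"
  by (simp_all add: amor_id_def)

lemma amor_comp_simps [simp]:
  "mH (amor_comp L \<Psi> \<Upsilon>) = mH \<Psi> \<bullet> mH \<Upsilon>" "mK (amor_comp L \<Psi> \<Upsilon>) = mK \<Psi> \<bullet> mK \<Upsilon>"
  "upL (amor_comp L \<Psi> \<Upsilon>) a = upL \<Psi> (Fo (mH \<Upsilon>) a) \<cdot>\<^bsub>catB L\<^esub> Fa (mK \<Psi>) (upL \<Upsilon> a)"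
  "upR (amor_comp L \<Psi> \<Upsilon>) b = upR \<Psi> (Fo (mK \<Upsilon>) b) \<cdot>\<^bsub>catA L\<^esub> Fa (mH \<Psi>) (upR \<Upsilon> b)"
  by (simp_all add: amor_comp_def)

lemma adj_morphism_id: "is_adjunction F \<Longrightarrow> adj_morphism F F (amor_id F)"
proof -
  assume F: "is_adjunction F"
  then interpret adjunction F by unfold_locales
  show ?thesis
    by (rule adj_morphismI) (simp_all add: F)
qed

lemma adj_morphism_comp:
  assumes "adj_morphism F G \<Upsilon>" "adj_morphism G L \<Psi>"
  shows "adj_morphism F L (amor_comp L \<Psi> \<Upsilon>)"
proof -
  interpret U: adj_mor F G \<Upsilon> using assms(1) by (rule adj_mor_intro)
  interpret P: adj_mor G L \<Psi> using assms(2) by (rule adj_mor_intro)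
  show ?thesis
  proof (rule adj_morphismI)
    show "is_functor U.F.A P.G.A (mH (amor_comp L \<Psi> \<Upsilon>))" "is_functor U.F.B P.G.B (mK (amor_comp L \<Psi> \<Upsilon>))"
      using is_functor_fcomp[OF U.H.is_functor P.H.is_functor]
        is_functor_fcomp[OF U.K.is_functor P.K.is_functor] by simp_all
  next
    fix a assume a: "a \<in> Ob U.F.A"
    show "P.G.Ra (upL (amor_comp L \<Psi> \<Upsilon>) a) \<cdot>\<^bsub>P.G.A\<^esub> upR (amor_comp L \<Psi> \<Upsilon>) (U.F.Lo a) \<cdot>\<^bsub>P.G.A\<^esub>
           Fa (mH (amor_comp L \<Psi> \<Upsilon>)) (U.F.\<eta> a) = P.G.\<eta> (Fo (mH (amor_comp L \<Psi> \<Upsilon>)) a)"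
    proof -
      \<comment> \<open>Naturality of \<open>P.r\<close> at \<open>U.l a\<close>, read from right to
        left, brings \<open>U.l a\<close> next to the other two factors of \<open>U.unit_law\<close>
        under \<open>P.Ha\<close>.\<close>
      have "P.G.Ra (P.Ka (U.l a)) \<cdot>\<^bsub>P.G.A\<^esub> P.r (U.Ko (U.F.Lo a)) \<cdot>\<^bsub>P.G.A\<^esub> P.Ha (U.r (U.F.Lo a))
          \<cdot>\<^bsub>P.G.A\<^esub> P.Ha (U.Ha (U.F.\<eta> a)) = P.r (U.G.Lo (U.Ho a)) \<cdot>\<^bsub>P.G.A\<^esub> P.Ha (U.G.\<eta> (U.Ho a))"
        using a P.r_nat2[of "U.l a" "U.G.Lo (U.Ho a)" "P.Ha (U.r (U.F.Lo a)) \<cdot>\<^bsub>P.G.A\<^esub> P.Ha (U.Ha (U.F.\<eta> a))"]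
          P.H.Fa_eq3(1)[OF U.unit_law, of a]
        by (simp del: P.r_nat2)
      then show ?thesis
        using a P.unit_law[of "U.Ho a"] by simp
    qed
  next
    fix b assume b: "b \<in> Ob U.F.B"
    show "P.G.\<epsilon> (Fo (mK (amor_comp L \<Psi> \<Upsilon>)) b) \<cdot>\<^bsub>P.G.B\<^esub> P.G.La (upR (amor_comp L \<Psi> \<Upsilon>) b)
        \<cdot>\<^bsub>P.G.B\<^esub> upL (amor_comp L \<Psi> \<Upsilon>) (U.F.Ro b) = Fa (mK (amor_comp L \<Psi> \<Upsilon>)) (U.F.\<epsilon> b)"
    proof -
      have "P.G.La (P.Ha (U.r b)) \<cdot>\<^bsub>P.G.B\<^esub> P.l (U.Ho (U.F.Ro b)) \<cdot>\<^bsub>P.G.B\<^esub> P.Ka (U.l (U.F.Ro b))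
          = P.l (U.G.Ro (U.Ko b)) \<cdot>\<^bsub>P.G.B\<^esub> P.Ka (U.G.La (U.r b)) \<cdot>\<^bsub>P.G.B\<^esub> P.Ka (U.l (U.F.Ro b))"
        using b by simp
      then show ?thesis
        using b P.counit_law_simp(2)[of "U.Ko b" _ "P.Ka (U.G.La (U.r b)) \<cdot>\<^bsub>P.G.B\<^esub> P.Ka (U.l (U.F.Ro b))"]
          P.K.Fa_eq3(1)[OF U.counit_law, of b]
        by (simp del: P.l_nat2)
    qed
  qed (simp_all add: iso_Comp U.F.is_adjunction P.G.is_adjunction
      P.K.Fa_eq2[OF U.l_nat] P.H.Fa_eq2[OF U.r_nat])
qed

section \<open>Isomorphism of parallel morphisms\<close>

locale adj_mor_iso = U: adj_mor F G \<Upsilon> + U': adj_mor F G \<Upsilon>'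
  for F :: "('oa, 'ma, 'ob, 'mb) adj" and G :: "('oc, 'mc, 'od, 'md) adj" and \<Upsilon> \<Upsilon>' +
  fixes \<theta> \<phi>
  assumes nat_\<theta>: "nat_iso (catA F) (catA G) (mH \<Upsilon>) (mH \<Upsilon>') \<theta>"
    and nat_\<phi>: "nat_iso (catB F) (catB G) (mK \<Upsilon>) (mK \<Upsilon>') \<phi>"
    and compat_l: "\<And>a. a \<in> Ob (catA F) \<Longrightarrow>
           upL \<Upsilon>' a \<cdot>\<^bsub>catB G\<^esub> \<phi> (Fo (left F) a) = Fa (left G) (\<theta> a) \<cdot>\<^bsub>catB G\<^esub> upL \<Upsilon> a"
    and compat_r: "\<And>b. b \<in> Ob (catB F) \<Longrightarrow>
           upR \<Upsilon>' b \<cdot>\<^bsub>catA G\<^esub> \<theta> (Fo (right F) b) = Fa (right G) (\<phi> b) \<cdot>\<^bsub>catA G\<^esub> upR \<Upsilon> b"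
begin

sublocale t: natural_iso "catA F" "catA G" "mH \<Upsilon>" "mH \<Upsilon>'" \<theta>
  by unfold_locales (rule nat_\<theta>)

sublocale p: natural_iso "catB F" "catB G" "mK \<Upsilon>" "mK \<Upsilon>'" \<phi>
  by unfold_locales (rule nat_\<phi>)

lemma amor_iso: "amor_iso F G \<Upsilon> \<Upsilon>'"
  unfolding amor_iso_def
  using U.adj_morphism U'.adj_morphism nat_\<theta> nat_\<phi> compat_l compat_r by blast

end

lemma amor_isoE:
  assumes "amor_iso F G \<Upsilon> \<Upsilon>'"
  obtains \<theta> \<phi> where "adj_mor_iso F G \<Upsilon> \<Upsilon>' \<theta> \<phi>"
proof -
  obtain \<theta> \<phi> where *: "nat_iso (catA F) (catA G) (mH \<Upsilon>) (mH \<Upsilon>') \<theta>"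
    "nat_iso (catB F) (catB G) (mK \<Upsilon>) (mK \<Upsilon>') \<phi>"
    "\<And>a. a \<in> Ob (catA F) \<Longrightarrow>
           upL \<Upsilon>' a \<cdot>\<^bsub>catB G\<^esub> \<phi> (Fo (left F) a) = Fa (left G) (\<theta> a) \<cdot>\<^bsub>catB G\<^esub> upL \<Upsilon> a"
    "\<And>b. b \<in> Ob (catB F) \<Longrightarrow>
           upR \<Upsilon>' b \<cdot>\<^bsub>catA G\<^esub> \<theta> (Fo (right F) b) = Fa (right G) (\<phi> b) \<cdot>\<^bsub>catA G\<^esub> upR \<Upsilon> b"
    using assms unfolding amor_iso_def by (elim conjE exE) blast
  have "adj_mor F G \<Upsilon>" "adj_mor F G \<Upsilon>'"
    using assms by (auto simp: amor_iso_def intro: adj_mor_intro)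
  then have "adj_mor_iso F G \<Upsilon> \<Upsilon>' \<theta> \<phi>"
    by (intro adj_mor_iso.intro adj_mor_iso_axioms.intro *)
  then show thesis by (rule that)
qed

lemma amor_isoI:
  assumes "adj_morphism F G \<Upsilon>" "adj_morphism F G \<Upsilon>'"
    "\<And>a. a \<in> Ob (catA F) \<Longrightarrow> is_iso (catA G) (\<theta> a) \<and> Dom (catA G) (\<theta> a) = Fo (mH \<Upsilon>) a
        \<and> Cod (catA G) (\<theta> a) = Fo (mH \<Upsilon>') a"
    "\<And>b. b \<in> Ob (catB F) \<Longrightarrow> is_iso (catB G) (\<phi> b) \<and> Dom (catB G) (\<phi> b) = Fo (mK \<Upsilon>) b
        \<and> Cod (catB G) (\<phi> b) = Fo (mK \<Upsilon>') b"
    "\<And>f. f \<in> Arr (catA F) \<Longrightarrow> \<theta> (Cod (catA F) f) \<cdot>\<^bsub>catA G\<^esub> Fa (mH \<Upsilon>) f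
        = Fa (mH \<Upsilon>') f \<cdot>\<^bsub>catA G\<^esub> \<theta> (Dom (catA F) f)"
    "\<And>g. g \<in> Arr (catB F) \<Longrightarrow> \<phi> (Cod (catB F) g) \<cdot>\<^bsub>catB G\<^esub> Fa (mK \<Upsilon>) g
        = Fa (mK \<Upsilon>') g \<cdot>\<^bsub>catB G\<^esub> \<phi> (Dom (catB F) g)"
    "\<And>a. a \<in> Ob (catA F) \<Longrightarrow>
           upL \<Upsilon>' a \<cdot>\<^bsub>catB G\<^esub> \<phi> (Fo (left F) a) = Fa (left G) (\<theta> a) \<cdot>\<^bsub>catB G\<^esub> upL \<Upsilon> a"
    "\<And>b. b \<in> Ob (catB F) \<Longrightarrow>
           upR \<Upsilon>' b \<cdot>\<^bsub>catA G\<^esub> \<theta> (Fo (right F) b) = Fa (right G) (\<phi> b) \<cdot>\<^bsub>catA G\<^esub> upR \<Upsilon> b"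
  shows "amor_iso F G \<Upsilon> \<Upsilon>'"
proof -
  interpret U: adj_mor F G \<Upsilon> using assms(1) by (rule adj_mor_intro)
  interpret U': adj_mor F G \<Upsilon>' using assms(2) by (rule adj_mor_intro)
  have "\<And>a. a \<in> Ob U.F.A \<Longrightarrow> \<theta> a \<in> Arr U.G.A" "\<And>b. b \<in> Ob U.F.B \<Longrightarrow> \<phi> b \<in> Arr U.G.B"
    using assms(3,4) is_iso_Arr[OF U.H.cats(2)] is_iso_Arr[OF U.K.cats(2)] by blast+
  then have "nat_iso (catA F) (catA G) (mH \<Upsilon>) (mH \<Upsilon>') \<theta>" "nat_iso (catB F) (catB G) (mK \<Upsilon>) (mK \<Upsilon>') \<phi>"
    by (intro nat_isoI U.H.is_functor U'.H.is_functor U.K.is_functor U'.K.is_functor; simp add: assms)+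
  then interpret adj_mor_iso F G \<Upsilon> \<Upsilon>' \<theta> \<phi>
    by unfold_locales (use assms(7,8) in auto)
  show ?thesis by (rule amor_iso)
qed

lemma amor_iso_sym:
  assumes "amor_iso F G \<Upsilon> \<Upsilon>'"
  shows "amor_iso F G \<Upsilon>' \<Upsilon>"
proof -
  obtain \<theta> \<phi> where "adj_mor_iso F G \<Upsilon> \<Upsilon>' \<theta> \<phi>" using assms by (rule amor_isoE)
  then interpret adj_mor_iso F G \<Upsilon> \<Upsilon>' \<theta> \<phi> .
  show ?thesis
  proof (rule amor_isoI[OF U'.adj_morphism U.adj_morphism,
        where \<theta> = "\<lambda>a. inv_arr (catA G) (\<theta> a)" and \<phi> = "\<lambda>b. inv_arr (catB G) (\<phi> b)"])
    fix a assume a: "a \<in> Ob U.F.A"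
    show "upL \<Upsilon> a \<cdot>\<^bsub>U.G.B\<^esub> inv_arr U.G.B (\<phi> (U.F.Lo a))
        = U.G.La (inv_arr U.G.A (\<theta> a)) \<cdot>\<^bsub>U.G.B\<^esub> upL \<Upsilon>' a"
    proof (rule iso_epi[of U.G.B "\<phi> (U.F.Lo a)"])
      show "(upL \<Upsilon> a \<cdot>\<^bsub>U.G.B\<^esub> inv_arr U.G.B (\<phi> (U.F.Lo a))) \<cdot>\<^bsub>U.G.B\<^esub> \<phi> (U.F.Lo a)
        = (U.G.La (inv_arr U.G.A (\<theta> a)) \<cdot>\<^bsub>U.G.B\<^esub> upL \<Upsilon>' a) \<cdot>\<^bsub>U.G.B\<^esub> \<phi> (U.F.Lo a)"
        using a by (simp add: compat_l)
    qed (use a in simp_all)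
  next
    fix b assume b: "b \<in> Ob U.F.B"
    show "upR \<Upsilon> b \<cdot>\<^bsub>U.G.A\<^esub> inv_arr U.G.A (\<theta> (U.F.Ro b))
        = U.G.Ra (inv_arr U.G.B (\<phi> b)) \<cdot>\<^bsub>U.G.A\<^esub> upR \<Upsilon>' b"
    proof (rule iso_epi[of U.G.A "\<theta> (U.F.Ro b)"])
      show "(upR \<Upsilon> b \<cdot>\<^bsub>U.G.A\<^esub> inv_arr U.G.A (\<theta> (U.F.Ro b))) \<cdot>\<^bsub>U.G.A\<^esub> \<theta> (U.F.Ro b)
        = (U.G.Ra (inv_arr U.G.B (\<phi> b)) \<cdot>\<^bsub>U.G.A\<^esub> upR \<Upsilon>' b) \<cdot>\<^bsub>U.G.A\<^esub> \<theta> (U.F.Ro b)"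
        using b by (simp add: compat_r)
    qed (use b in simp_all)
  qed (simp_all add: t.inv_nat p.inv_nat)
qed

lemma amor_iso_trans:
  assumes "amor_iso F G \<Upsilon> \<Upsilon>'" "amor_iso F G \<Upsilon>' \<Upsilon>''"
  shows "amor_iso F G \<Upsilon> \<Upsilon>''"
proof -
  obtain \<theta> \<phi> where "adj_mor_iso F G \<Upsilon> \<Upsilon>' \<theta> \<phi>" using assms(1) by (rule amor_isoE)
  then interpret P: adj_mor_iso F G \<Upsilon> \<Upsilon>' \<theta> \<phi> .
  obtain \<theta>' \<phi>' where "adj_mor_iso F G \<Upsilon>' \<Upsilon>'' \<theta>' \<phi>'" using assms(2) by (rule amor_isoE)
  then interpret Q: adj_mor_iso F G \<Upsilon>' \<Upsilon>'' \<theta>' \<phi>' .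
  show ?thesis
  proof (rule amor_isoI[OF P.U.adj_morphism Q.U'.adj_morphism,
        where \<theta> = "\<lambda>a. \<theta>' a \<cdot>\<^bsub>catA G\<^esub> \<theta> a" and \<phi> = "\<lambda>b. \<phi>' b \<cdot>\<^bsub>catB G\<^esub> \<phi> b"])
    fix a assume "a \<in> Ob P.U.F.A"
    then show "upL \<Upsilon>'' a \<cdot>\<^bsub>P.U.G.B\<^esub> \<phi>' (P.U.F.Lo a) \<cdot>\<^bsub>P.U.G.B\<^esub> \<phi> (P.U.F.Lo a)
        = P.U.G.La (\<theta>' a \<cdot>\<^bsub>P.U.G.A\<^esub> \<theta> a) \<cdot>\<^bsub>P.U.G.B\<^esub> upL \<Upsilon> a"
      by (simp add: P.compat_l Comp_reduce2[OF _ Q.compat_l])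
  next
    fix b assume "b \<in> Ob P.U.F.B"
    then show "upR \<Upsilon>'' b \<cdot>\<^bsub>P.U.G.A\<^esub> \<theta>' (P.U.F.Ro b) \<cdot>\<^bsub>P.U.G.A\<^esub> \<theta> (P.U.F.Ro b)
        = P.U.G.Ra (\<phi>' b \<cdot>\<^bsub>P.U.G.B\<^esub> \<phi> b) \<cdot>\<^bsub>P.U.G.A\<^esub> upR \<Upsilon> b"
      by (simp add: P.compat_r Comp_reduce2[OF _ Q.compat_r])
  qed (simp_all add: iso_Comp)
qed

lemma amor_iso_comp_left:
  assumes "amor_iso F G \<Upsilon> \<Upsilon>'" "adj_morphism G L \<Psi>"
  shows "amor_iso F L (amor_comp L \<Psi> \<Upsilon>) (amor_comp L \<Psi> \<Upsilon>')"
proof -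
  obtain \<theta> \<phi> where "adj_mor_iso F G \<Upsilon> \<Upsilon>' \<theta> \<phi>" using assms(1) by (rule amor_isoE)
  then interpret adj_mor_iso F G \<Upsilon> \<Upsilon>' \<theta> \<phi> .
  interpret P: adj_mor G L \<Psi> using assms(2) by (rule adj_mor_intro)
  show ?thesis
    by (rule amor_isoI[OF adj_morphism_comp[OF U.adj_morphism P.adj_morphism]
          adj_morphism_comp[OF U'.adj_morphism P.adj_morphism],
          where \<theta> = "\<lambda>a. P.Ha (\<theta> a)" and \<phi> = "\<lambda>b. P.Ka (\<phi> b)"])
      (simp_all add: P.K.Fa_eq2[OF compat_l] P.H.Fa_eq2[OF compat_r]
        P.K.Fa_eq2[OF p.\<tau>_nat] P.H.Fa_eq2[OF t.\<tau>_nat])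
qed

lemma amor_iso_comp_right:
  assumes "adj_morphism F G \<Upsilon>" "amor_iso G L \<Psi> \<Psi>'"
  shows "amor_iso F L (amor_comp L \<Psi> \<Upsilon>) (amor_comp L \<Psi>' \<Upsilon>)"
proof -
  obtain \<theta> \<phi> where "adj_mor_iso G L \<Psi> \<Psi>' \<theta> \<phi>" using assms(2) by (rule amor_isoE)
  then interpret adj_mor_iso G L \<Psi> \<Psi>' \<theta> \<phi> .
  interpret P: adj_mor F G \<Upsilon> using assms(1) by (rule adj_mor_intro)
  show ?thesis
    by (rule amor_isoI[OF adj_morphism_comp[OF P.adj_morphism U.adj_morphism]
          adj_morphism_comp[OF P.adj_morphism U'.adj_morphism],
          where \<theta> = "\<lambda>a. \<theta> (P.Ho a)" and \<phi> = "\<lambda>b. \<phi> (P.Ko b)"])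
      (simp_all add: Comp_reduce2[OF _ compat_l[symmetric]] Comp_reduce2[OF _ compat_r[symmetric]])
qed

text \<open>The axioms of a morphism concern only values on the carriers, so
  \<open>\<Upsilon>'\<close> inherits them and identities form an isomorphism. Strict equalities
  enter the calculus of isomorphisms through this lemma.\<close>

lemma amor_eq_imp_iso:
  assumes "adj_morphism F G \<Upsilon>" "amor_eq F \<Upsilon> \<Upsilon>'"
  shows "amor_iso F G \<Upsilon> \<Upsilon>'"
proof -
  interpret U: adj_mor F G \<Upsilon> using assms(1) by (rule adj_mor_intro)
  have [simp]:
    "\<And>a. a \<in> Ob U.F.A \<Longrightarrow> Fo (mH \<Upsilon>') a = U.Ho a" "\<And>a. a \<in> Ob U.F.A \<Longrightarrow> upL \<Upsilon>' a = U.l a"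
    "\<And>f. f \<in> Arr U.F.A \<Longrightarrow> Fa (mH \<Upsilon>') f = U.Ha f"
    "\<And>b. b \<in> Ob U.F.B \<Longrightarrow> Fo (mK \<Upsilon>') b = U.Ko b" "\<And>b. b \<in> Ob U.F.B \<Longrightarrow> upR \<Upsilon>' b = U.r b"
    "\<And>g. g \<in> Arr U.F.B \<Longrightarrow> Fa (mK \<Upsilon>') g = U.Ka g"
    using assms(2) by (simp_all add: amor_eq_def)
  have "is_functor U.F.A U.G.A (mH \<Upsilon>')" "is_functor U.F.B U.G.B (mK \<Upsilon>')"
    by (rule is_functorI; simp)+
  then have "adj_morphism F G \<Upsilon>'"
    by (intro adj_morphismI) (simp_all add: U.F.is_adjunction U.G.is_adjunction)
  then show ?thesis
    by (rule amor_isoI[OF assms(1), where \<theta> = "\<lambda>a. Ide (catA G) (U.Ho a)" and \<phi> = "\<lambda>b. Ide (catB G) (U.Ko b)"])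
      simp_all
qed

lemma amor_iso_assoc:
  assumes "adj_morphism F G \<Upsilon>" "adj_morphism G L \<Psi>" "adj_morphism L M \<Xi>"
  shows "amor_iso F M (amor_comp M (amor_comp M \<Xi> \<Psi>) \<Upsilon>) (amor_comp M \<Xi> (amor_comp L \<Psi> \<Upsilon>))"
proof (rule amor_eq_imp_iso)
  show "adj_morphism F M (amor_comp M (amor_comp M \<Xi> \<Psi>) \<Upsilon>)"
    by (intro adj_morphism_comp[OF assms(1)] adj_morphism_comp[OF assms(2,3)])
  interpret U: adj_mor F G \<Upsilon> using assms(1) by (rule adj_mor_intro)
  interpret P: adj_mor G L \<Psi> using assms(2) by (rule adj_mor_intro)
  interpret X: adj_mor L M \<Xi> using assms(3) by (rule adj_mor_intro)
  show "amor_eq F (amor_comp M (amor_comp M \<Xi> \<Psi>) \<Upsilon>) (amor_comp M \<Xi> (amor_comp L \<Psi> \<Upsilon>))"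
    by (simp add: amor_eq_def)
qed

lemma amor_iso_id_left:
  assumes "adj_morphism F G \<Upsilon>"
  shows "amor_iso F G (amor_comp G (amor_id G) \<Upsilon>) \<Upsilon>"
proof (rule amor_eq_imp_iso)
  interpret U: adj_mor F G \<Upsilon> using assms by (rule adj_mor_intro)
  show "adj_morphism F G (amor_comp G (amor_id G) \<Upsilon>)"
    using assms adj_morphism_comp adj_morphism_id U.G.is_adjunction by blast
  show "amor_eq F (amor_comp G (amor_id G) \<Upsilon>) \<Upsilon>"
    by (simp add: amor_eq_def)
qed

lemma amor_iso_id_right:
  assumes "adj_morphism F G \<Upsilon>"
  shows "amor_iso F G (amor_comp G \<Upsilon> (amor_id F)) \<Upsilon>"
proof (rule amor_eq_imp_iso)
  interpret U: adj_mor F G \<Upsilon> using assms by (rule adj_mor_intro)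
  show "adj_morphism F G (amor_comp G \<Upsilon> (amor_id F))"
    using assms adj_morphism_comp adj_morphism_id U.F.is_adjunction by blast
  show "amor_eq F (amor_comp G \<Upsilon> (amor_id F)) \<Upsilon>"
    by (simp add: amor_eq_def)
qed

section \<open>Vertical composition and whiskering\<close>

lemma nat_trans_comp:
  assumes "nat_trans C D H H' \<sigma>" "nat_trans C D H' H'' \<tau>"
  shows "nat_trans C D H H'' (\<lambda>x. \<tau> x \<cdot>\<^bsub>D\<^esub> \<sigma> x)"
proof -
  interpret s: natural_trans C D H H' \<sigma> by unfold_locales fact
  interpret t: natural_trans C D H' H'' \<tau> by unfold_locales fact
  show ?thesis
    by (rule nat_transI) (simp_all add: s.H.is_functor t.H'.is_functor)
qed

lemma nat_trans_whisker_left: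
  assumes "nat_trans C D H H' \<tau>" "is_functor D E K"
  shows "nat_trans C E (K \<bullet> H) (K \<bullet> H') (\<lambda>x. Fa K (\<tau> x))"
proof -
  interpret t: natural_trans C D H H' \<tau> by unfold_locales fact
  interpret K: cat_functor D E K by unfold_locales fact
  show ?thesis
    by (rule nat_transI)
      (simp_all add: t.\<tau>_nat is_functor_fcomp[OF t.H.is_functor K.is_functor]
        is_functor_fcomp[OF t.H'.is_functor K.is_functor] flip: K.Fa_Comp)
qed

lemma nat_trans_whisker_right:
  assumes "nat_trans C D H H' \<tau>" "is_functor B C K"
  shows "nat_trans B D (H \<bullet> K) (H' \<bullet> K) (\<lambda>x. \<tau> (Fo K x))"
proof -
  interpret t: natural_trans C D H H' \<tau> by unfold_locales fact
  interpret K: cat_functor B C K by unfold_locales fact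
  show ?thesis
    by (rule nat_transI)
      (simp_all add: is_functor_fcomp[OF K.is_functor t.H.is_functor]
        is_functor_fcomp[OF K.is_functor t.H'.is_functor])
qed

lemma nat_isoD: "nat_iso C D H H' \<tau> \<Longrightarrow> nat_trans C D H H' \<tau>"
  by (simp add: nat_iso_def)

lemma fcomp_fid [simp]: "H \<bullet> fid = H" "fid \<bullet> H = H"
  by (simp_all add: fcomp_def fid_def)

lemma fcomp_assoc: "(H \<bullet> K) \<bullet> M = H \<bullet> K \<bullet> M"
  by (simp add: fcomp_def)

section \<open>Idempotent completion\<close>

lemma structured_cat_simps [simp]:
  "Ob (structured_cat X h i c) = X"
  "Dom (structured_cat X h i c) = asrc"
  "Cod (structured_cat X h i c) = atgt"
  "Ide (structured_cat X h i c) x = Arrow x (i x) x"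
  "Comp (structured_cat X h i c) g f = Arrow (asrc f) (c (base g) (base f)) (atgt g)"
  "Arrow x u y \<in> Arr (structured_cat X h i c) \<longleftrightarrow> x \<in> X \<and> y \<in> X \<and> u \<in> h x y"
  by (simp_all add: structured_cat_def)

lemma Arr_structured_iff:
  "f \<in> Arr (structured_cat X h i c) \<longleftrightarrow> asrc f \<in> X \<and> atgt f \<in> X \<and> base f \<in> h (asrc f) (atgt f)"
  by (cases f) simp

text \<open>Associativity is the law inherited from \<open>C\<close>. The unit laws are assumed
  separately because identities may change: in the idempotent completion the identity of
  \<open>(x, p)\<close> is \<open>p\<close>.\<close>

lemma is_category_structured:
  assumes C: "is_category C"
    and h: "\<And>x y f. \<lbrakk>x \<in> X; y \<in> X; f \<in> h x y\<rbrakk> \<Longrightarrow> f \<in> Arr C \<and> Dom C f = U x \<and> Cod C f = U y"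
    and i: "\<And>x. x \<in> X \<Longrightarrow> i x \<in> h x x"
    and c: "\<And>x y z f g. \<lbrakk>x \<in> X; y \<in> X; z \<in> X; f \<in> h x y; g \<in> h y z\<rbrakk> \<Longrightarrow> g \<cdot>\<^bsub>C\<^esub> f \<in> h x z"
    and u: "\<And>x y f. \<lbrakk>x \<in> X; y \<in> X; f \<in> h x y\<rbrakk> \<Longrightarrow> f \<cdot>\<^bsub>C\<^esub> i x = f \<and> i y \<cdot>\<^bsub>C\<^esub> f = f"
  shows "is_category (structured_cat X h i (Comp C))"
proof (rule is_categoryI)
  fix f g k
  assume "f \<in> Arr (structured_cat X h i (Comp C))" "g \<in> Arr (structured_cat X h i (Comp C))"
    "k \<in> Arr (structured_cat X h i (Comp C))"
    "Dom (structured_cat X h i (Comp C)) g = Cod (structured_cat X h i (Comp C)) f"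
    "Dom (structured_cat X h i (Comp C)) k = Cod (structured_cat X h i (Comp C)) g"
  then show "k \<cdot>\<^bsub>structured_cat X h i (Comp C)\<^esub> g \<cdot>\<^bsub>structured_cat X h i (Comp C)\<^esub> f =
      (k \<cdot>\<^bsub>structured_cat X h i (Comp C)\<^esub> g) \<cdot>\<^bsub>structured_cat X h i (Comp C)\<^esub> f"
    using Comp_assoc[OF C, of "base f" "base g" "base k"] h
    by (auto simp: Arr_structured_iff)
qed (auto simp: Arr_structured_iff i u intro: c)

lemma Ob_karoubi [simp]: "(x, p) \<in> Ob (karoubi C) \<longleftrightarrow>
    x \<in> Ob C \<and> p \<in> Arr C \<and> Dom C p = x \<and> Cod C p = x \<and> p \<cdot>\<^bsub>C\<^esub> p = p"
  by (simp add: karoubi_def)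

text \<open>As \<open>p\<close> and \<open>q\<close> are idempotent, the single condition
  \<open>q f p = f\<close> separates into absorption on either side. The separated form is what
  \<open>Comp_absorb\<close> and \<open>Fa_absorb\<close> consume.\<close>

lemma Arr_karoubi [simp]:
  assumes C: "is_category C"
  shows "Arrow (x, p) f (y, q) \<in> Arr (karoubi C) \<longleftrightarrow>
    (x, p) \<in> Ob (karoubi C) \<and> (y, q) \<in> Ob (karoubi C) \<and> f \<in> Arr C \<and> Dom C f = x \<and> Cod C f = y \<and>
    q \<cdot>\<^bsub>C\<^esub> f = f \<and> f \<cdot>\<^bsub>C\<^esub> p = f"
    (is "?L \<longleftrightarrow> ?R")
proof
  assume ?L
  then have *: "(x, p) \<in> Ob (karoubi C)" "(y, q) \<in> Ob (karoubi C)" "f \<in> Arr C" "Dom C f = x" "Cod C f = y"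
    "q \<cdot>\<^bsub>C\<^esub> f \<cdot>\<^bsub>C\<^esub> p = f"
    by (auto simp: karoubi_def)
  have "q \<cdot>\<^bsub>C\<^esub> f = q \<cdot>\<^bsub>C\<^esub> q \<cdot>\<^bsub>C\<^esub> f \<cdot>\<^bsub>C\<^esub> p" using * by simp
  also have "\<dots> = (q \<cdot>\<^bsub>C\<^esub> q) \<cdot>\<^bsub>C\<^esub> f \<cdot>\<^bsub>C\<^esub> p" using * C by (subst Comp_assoc) auto
  also have "\<dots> = f" using * by simp
  finally have 1: "q \<cdot>\<^bsub>C\<^esub> f = f" .
  have "f \<cdot>\<^bsub>C\<^esub> p = (q \<cdot>\<^bsub>C\<^esub> f \<cdot>\<^bsub>C\<^esub> p) \<cdot>\<^bsub>C\<^esub> p" using * by simp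
  also have "\<dots> = q \<cdot>\<^bsub>C\<^esub> f \<cdot>\<^bsub>C\<^esub> p \<cdot>\<^bsub>C\<^esub> p" using *(1-5) C by simp
  also have "\<dots> = f" using * by simp
  finally have "f \<cdot>\<^bsub>C\<^esub> p = f" .
  then show ?R using 1 *(1-5) by (intro conjI)
qed (auto simp: karoubi_def)

lemma karoubi_simps [simp]:
  "Dom (karoubi C) = asrc" "Cod (karoubi C) = atgt" "Ide (karoubi C) (x, p) = Arrow (x, p) p (x, p)"
  "Comp (karoubi C) g f = Arrow (asrc f) (base g \<cdot>\<^bsub>C\<^esub> base f) (atgt g)"
  by (simp_all add: karoubi_def)

lemma ArrE_karoubi:
  assumes "is_category C" "f \<in> Arr (karoubi C)"
  obtains x p u y q where "f = Arrow (x, p) u (y, q)" "x \<in> Ob C" "p \<in> Arr C" "Dom C p = x" "Cod C p = x" "p \<cdot>\<^bsub>C\<^esub> p = p"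
    "y \<in> Ob C" "q \<in> Arr C" "Dom C q = y" "Cod C q = y" "q \<cdot>\<^bsub>C\<^esub> q = q"
    "u \<in> Arr C" "Dom C u = x" "Cod C u = y" "q \<cdot>\<^bsub>C\<^esub> u = u" "u \<cdot>\<^bsub>C\<^esub> p = u"
proof -
  obtain x p u y q where f: "f = Arrow (x, p) u (y, q)" by (metis arrow.exhaust surj_pair)
  show thesis using assms(2) f by (intro that[of x p u y q]) (auto simp: assms(1))
qed

lemma is_category_karoubi [simp]:
  assumes C: "is_category C"
  shows "is_category (karoubi C)"
  unfolding karoubi_def
proof (rule is_category_structured[OF C, where U = fst])
  note [simp] = C
  fix x y z f g
  let ?X = "{(x, p). x \<in> Ob C \<and> p \<in> hom C x x \<and> p \<cdot>\<^bsub>C\<^esub> p = p}"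
  let ?h = "\<lambda>(x, p) (y, q). {f \<in> hom C x y. q \<cdot>\<^bsub>C\<^esub> f \<cdot>\<^bsub>C\<^esub> p = f}"
  \<comment> \<open>Hom-set membership is traded for membership in \<open>Arr (karoubi C)\<close> so
    that the two absorption laws of \<open>Arr_karoubi\<close> become available.\<close>
  have h: "f \<in> ?h x y \<longleftrightarrow> Arrow x f y \<in> Arr (karoubi C)" if "x \<in> ?X" "y \<in> ?X" for x y f
    using that by (simp add: karoubi_def)
  {
    assume x: "x \<in> ?X" and y: "y \<in> ?X" and z: "z \<in> ?X" and f: "f \<in> ?h x y" and g: "g \<in> ?h y z"
    show "g \<cdot>\<^bsub>C\<^esub> f \<in> ?h x z"
      using f g Comp_reduce[OF C, of "snd z" g g f] unfolding h[OF x y] h[OF y z] h[OF x z]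
      by (cases x; cases y; cases z) auto
  next
    assume x: "x \<in> ?X" and y: "y \<in> ?X" and f: "f \<in> ?h x y"
    show "f \<cdot>\<^bsub>C\<^esub> snd x = f \<and> snd y \<cdot>\<^bsub>C\<^esub> f = f"
      using f unfolding h[OF x y] by (cases x; cases y) auto
  }
qed auto

lemma karoubi_fctr_simps [simp]:
  "Fo (karoubi_fctr H) (x, p) = (Fo H x, Fa H p)"
  "Fa (karoubi_fctr H) f = Arrow (Fo (karoubi_fctr H) (asrc f)) (Fa H (base f)) (Fo (karoubi_fctr H) (atgt f))"
  by (simp_all add: karoubi_fctr_def Let_def)

lemma karoubi_fctr_fid [simp]: "karoubi_fctr fid = fid"
  by (simp add: karoubi_fctr_def fid_def id_def)

lemma karoubi_fctr_fcomp: "karoubi_fctr (K \<bullet> H) = karoubi_fctr K \<bullet> karoubi_fctr H"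
  by (auto simp: karoubi_fctr_def fcomp_def Let_def fun_eq_iff split: prod.split)

lemma is_functor_karoubi:
  assumes "is_functor C D H"
  shows "is_functor (karoubi C) (karoubi D) (karoubi_fctr H)"
proof -
  interpret cat_functor C D H by unfold_locales fact
  show ?thesis
    by (rule is_functorI) (auto elim!: ArrE_karoubi[OF cats(1)] simp: Fa_absorb Comp_absorb)
qed

lemma karoubi_trans_simp: "karoubi_trans D H H' \<tau> (x, p) =
    Arrow (Fo H x, Fa H p) (\<tau> x \<cdot>\<^bsub>D\<^esub> Fa H p) (Fo H' x, Fa H' p)"
  by (simp add: karoubi_trans_def)

lemma nat_trans_karoubi:
  assumes "nat_trans C D H H' \<tau>"
  shows "nat_trans (karoubi C) (karoubi D) (karoubi_fctr H) (karoubi_fctr H') (karoubi_trans D H H' \<tau>)"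
proof -
  interpret natural_trans C D H H' \<tau> by unfold_locales fact
  show ?thesis
    by (rule nat_transI)
      (auto elim!: ArrE_karoubi[OF H.cats(1)] simp: karoubi_trans_simp Comp_absorb H.Fa_absorb H'.Fa_absorb
        is_functor_karoubi H.is_functor H'.is_functor)
qed

lemma nat_iso_karoubi:
  assumes "nat_iso C D H H' \<tau>"
  shows "nat_iso (karoubi C) (karoubi D) (karoubi_fctr H) (karoubi_fctr H') (karoubi_trans D H H' \<tau>)"
proof -
  interpret natural_iso C D H H' \<tau> by unfold_locales fact
  interpret k: natural_trans "karoubi C" "karoubi D" "karoubi_fctr H" "karoubi_fctr H'" "karoubi_trans D H H' \<tau>"
    using assms by unfold_locales (simp add: nat_trans_karoubi nat_isoD)
  interpret i: natural_iso C D H' H "\<lambda>x. inv_arr D (\<tau> x)"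
    by unfold_locales (rule nat_iso_inv)
  show ?thesis
    unfolding nat_iso_def
  proof (intro conjI k.nat_trans ballI)
    fix a assume a: "a \<in> Ob (karoubi C)"
    obtain x p where xp: "a = (x, p)" by force
    show "is_iso (karoubi D) (karoubi_trans D H H' \<tau> a)"
      \<comment> \<open>The inverse is the lift of the inverse transformation; both composites
        reduce to images of \<open>p\<close>, which are the identities of the completion.\<close>
      by (rule is_isoI(1)[of _ _ "Arrow (Fo H' x, Fa H' p) (inv_arr D (\<tau> x) \<cdot>\<^bsub>D\<^esub> Fa H' p) (Fo H x, Fa H p)"])
        (use a xp in \<open>auto simp: karoubi_trans_simp Comp_absorb H.Fa_absorb H'.Fa_absorb\<close>)
  qed
qed

text \<open>Together with the whiskering lemmas, \<open>karoubi_trans_cong\<close> and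
  \<open>karoubi_trans_id\<close>, this makes completion 2-functorial: an equation between pasted
  2-cells lifts componentwise, without any computation with idempotents.\<close>

lemma karoubi_trans_comp:
  assumes "nat_trans C D H H' \<sigma>" "nat_trans C D H' H'' \<tau>" "a \<in> Ob (karoubi C)"
  shows "karoubi_trans D H' H'' \<tau> a \<cdot>\<^bsub>karoubi D\<^esub> karoubi_trans D H H' \<sigma> a
    = karoubi_trans D H H'' (\<lambda>x. \<tau> x \<cdot>\<^bsub>D\<^esub> \<sigma> x) a"
proof -
  interpret s: natural_trans C D H H' \<sigma> by unfold_locales fact
  interpret t: natural_trans C D H' H'' \<tau> by unfold_locales fact
  show ?thesis
    using assms(3) by (cases a) (auto simp: karoubi_trans_simp Comp_absorb s.H.Fa_absorb s.H'.Fa_absorb t.H'.Fa_absorb)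
qed

lemma karoubi_trans_whisker_left:
  assumes "nat_trans C D H H' \<tau>" "is_functor D E K" "a \<in> Ob (karoubi C)"
  shows "Fa (karoubi_fctr K) (karoubi_trans D H H' \<tau> a)
    = karoubi_trans E (K \<bullet> H) (K \<bullet> H') (\<lambda>x. Fa K (\<tau> x)) a"
proof -
  interpret t: natural_trans C D H H' \<tau> by unfold_locales fact
  interpret K: cat_functor D E K by unfold_locales fact
  show ?thesis
    using assms(3) by (cases a) (auto simp: karoubi_trans_simp simp del: t.\<tau>_nat_simp)
qed

lemma karoubi_trans_whisker_right:
  "karoubi_trans D H H' \<tau> (Fo (karoubi_fctr K) a)
    = karoubi_trans D (H \<bullet> K) (H' \<bullet> K) (\<lambda>x. \<tau> (Fo K x)) a"
  by (cases a) (simp add: karoubi_trans_simp)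

lemma karoubi_trans_cong:
  "\<lbrakk>a \<in> Ob (karoubi C); \<And>x. x \<in> Ob C \<Longrightarrow> \<tau> x = \<sigma> x\<rbrakk>
    \<Longrightarrow> karoubi_trans D H H' \<tau> a = karoubi_trans D H H' \<sigma> a"
  by (cases a) (simp add: karoubi_trans_simp)

lemma karoubi_trans_id:
  assumes "is_functor C D H" "a \<in> Ob (karoubi C)"
  shows "karoubi_trans D H H (\<lambda>x. Ide D (Fo H x)) a = Ide (karoubi D) (Fo (karoubi_fctr H) a)"
proof -
  interpret cat_functor C D H by unfold_locales fact
  show ?thesis using assms(2) by (cases a) (auto simp: karoubi_trans_simp)
qed

context adjunction
begin

lemma nat_\<eta>: "nat_trans A A fid (right F \<bullet> left F) \<eta>"
  and nat_\<epsilon>: "nat_trans B B (left F \<bullet> right F) fid \<epsilon>"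
  using is_adjunction by (simp_all add: is_adjunction_def)

end

lemma karoubi_adj_simps [simp]:
  "catA (karoubi_adj F) = karoubi (catA F)" "catB (karoubi_adj F) = karoubi (catB F)"
  "left (karoubi_adj F) = karoubi_fctr (left F)" "right (karoubi_adj F) = karoubi_fctr (right F)"
  "aunit (karoubi_adj F) = karoubi_trans (catA F) fid (right F \<bullet> left F) (aunit F)"
  "acounit (karoubi_adj F) = karoubi_trans (catB F) (left F \<bullet> right F) fid (acounit F)"
  by (simp_all add: karoubi_adj_def)

lemma is_adjunction_karoubi:
  assumes "is_adjunction F"
  shows "is_adjunction (karoubi_adj F)"
proof -
  interpret adjunction F by unfold_locales fact
  note w = nat_trans_whisker_left[OF nat_\<eta> L.is_functor] nat_trans_whisker_right[OF nat_\<epsilon> L.is_functor]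
    nat_trans_whisker_left[OF nat_\<epsilon> R.is_functor] nat_trans_whisker_right[OF nat_\<eta> R.is_functor]
  show ?thesis
    unfolding is_adjunction_def
  proof (intro conjI ballI)
    show "nat_trans (catA (karoubi_adj F)) (catA (karoubi_adj F)) fid
        (right (karoubi_adj F) \<bullet> left (karoubi_adj F)) (aunit (karoubi_adj F))"
      "nat_trans (catB (karoubi_adj F)) (catB (karoubi_adj F))
        (left (karoubi_adj F) \<bullet> right (karoubi_adj F)) fid (acounit (karoubi_adj F))"
      using nat_trans_karoubi[OF nat_\<eta>] nat_trans_karoubi[OF nat_\<epsilon>] by (simp_all add: karoubi_fctr_fcomp)
  next
    fix a assume "a \<in> Ob (catA (karoubi_adj F))"
    then have a: "a \<in> Ob (karoubi A)" by simp
    show "acounit (karoubi_adj F) (Fo (left (karoubi_adj F)) a) \<cdot>\<^bsub>catB (karoubi_adj F)\<^esub>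
        Fa (left (karoubi_adj F)) (aunit (karoubi_adj F) a)
        = Ide (catB (karoubi_adj F)) (Fo (left (karoubi_adj F)) a)"
      using karoubi_trans_comp[OF w(1)[unfolded fcomp_fid fcomp_assoc] w(2)[unfolded fcomp_fid fcomp_assoc] a]
        karoubi_trans_cong[OF a triangle_L]
      unfolding karoubi_adj_simps karoubi_trans_whisker_right
        karoubi_trans_whisker_left[OF nat_\<eta> L.is_functor a] fcomp_fid fcomp_assoc karoubi_trans_id[OF L.is_functor a, symmetric]
      by simp
  next
    fix b assume "b \<in> Ob (catB (karoubi_adj F))"
    then have b: "b \<in> Ob (karoubi B)" by simp
    show "Fa (right (karoubi_adj F)) (acounit (karoubi_adj F) b) \<cdot>\<^bsub>catA (karoubi_adj F)\<^esub>
        aunit (karoubi_adj F) (Fo (right (karoubi_adj F)) b)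
        = Ide (catA (karoubi_adj F)) (Fo (right (karoubi_adj F)) b)"
      using karoubi_trans_comp[OF w(4)[unfolded fcomp_fid fcomp_assoc] w(3)[unfolded fcomp_fid fcomp_assoc] b]
        karoubi_trans_cong[OF b triangle_R]
      unfolding karoubi_adj_simps karoubi_trans_whisker_right
        karoubi_trans_whisker_left[OF nat_\<epsilon> R.is_functor b] fcomp_fid fcomp_assoc karoubi_trans_id[OF R.is_functor b, symmetric]
      by simp
  qed (simp_all add: is_functor_karoubi L.is_functor R.is_functor)
qed

lemma karoubi_amor_simps [simp]:
  "mH (karoubi_amor F G \<Upsilon>) = karoubi_fctr (mH \<Upsilon>)" "mK (karoubi_amor F G \<Upsilon>) = karoubi_fctr (mK \<Upsilon>)"
  "upL (karoubi_amor F G \<Upsilon>) = karoubi_trans (catB G) (mK \<Upsilon> \<bullet> left F) (left G \<bullet> mH \<Upsilon>) (upL \<Upsilon>)"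
  "upR (karoubi_amor F G \<Upsilon>) = karoubi_trans (catA G) (mH \<Upsilon> \<bullet> right F) (right G \<bullet> mK \<Upsilon>) (upR \<Upsilon>)"
  by (simp_all add: karoubi_amor_def)

lemma adj_morphism_karoubi:
  assumes "adj_morphism F G \<Upsilon>"
  shows "adj_morphism (karoubi_adj F) (karoubi_adj G) (karoubi_amor F G \<Upsilon>)"
proof -
  interpret adj_mor F G \<Upsilon> using assms by (rule adj_mor_intro)
  note fc = fcomp_fid fcomp_assoc
  note l1 = nat_isoD[OF nat_iso_l] and r1 = nat_isoD[OF nat_iso_r]
  note w = nat_trans_whisker_left[OF l1 G.R.is_functor, unfolded fc]
    nat_trans_whisker_right[OF r1 F.L.is_functor, unfolded fc]
    nat_trans_whisker_left[OF F.nat_\<eta> H.is_functor, unfolded fc]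
    nat_trans_whisker_left[OF r1 G.L.is_functor, unfolded fc]
    nat_trans_whisker_right[OF l1 F.R.is_functor, unfolded fc]
    nat_trans_whisker_right[OF G.nat_\<epsilon> K.is_functor, unfolded fc]
  show ?thesis
    unfolding adj_morphism_def
  proof (intro conjI ballI)
    fix a assume "a \<in> Ob (catA (karoubi_adj F))"
    then have a: "a \<in> Ob (karoubi F.A)" by simp
    show "Fa (right (karoubi_adj G)) (upL (karoubi_amor F G \<Upsilon>) a) \<cdot>\<^bsub>catA (karoubi_adj G)\<^esub>
        upR (karoubi_amor F G \<Upsilon>) (Fo (left (karoubi_adj F)) a) \<cdot>\<^bsub>catA (karoubi_adj G)\<^esub>
        Fa (mH (karoubi_amor F G \<Upsilon>)) (aunit (karoubi_adj F) a)
        = aunit (karoubi_adj G) (Fo (mH (karoubi_amor F G \<Upsilon>)) a)"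
      unfolding karoubi_adj_simps karoubi_amor_simps karoubi_trans_whisker_right
        karoubi_trans_whisker_left[OF l1 G.R.is_functor a]
        karoubi_trans_whisker_left[OF F.nat_\<eta> H.is_functor a] fc
        karoubi_trans_comp[OF w(3) w(2) a] karoubi_trans_comp[OF nat_trans_comp[OF w(3) w(2)] w(1) a]
      by (rule karoubi_trans_cong[OF a]) (rule unit_law)
  next
    fix b assume "b \<in> Ob (catB (karoubi_adj F))"
    then have b: "b \<in> Ob (karoubi F.B)" by simp
    show "acounit (karoubi_adj G) (Fo (mK (karoubi_amor F G \<Upsilon>)) b) \<cdot>\<^bsub>catB (karoubi_adj G)\<^esub>
        Fa (left (karoubi_adj G)) (upR (karoubi_amor F G \<Upsilon>) b) \<cdot>\<^bsub>catB (karoubi_adj G)\<^esub>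
        upL (karoubi_amor F G \<Upsilon>) (Fo (right (karoubi_adj F)) b)
        = Fa (mK (karoubi_amor F G \<Upsilon>)) (acounit (karoubi_adj F) b)"
      unfolding karoubi_adj_simps karoubi_amor_simps karoubi_trans_whisker_right
        karoubi_trans_whisker_left[OF r1 G.L.is_functor b]
        karoubi_trans_whisker_left[OF F.nat_\<epsilon> K.is_functor b] fc
        karoubi_trans_comp[OF w(5) w(4) b] karoubi_trans_comp[OF nat_trans_comp[OF w(5) w(4)] w(6) b]
      by (rule karoubi_trans_cong[OF b]) (rule counit_law)
  qed (use is_adjunction_karoubi F.is_adjunction G.is_adjunction is_functor_karoubi H.is_functor K.is_functor
      nat_iso_karoubi[OF nat_iso_l] nat_iso_karoubi[OF nat_iso_r] in \<open>simp_all add: karoubi_fctr_fcomp\<close>)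
qed

lemma karoubi_amor_id:
  assumes "is_adjunction F"
  shows "amor_eq (karoubi_adj F) (karoubi_amor F F (amor_id F)) (amor_id (karoubi_adj F))"
proof -
  interpret adjunction F by unfold_locales fact
  show ?thesis
    by (auto simp: amor_eq_def karoubi_trans_simp)
qed

lemma karoubi_amor_comp:
  assumes "adj_morphism F G \<Upsilon>" "adj_morphism G L \<Psi>"
  shows "amor_eq (karoubi_adj F) (karoubi_amor F L (amor_comp L \<Psi> \<Upsilon>))
    (amor_comp (karoubi_adj L) (karoubi_amor G L \<Psi>) (karoubi_amor F G \<Upsilon>))"
proof -
  interpret U: adj_mor F G \<Upsilon> using assms(1) by (rule adj_mor_intro)
  interpret P: adj_mor G L \<Psi> using assms(2) by (rule adj_mor_intro)
  note fc = fcomp_fid fcomp_assoc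
  note l1 = nat_isoD[OF U.nat_iso_l] and r1 = nat_isoD[OF U.nat_iso_r]
  note w = nat_trans_whisker_left[OF l1 P.K.is_functor, unfolded fc]
    nat_trans_whisker_right[OF nat_isoD[OF P.nat_iso_l] U.H.is_functor, unfolded fc]
    nat_trans_whisker_left[OF r1 P.H.is_functor, unfolded fc]
    nat_trans_whisker_right[OF nat_isoD[OF P.nat_iso_r] U.K.is_functor, unfolded fc]
  show ?thesis
    unfolding amor_eq_def karoubi_adj_simps amor_comp_simps karoubi_amor_simps
      karoubi_trans_whisker_right karoubi_fctr_fcomp
    using karoubi_trans_comp[OF w(1,2)] karoubi_trans_whisker_left[OF l1 P.K.is_functor]
      karoubi_trans_comp[OF w(3,4)] karoubi_trans_whisker_left[OF r1 P.H.is_functor]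
    \<comment> \<open>Rules that open up objects and arrows of the completion are removed, so that
      lifted 2-cells are composed as wholes by \<open>karoubi_trans_comp\<close>.\<close>
    by (simp add: fc del: karoubi_simps karoubi_fctr_simps Ob_karoubi split_paired_Ball_Sigma)
qed

lemma karoubi_amor_iso:
  assumes "amor_iso F G \<Upsilon> \<Upsilon>'"
  shows "amor_iso (karoubi_adj F) (karoubi_adj G) (karoubi_amor F G \<Upsilon>) (karoubi_amor F G \<Upsilon>')"
proof -
  obtain \<theta> \<phi> where "adj_mor_iso F G \<Upsilon> \<Upsilon>' \<theta> \<phi>" using assms by (rule amor_isoE)
  then interpret adj_mor_iso F G \<Upsilon> \<Upsilon>' \<theta> \<phi> .
  note fc = fcomp_fid fcomp_assoc
  note l = nat_isoD[OF U.nat_iso_l] nat_isoD[OF U'.nat_iso_l] and r = nat_isoD[OF U.nat_iso_r] nat_isoD[OF U'.nat_iso_r]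
    and t = nat_isoD[OF nat_\<theta>] and p = nat_isoD[OF nat_\<phi>]
  note w = nat_trans_whisker_left[OF t U.G.L.is_functor, unfolded fc]
    nat_trans_whisker_right[OF p U.F.L.is_functor, unfolded fc]
    nat_trans_whisker_left[OF p U.G.R.is_functor, unfolded fc]
    nat_trans_whisker_right[OF t U.F.R.is_functor, unfolded fc]
  show ?thesis
    unfolding amor_iso_def
  proof (intro conjI exI ballI)
    show "nat_iso (catA (karoubi_adj F)) (catA (karoubi_adj G)) (mH (karoubi_amor F G \<Upsilon>))
        (mH (karoubi_amor F G \<Upsilon>')) (karoubi_trans (catA G) (mH \<Upsilon>) (mH \<Upsilon>') \<theta>)"
      "nat_iso (catB (karoubi_adj F)) (catB (karoubi_adj G)) (mK (karoubi_amor F G \<Upsilon>))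
        (mK (karoubi_amor F G \<Upsilon>')) (karoubi_trans (catB G) (mK \<Upsilon>) (mK \<Upsilon>') \<phi>)"
      using nat_iso_karoubi[OF nat_\<theta>] nat_iso_karoubi[OF nat_\<phi>] by simp_all
  next
    fix a assume "a \<in> Ob (catA (karoubi_adj F))"
    then have a: "a \<in> Ob (karoubi U.F.A)" by simp
    show "upL (karoubi_amor F G \<Upsilon>') a \<cdot>\<^bsub>catB (karoubi_adj G)\<^esub>
        karoubi_trans (catB G) (mK \<Upsilon>) (mK \<Upsilon>') \<phi> (Fo (left (karoubi_adj F)) a)
        = Fa (left (karoubi_adj G)) (karoubi_trans (catA G) (mH \<Upsilon>) (mH \<Upsilon>') \<theta> a)
          \<cdot>\<^bsub>catB (karoubi_adj G)\<^esub> upL (karoubi_amor F G \<Upsilon>) a"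
      unfolding karoubi_adj_simps karoubi_amor_simps karoubi_trans_whisker_right
        karoubi_trans_whisker_left[OF t U.G.L.is_functor a]
        karoubi_trans_comp[OF l(1) w(1) a] karoubi_trans_comp[OF w(2) l(2) a]
      by (rule karoubi_trans_cong[OF a]) (rule compat_l)
  next
    fix b assume "b \<in> Ob (catB (karoubi_adj F))"
    then have b: "b \<in> Ob (karoubi U.F.B)" by simp
    show "upR (karoubi_amor F G \<Upsilon>') b \<cdot>\<^bsub>catA (karoubi_adj G)\<^esub>
        karoubi_trans (catA G) (mH \<Upsilon>) (mH \<Upsilon>') \<theta> (Fo (right (karoubi_adj F)) b)
        = Fa (right (karoubi_adj G)) (karoubi_trans (catB G) (mK \<Upsilon>) (mK \<Upsilon>') \<phi> b)
          \<cdot>\<^bsub>catA (karoubi_adj G)\<^esub> upR (karoubi_amor F G \<Upsilon>) b"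
      unfolding karoubi_adj_simps karoubi_amor_simps karoubi_trans_whisker_right
        karoubi_trans_whisker_left[OF p U.G.R.is_functor b]
        karoubi_trans_comp[OF r(1) w(3) b] karoubi_trans_comp[OF w(4) r(2) b]
      by (rule karoubi_trans_cong[OF b]) (rule compat_r)
  qed (use adj_morphism_karoubi U.adj_morphism U'.adj_morphism in auto)
qed

subsection \<open>The embedding\<close>

lemma karoubi_embed_simps [simp]:
  "Fo (karoubi_embed C) x = (x, Ide C x)"
  "Fa (karoubi_embed C) f = Arrow (Dom C f, Ide C (Dom C f)) f (Cod C f, Ide C (Cod C f))"
  by (simp_all add: karoubi_embed_def Let_def)

lemma is_functor_karoubi_embed: "is_category C \<Longrightarrow> is_functor C (karoubi C) (karoubi_embed C)"
  by (rule is_functorI) auto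

lemma adj_embed_simps [simp]:
  "mH (adj_embed F) = karoubi_embed (catA F)" "mK (adj_embed F) = karoubi_embed (catB F)"
  "upL (adj_embed F) a = Ide (karoubi (catB F)) (Fo (karoubi_embed (catB F)) (Fo (left F) a))"
  "upR (adj_embed F) b = Ide (karoubi (catA F)) (Fo (karoubi_embed (catA F)) (Fo (right F) b))"
  by (simp_all add: adj_embed_def)

lemma adj_morphism_embed:
  assumes "is_adjunction F"
  shows "adj_morphism F (karoubi_adj F) (adj_embed F)"
proof -
  interpret adjunction F by unfold_locales fact
  have "is_iso (karoubi A) (Arrow (a, Ide A a) (Ide A a) (a, Ide A a))" if "a \<in> Ob A" for a
    using iso_Ide[of "karoubi A" "(a, Ide A a)"] that by simp
  moreover have "is_iso (karoubi B) (Arrow (b, Ide B b) (Ide B b) (b, Ide B b))" if "b \<in> Ob B" for b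
    using iso_Ide[of "karoubi B" "(b, Ide B b)"] that by simp
  ultimately show ?thesis
    by (intro adj_morphismI)
      (auto simp: assms is_adjunction_karoubi is_functor_karoubi_embed karoubi_trans_simp)
qed

text \<open>A functor sends the identity of \<open>x\<close> to an identity, so its completion sends
  embedded objects to embedded objects; the square commutes strictly on the carriers.\<close>

lemma adj_embed_natural:
  assumes "adj_morphism F G \<Upsilon>"
  shows "amor_iso F (karoubi_adj G) (amor_comp (karoubi_adj G) (karoubi_amor F G \<Upsilon>) (adj_embed F))
    (amor_comp (karoubi_adj G) (adj_embed G) \<Upsilon>)"
proof -
  interpret adj_mor F G \<Upsilon> using assms by (rule adj_mor_intro)
  show ?thesis
  proof (rule amor_eq_imp_iso)
    show "adj_morphism F (karoubi_adj G) (amor_comp (karoubi_adj G) (karoubi_amor F G \<Upsilon>) (adj_embed F))"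
      by (rule adj_morphism_comp[OF adj_morphism_embed[OF F.is_adjunction] adj_morphism_karoubi[OF assms]])
    show "amor_eq F (amor_comp (karoubi_adj G) (karoubi_amor F G \<Upsilon>) (adj_embed F))
        (amor_comp (karoubi_adj G) (adj_embed G) \<Upsilon>)"
      by (simp add: amor_eq_def karoubi_trans_simp)
  qed
qed

text \<open>The two embeddings of the completion into its own completion send \<open>(x, p)\<close> to itself with
  its identity and to \<open>(x, 1)\<close> with the idempotent \<open>p\<close>; the arrow \<open>p\<close> identifies them.\<close>

definition embed_shift :: "('o, 'm) cat \<Rightarrow> ('o, 'm) kob \<Rightarrow> (('o, 'm) kob, ('o, 'm) karr) karr" where
  "embed_shift C xp = (case xp of (x, p) \<Rightarrow>
     Arrow ((x, p), Arrow (x, p) p (x, p)) (Arrow (x, p) p (x, Ide C x))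
       ((x, Ide C x), Arrow (x, Ide C x) p (x, Ide C x)))"

lemma embed_shift_iso:
  assumes [simp]: "is_category C" and "(x, p) \<in> Ob (karoubi C)"
  shows "is_iso (karoubi (karoubi C)) (embed_shift C (x, p))"
  \<comment> \<open>The inverse is \<open>p\<close> read in the other direction:
    \<open>p p = p\<close> underlies the identity of either end.\<close>
  by (rule is_isoI(1)[of _ _ "Arrow ((x, Ide C x), Arrow (x, Ide C x) p (x, Ide C x)) (Arrow (x, Ide C x) p (x, p))
      ((x, p), Arrow (x, p) p (x, p))"]) (use assms(2) in \<open>auto simp: embed_shift_def\<close>)

text \<open>This is the well-pointedness of completion. In \<open>Nuc_amor_unit\<close> it is
  combined with the corresponding property of \<open>nuc\<close>.\<close>

lemma adj_embed_karoubi: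
  assumes "is_adjunction F"
  shows "amor_iso (karoubi_adj F) (karoubi_adj (karoubi_adj F)) (adj_embed (karoubi_adj F))
    (karoubi_amor F (karoubi_adj F) (adj_embed F))"
proof -
  interpret adjunction F by unfold_locales fact
  show ?thesis
  proof (rule amor_isoI[where \<theta> = "embed_shift A" and \<phi> = "embed_shift B"])
    show "adj_morphism (karoubi_adj F) (karoubi_adj (karoubi_adj F)) (adj_embed (karoubi_adj F))"
      by (intro adj_morphism_embed is_adjunction_karoubi assms)
    show "adj_morphism (karoubi_adj F) (karoubi_adj (karoubi_adj F)) (karoubi_amor F (karoubi_adj F) (adj_embed F))"
      by (intro adj_morphism_karoubi adj_morphism_embed assms)
  next
    fix a assume "a \<in> Ob (catA (karoubi_adj F))"
    then show "is_iso (catA (karoubi_adj (karoubi_adj F))) (embed_shift A a) \<and>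
         Dom (catA (karoubi_adj (karoubi_adj F))) (embed_shift A a) = Fo (mH (adj_embed (karoubi_adj F))) a \<and>
         Cod (catA (karoubi_adj (karoubi_adj F))) (embed_shift A a) =
         Fo (mH (karoubi_amor F (karoubi_adj F) (adj_embed F))) a"
      "upL (karoubi_amor F (karoubi_adj F) (adj_embed F)) a \<cdot>\<^bsub>catB (karoubi_adj (karoubi_adj F))\<^esub>
         embed_shift B (Fo (left (karoubi_adj F)) a) =
         Fa (left (karoubi_adj (karoubi_adj F))) (embed_shift A a)
           \<cdot>\<^bsub>catB (karoubi_adj (karoubi_adj F))\<^esub> upL (adj_embed (karoubi_adj F)) a"
      by (cases a; simp add: embed_shift_iso del: Ob_karoubi; simp add: embed_shift_def karoubi_trans_simp L.Fa_absorb)+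
  next
    fix b assume "b \<in> Ob (catB (karoubi_adj F))"
    then show "is_iso (catB (karoubi_adj (karoubi_adj F))) (embed_shift B b) \<and>
         Dom (catB (karoubi_adj (karoubi_adj F))) (embed_shift B b) = Fo (mK (adj_embed (karoubi_adj F))) b \<and>
         Cod (catB (karoubi_adj (karoubi_adj F))) (embed_shift B b) =
         Fo (mK (karoubi_amor F (karoubi_adj F) (adj_embed F))) b"
      "upR (karoubi_amor F (karoubi_adj F) (adj_embed F)) b \<cdot>\<^bsub>catA (karoubi_adj (karoubi_adj F))\<^esub>
         embed_shift A (Fo (right (karoubi_adj F)) b) =
         Fa (right (karoubi_adj (karoubi_adj F))) (embed_shift B b)
           \<cdot>\<^bsub>catA (karoubi_adj (karoubi_adj F))\<^esub> upR (adj_embed (karoubi_adj F)) b"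
      by (cases b; simp add: embed_shift_iso del: Ob_karoubi; simp add: embed_shift_def karoubi_trans_simp R.Fa_absorb)+
  qed (auto elim!: ArrE_karoubi[rotated] simp: embed_shift_def)
qed

section \<open>Splitting of idempotents in the completion\<close>

definition split_idempotents :: "('o, 'm) cat \<Rightarrow> bool" where
  "split_idempotents C \<longleftrightarrow> (\<forall>e\<in>Arr C. Cod C e = Dom C e \<and> e \<cdot>\<^bsub>C\<^esub> e = e \<longrightarrow>
     (\<exists>r i. r \<in> Arr C \<and> i \<in> Arr C \<and> Dom C r = Dom C e \<and> Cod C i = Dom C e \<and> Dom C i = Cod C r \<and>
        i \<cdot>\<^bsub>C\<^esub> r = e \<and> r \<cdot>\<^bsub>C\<^esub> i = Ide C (Cod C r)))"

lemma split_idempotents_karoubi: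
  assumes C: "is_category C"
  shows "split_idempotents (karoubi C)"
  unfolding split_idempotents_def
proof (intro ballI impI, elim conjE)
  note [simp] = C
  fix e assume e: "e \<in> Arr (karoubi C)" "Cod (karoubi C) e = Dom (karoubi C) e" "e \<cdot>\<^bsub>karoubi C\<^esub> e = e"
  obtain x p u where *: "e = Arrow (x, p) u (x, p)"
    using e(1,2) by (cases rule: ArrE_karoubi[OF C e(1)]) simp
  with e have "x \<in> Ob C" "p \<in> Arr C" "Dom C p = x" "Cod C p = x" "p \<cdot>\<^bsub>C\<^esub> p = p"
    "u \<in> Arr C" "Dom C u = x" "Cod C u = x" "p \<cdot>\<^bsub>C\<^esub> u = u" "u \<cdot>\<^bsub>C\<^esub> p = u" "u \<cdot>\<^bsub>C\<^esub> u = u"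
    by simp_all
  then show "\<exists>r i. r \<in> Arr (karoubi C) \<and> i \<in> Arr (karoubi C) \<and> Dom (karoubi C) r = Dom (karoubi C) e \<and>
      Cod (karoubi C) i = Dom (karoubi C) e \<and> Dom (karoubi C) i = Cod (karoubi C) r \<and>
      i \<cdot>\<^bsub>karoubi C\<^esub> r = e \<and> r \<cdot>\<^bsub>karoubi C\<^esub> i = Ide (karoubi C) (Cod (karoubi C) r)"
    \<comment> \<open>An idempotent \<open>u\<close> on \<open>(x, p)\<close> is itself the second
      half of an object \<open>(x, u)\<close>, through which it splits with \<open>u\<close> as both
      halves.\<close>
    by (intro exI[of _ "Arrow (x, p) u (x, u)"] exI[of _ "Arrow (x, u) u (x, p)"]) (simp add: *)
qed

section \<open>Duality\<close>

definition op_cat :: "('o, 'm) cat \<Rightarrow> ('o, 'm) cat" where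
  "op_cat C = \<lparr>Ob = Ob C, Arr = Arr C, Dom = Cod C, Cod = Dom C, Ide = Ide C, Comp = (\<lambda>g f. f \<cdot>\<^bsub>C\<^esub> g)\<rparr>"

text \<open>The coalgebras of the opposite adjunction are the algebras of \<open>F\<close>. Facts on
  the level of the base categories are proved for coalgebras and read off for algebras.\<close>

definition op_adj :: "('oa, 'ma, 'ob, 'mb) adj \<Rightarrow> ('ob, 'mb, 'oa, 'ma) adj" where
  "op_adj F = \<lparr>catA = op_cat (catB F), catB = op_cat (catA F), left = right F, right = left F,
     aunit = acounit F, acounit = aunit F\<rparr>"

text \<open>Reversing arrows would turn the 2-cells of a morphism around, so their inverses are
  taken. Duality for morphisms thus rests on the invertibility of the 2-cells; \<open>G\<close>
  names the categories in which the inverses are formed.\<close>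

definition op_amor ::
  "('oc, 'mc, 'od, 'md) adj \<Rightarrow> ('oa, 'ma, 'ob, 'mb, 'oc, 'mc, 'od, 'md) amor
    \<Rightarrow> ('ob, 'mb, 'oa, 'ma, 'od, 'md, 'oc, 'mc) amor" where
  "op_amor G \<Upsilon> = \<lparr>mH = mK \<Upsilon>, mK = mH \<Upsilon>, upL = (\<lambda>b. inv_arr (catA G) (upR \<Upsilon> b)),
     upR = (\<lambda>a. inv_arr (catB G) (upL \<Upsilon> a))\<rparr>"

lemma op_cat_simps [simp]:
  "Ob (op_cat C) = Ob C" "Arr (op_cat C) = Arr C" "Dom (op_cat C) = Cod C" "Cod (op_cat C) = Dom C"
  "Ide (op_cat C) = Ide C" "g \<cdot>\<^bsub>op_cat C\<^esub> f = f \<cdot>\<^bsub>C\<^esub> g"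
  by (simp_all add: op_cat_def)

lemma op_adj_simps [simp]:
  "catA (op_adj F) = op_cat (catB F)" "catB (op_adj F) = op_cat (catA F)"
  "left (op_adj F) = right F" "right (op_adj F) = left F"
  "aunit (op_adj F) = acounit F" "acounit (op_adj F) = aunit F"
  by (simp_all add: op_adj_def)

lemma op_amor_simps [simp]:
  "mH (op_amor G \<Upsilon>) = mK \<Upsilon>" "mK (op_amor G \<Upsilon>) = mH \<Upsilon>"
  "upL (op_amor G \<Upsilon>) b = inv_arr (catA G) (upR \<Upsilon> b)" "upR (op_amor G \<Upsilon>) a = inv_arr (catB G) (upL \<Upsilon> a)"
  by (simp_all add: op_amor_def)

lemma inverse_arrows_op [simp]: "inverse_arrows (op_cat C) f g \<longleftrightarrow> inverse_arrows C f g"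
  by (auto simp: inverse_arrows_def)

lemma is_iso_op [simp]: "is_iso (op_cat C) f \<longleftrightarrow> is_iso C f"
  and inv_arr_op [simp]: "inv_arr (op_cat C) f = inv_arr C f"
  by (simp_all add: is_iso_def inv_arr_def)

lemma is_category_op: "is_category C \<Longrightarrow> is_category (op_cat C)"
  by (rule is_categoryI) auto

lemma is_functor_op: "is_functor C D H \<Longrightarrow> is_functor (op_cat C) (op_cat D) H"
proof -
  assume "is_functor C D H"
  then interpret cat_functor C D H by unfold_locales
  show ?thesis by (rule is_functorI) (auto simp: is_category_op)
qed

lemma is_adjunction_op: "is_adjunction F \<Longrightarrow> is_adjunction (op_adj F)"
proof -
  assume "is_adjunction F"
  then interpret adjunction F by unfold_locales
  show ?thesis
    by (rule is_adjunctionI) (simp_all add: is_functor_op L.is_functor R.is_functor)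
qed

lemma adj_morphism_op: "adj_morphism F G \<Upsilon> \<Longrightarrow> adj_morphism (op_adj F) (op_adj G) (op_amor G \<Upsilon>)"
proof -
  assume "adj_morphism F G \<Upsilon>"
  then interpret adj_mor F G \<Upsilon> by (rule adj_mor_intro)
  show ?thesis
  proof (rule adj_morphismI)
    fix a assume "a \<in> Ob (catA (op_adj F))"
    then have a: "a \<in> Ob F.B" by simp
    then show "Fa (right (op_adj G)) (upL (op_amor G \<Upsilon>) a) \<cdot>\<^bsub>catA (op_adj G)\<^esub>
         upR (op_amor G \<Upsilon>) (Fo (left (op_adj F)) a) \<cdot>\<^bsub>catA (op_adj G)\<^esub>
         Fa (mH (op_amor G \<Upsilon>)) (aunit (op_adj F) a) =
         aunit (op_adj G) (Fo (mH (op_amor G \<Upsilon>)) a)"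
      by (simp add: counit_law')
  next
    fix b assume "b \<in> Ob (catB (op_adj F))"
    then have b: "b \<in> Ob F.A" by simp
    then show "acounit (op_adj G) (Fo (mK (op_amor G \<Upsilon>)) b) \<cdot>\<^bsub>catB (op_adj G)\<^esub>
         Fa (left (op_adj G)) (upR (op_amor G \<Upsilon>) b) \<cdot>\<^bsub>catB (op_adj G)\<^esub>
         upL (op_amor G \<Upsilon>) (Fo (right (op_adj F)) b) =
         Fa (mK (op_amor G \<Upsilon>)) (acounit (op_adj F) b)"
      by (simp add: unit_law')
  qed (simp_all add: is_functor_op H.is_functor K.is_functor F.is_adjunction G.is_adjunction is_adjunction_op)
qed

section \<open>Coalgebras and algebras\<close>

text \<open>A predicate on the adjunction, in place of membership in \<open>Ob (Coalg F)\<close>,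
  can be instantiated at \<open>op_adj F\<close>. \<open>Coalg_structured\<close> and
  \<open>Alg_structured\<close> tie it to the categories.\<close>

definition coalg :: "('oa, 'ma, 'ob, 'mb) adj \<Rightarrow> 'ob \<Rightarrow> 'mb \<Rightarrow> bool" where
  "coalg F b \<beta> \<longleftrightarrow> b \<in> Ob (catB F) \<and> \<beta> \<in> Arr (catB F) \<and> Dom (catB F) \<beta> = b \<and>
     Cod (catB F) \<beta> = Fo (left F) (Fo (right F) b) \<and> acounit F b \<cdot>\<^bsub>catB F\<^esub> \<beta> = Ide (catB F) b \<and>
     Fa (left F) (Fa (right F) \<beta>) \<cdot>\<^bsub>catB F\<^esub> \<beta> = Fa (left F) (aunit F (Fo (right F) b)) \<cdot>\<^bsub>catB F\<^esub> \<beta>"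

definition coalg_hom :: "('oa, 'ma, 'ob, 'mb) adj \<Rightarrow> 'ob \<times> 'mb \<Rightarrow> 'ob \<times> 'mb \<Rightarrow> 'mb \<Rightarrow> bool" where
  "coalg_hom F x y g \<longleftrightarrow> g \<in> Arr (catB F) \<and> Dom (catB F) g = fst x \<and> Cod (catB F) g = fst y \<and>
     snd y \<cdot>\<^bsub>catB F\<^esub> g = Fa (left F) (Fa (right F) g) \<cdot>\<^bsub>catB F\<^esub> snd x"

abbreviation alg :: "('oa, 'ma, 'ob, 'mb) adj \<Rightarrow> 'oa \<Rightarrow> 'ma \<Rightarrow> bool" where
  "alg F \<equiv> coalg (op_adj F)"

text \<open>The arguments \<open>x\<close> and \<open>y\<close> are exchanged because the opposite
  category reverses arrows.\<close>

abbreviation alg_hom :: "('oa, 'ma, 'ob, 'mb) adj \<Rightarrow> 'oa \<times> 'ma \<Rightarrow> 'oa \<times> 'ma \<Rightarrow> 'ma \<Rightarrow> bool" where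
  "alg_hom F x y f \<equiv> coalg_hom (op_adj F) y x f"

lemma alg_hom_iff: "alg_hom F x y f \<longleftrightarrow> f \<in> Arr (catA F) \<and> Dom (catA F) f = fst x \<and> Cod (catA F) f = fst y \<and>
     f \<cdot>\<^bsub>catA F\<^esub> snd x = snd y \<cdot>\<^bsub>catA F\<^esub> Fa (right F) (Fa (left F) f)"
  by (auto simp: coalg_hom_def)

lemma Coalg_structured:
  "Coalg F = structured_cat {(b, \<beta>). coalg F b \<beta>} (\<lambda>x y. {g. coalg_hom F x y g})
     (\<lambda>x. Ide (catB F) (fst x)) (Comp (catB F))"
  by (auto simp: Coalg_def coalgebras_def adj_comonad_def structured_cat_def coalg_def coalg_hom_def
      Let_def fun_eq_iff split_beta)

lemma Alg_structured:
  "Alg F = structured_cat {(a, \<alpha>). alg F a \<alpha>} (\<lambda>x y. {f. alg_hom F x y f})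
     (\<lambda>x. Ide (catA F) (fst x)) (Comp (catA F))"
  by (auto simp: Alg_def algebras_def adj_monad_def structured_cat_def coalg_def coalg_hom_def
      Let_def fun_eq_iff split_beta)

lemma Coalg_simps [simp]:
  "(b, \<beta>) \<in> Ob (Coalg F) \<longleftrightarrow> coalg F b \<beta>"
  "Dom (Coalg F) = asrc" "Cod (Coalg F) = atgt" "Ide (Coalg F) x = Arrow x (Ide (catB F) (fst x)) x"
  "g \<cdot>\<^bsub>Coalg F\<^esub> f = Arrow (asrc f) (base g \<cdot>\<^bsub>catB F\<^esub> base f) (atgt g)"
  "Arrow (b, \<beta>) u (b', \<beta>') \<in> Arr (Coalg F) \<longleftrightarrow> coalg F b \<beta> \<and> coalg F b' \<beta>' \<and> coalg_hom F (b, \<beta>) (b', \<beta>') u"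
  by (simp_all add: Coalg_structured)

lemma Alg_simps [simp]:
  "(a, \<alpha>) \<in> Ob (Alg F) \<longleftrightarrow> alg F a \<alpha>"
  "Dom (Alg F) = asrc" "Cod (Alg F) = atgt" "Ide (Alg F) x = Arrow x (Ide (catA F) (fst x)) x"
  "g \<cdot>\<^bsub>Alg F\<^esub> f = Arrow (asrc f) (base g \<cdot>\<^bsub>catA F\<^esub> base f) (atgt g)"
  "Arrow (a, \<alpha>) u (a', \<alpha>') \<in> Arr (Alg F) \<longleftrightarrow> alg F a \<alpha> \<and> alg F a' \<alpha>' \<and> alg_hom F (a, \<alpha>) (a', \<alpha>') u"
  by (simp_all add: Alg_structured)

context adjunction
begin

lemma op: "adjunction (op_adj F)"
  by unfold_locales (simp add: is_adjunction is_adjunction_op)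

lemma coalgD:
  assumes "coalg F b \<beta>"
  shows "b \<in> Ob B" "\<beta> \<in> Arr B" "Dom B \<beta> = b" "Cod B \<beta> = Lo (Ro b)" "\<epsilon> b \<cdot>\<^bsub>B\<^esub> \<beta> = Ide B b"
    "La (Ra \<beta>) \<cdot>\<^bsub>B\<^esub> \<beta> = La (\<eta> (Ro b)) \<cdot>\<^bsub>B\<^esub> \<beta>"
  using assms unfolding coalg_def by blast+

lemma coalg_counit [simp]:
  assumes "coalg F b \<beta>"
  shows "\<epsilon> b \<cdot>\<^bsub>B\<^esub> \<beta> = Ide B b" "\<lbrakk>k \<in> Arr B; Cod B k = b\<rbrakk> \<Longrightarrow> \<epsilon> b \<cdot>\<^bsub>B\<^esub> \<beta> \<cdot>\<^bsub>B\<^esub> k = k"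
  using coalgD(5)[OF assms] Comp_reduce[OF _ coalgD(5)[OF assms], of k] coalgD(1-4)[OF assms] by simp_all

lemma coalg_homD:
  assumes "coalg_hom F (b, \<beta>) (b', \<beta>') g"
  shows "g \<in> Arr B" "Dom B g = b" "Cod B g = b'" "\<beta>' \<cdot>\<^bsub>B\<^esub> g = La (Ra g) \<cdot>\<^bsub>B\<^esub> \<beta>"
  using assms unfolding coalg_hom_def fst_conv snd_conv by blast+

lemma coalg_hom_id: "coalg F b \<beta> \<Longrightarrow> coalg_hom F (b, \<beta>) (b, \<beta>) (Ide B b)"
  using coalgD[of b \<beta>] by (simp add: coalg_hom_def)

lemma coalg_hom_comp:
  assumes "coalg F b \<beta>" "coalg F b' \<beta>'" "coalg F b'' \<beta>''"
    "coalg_hom F (b, \<beta>) (b', \<beta>') f" "coalg_hom F (b', \<beta>') (b'', \<beta>'') g"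
  shows "coalg_hom F (b, \<beta>) (b'', \<beta>'') (g \<cdot>\<^bsub>B\<^esub> f)"
proof -
  note * = coalgD(1-4)[OF assms(1)] coalgD(1-4)[OF assms(2)] coalgD(1-4)[OF assms(3)]
    coalg_homD[OF assms(4)] coalg_homD[OF assms(5)]
  then show ?thesis
    using Comp_reduce2[OF _ coalg_homD(4)[OF assms(5)], of f] by (simp add: coalg_hom_def)
qed

text \<open>Composing with the invertible \<open>f\<close> reduces the equation for the inverse to
  the one for \<open>f\<close>. Hence the forgetful functors reflect isomorphisms, in the form of
  \<open>iso_Coalg\<close> and \<open>iso_Alg\<close>.\<close>

lemma coalg_hom_inv:
  assumes "coalg F b \<beta>" "coalg F b' \<beta>'" "coalg_hom F (b, \<beta>) (b', \<beta>') f" "is_iso B f"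
  shows "coalg_hom F (b', \<beta>') (b, \<beta>) (inv_arr B f)"
proof -
  note * = coalgD(1-4)[OF assms(1)] coalgD(1-4)[OF assms(2)] coalg_homD[OF assms(3)] assms(4)
  have "\<beta> \<cdot>\<^bsub>B\<^esub> inv_arr B f = La (Ra (inv_arr B f)) \<cdot>\<^bsub>B\<^esub> \<beta>'"
  proof (rule iso_epi[of B f])
    show "(\<beta> \<cdot>\<^bsub>B\<^esub> inv_arr B f) \<cdot>\<^bsub>B\<^esub> f = (La (Ra (inv_arr B f)) \<cdot>\<^bsub>B\<^esub> \<beta>') \<cdot>\<^bsub>B\<^esub> f"
      using * by (simp add: L.Fa_eq[OF R.Fa_inv_cancel(2)])
  qed (use * in simp_all)
  then show ?thesis
    using * by (simp add: coalg_hom_def)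
qed

lemma coalg_cofree: "a \<in> Ob A \<Longrightarrow> coalg F (Lo a) (La (\<eta> a))"
  by (simp add: coalg_def L.Fa_eq2[OF \<eta>_nat])

lemma coalg_hom_cofree: "f \<in> Arr A \<Longrightarrow>
    coalg_hom F (Lo (Dom A f), La (\<eta> (Dom A f))) (Lo (Cod A f), La (\<eta> (Cod A f))) (La f)"
  by (simp add: coalg_hom_def L.Fa_eq2[OF \<eta>_nat])

text \<open>This is coassociativity in another guise. It makes \<open>\<beta>\<close> available as
  the unit of the nucleus at \<open>(b, \<beta>)\<close>.\<close>

lemma coalg_hom_structure: "coalg F b \<beta> \<Longrightarrow> coalg_hom F (b, \<beta>) (Lo (Ro b), La (\<eta> (Ro b))) \<beta>"
  using coalgD[of b \<beta>] by (simp add: coalg_hom_def)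

text \<open>The algebra versions: instances at \<open>op_adj F\<close> with the opposites simplified
  away.\<close>

lemmas algD = adjunction.coalgD[OF op, simplified]
lemmas alg_unit [simp] = adjunction.coalg_counit(1)[OF op, simplified]
lemmas alg_homD = adjunction.coalg_homD[OF op, simplified]
lemmas alg_hom_id = adjunction.coalg_hom_id[OF op, simplified]
lemmas alg_hom_comp = adjunction.coalg_hom_comp[OF op, simplified]
lemmas alg_hom_inv = adjunction.coalg_hom_inv[OF op, simplified]
lemmas alg_free = adjunction.coalg_cofree[OF op, simplified]
lemmas alg_hom_free = adjunction.coalg_hom_cofree[OF op, simplified]
lemmas alg_hom_structure = adjunction.coalg_hom_structure[OF op, simplified]

lemma ObE_Coalg:
  assumes "x \<in> Ob (Coalg F)"
  obtains b \<beta> where "x = (b, \<beta>)" "coalg F b \<beta>" "b \<in> Ob B" "\<beta> \<in> Arr B" "Dom B \<beta> = b" "Cod B \<beta> = Lo (Ro b)"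
  using assms coalgD by (cases x) auto

lemma ObE_Alg:
  assumes "x \<in> Ob (Alg F)"
  obtains a \<alpha> where "x = (a, \<alpha>)" "alg F a \<alpha>" "a \<in> Ob A" "\<alpha> \<in> Arr A" "Dom A \<alpha> = Ro (Lo a)" "Cod A \<alpha> = a"
  using assms algD by (cases x) auto

lemma ArrE_Coalg:
  assumes "f \<in> Arr (Coalg F)"
  obtains b \<beta> u b' \<beta>' where "f = Arrow (b, \<beta>) u (b', \<beta>')" "coalg F b \<beta>" "coalg F b' \<beta>'"
    "coalg_hom F (b, \<beta>) (b', \<beta>') u"
    "b \<in> Ob B" "\<beta> \<in> Arr B" "Dom B \<beta> = b" "Cod B \<beta> = Lo (Ro b)"
    "b' \<in> Ob B" "\<beta>' \<in> Arr B" "Dom B \<beta>' = b'" "Cod B \<beta>' = Lo (Ro b')"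
    "u \<in> Arr B" "Dom B u = b" "Cod B u = b'" "\<beta>' \<cdot>\<^bsub>B\<^esub> u = La (Ra u) \<cdot>\<^bsub>B\<^esub> \<beta>"
proof -
  obtain b \<beta> u b' \<beta>' where f: "f = Arrow (b, \<beta>) u (b', \<beta>')"
    by (metis arrow.exhaust surj_pair)
  then have *: "coalg F b \<beta>" "coalg F b' \<beta>'" "coalg_hom F (b, \<beta>) (b', \<beta>') u"
    using assms by simp_all
  show thesis
    by (rule that[OF f *] coalgD[OF *(1)] coalgD[OF *(2)] coalg_homD[OF *(3)])+
qed

lemma ArrE_Alg:
  assumes "f \<in> Arr (Alg F)"
  obtains a \<alpha> u a' \<alpha>' where "f = Arrow (a, \<alpha>) u (a', \<alpha>')" "alg F a \<alpha>" "alg F a' \<alpha>'"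
    "alg_hom F (a, \<alpha>) (a', \<alpha>') u"
    "a \<in> Ob A" "\<alpha> \<in> Arr A" "Dom A \<alpha> = Ro (Lo a)" "Cod A \<alpha> = a"
    "a' \<in> Ob A" "\<alpha>' \<in> Arr A" "Dom A \<alpha>' = Ro (Lo a')" "Cod A \<alpha>' = a'"
    "u \<in> Arr A" "Dom A u = a" "Cod A u = a'" "u \<cdot>\<^bsub>A\<^esub> \<alpha> = \<alpha>' \<cdot>\<^bsub>A\<^esub> Ra (La u)"
proof -
  obtain a \<alpha> u a' \<alpha>' where f: "f = Arrow (a, \<alpha>) u (a', \<alpha>')"
    by (metis arrow.exhaust surj_pair)
  then have *: "alg F a \<alpha>" "alg F a' \<alpha>'" "alg_hom F (a, \<alpha>) (a', \<alpha>') u"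
    using assms by simp_all
  show thesis
    by (rule that[OF f *] algD[OF *(1)] algD[OF *(2)] alg_homD[OF *(3)])+
qed

lemma is_category_Coalg [simp]: "is_category (Coalg F)"
  unfolding Coalg_structured
proof (rule is_category_structured[where U = fst])
  fix x y f assume "f \<in> {g. coalg_hom F x y g}"
  then show "f \<cdot>\<^bsub>B\<^esub> Ide B (fst x) = f \<and> Ide B (fst y) \<cdot>\<^bsub>B\<^esub> f = f"
    by (simp add: coalg_hom_def)
qed (auto simp: coalg_hom_id dest: coalgD coalg_homD intro: coalg_hom_comp)

lemma is_category_Alg [simp]: "is_category (Alg F)"
  unfolding Alg_structured
proof (rule is_category_structured[where U = fst])
  fix x y f assume "f \<in> {f. alg_hom F x y f}"
  then show "f \<cdot>\<^bsub>A\<^esub> Ide A (fst x) = f \<and> Ide A (fst y) \<cdot>\<^bsub>A\<^esub> f = f"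
    by (simp add: alg_hom_iff)
qed (auto simp: alg_hom_id dest: algD alg_homD intro: alg_hom_comp)

lemma iso_Coalg:
  assumes "Arrow x u y \<in> Arr (Coalg F)" "is_iso B u"
  shows "is_iso (Coalg F) (Arrow x u y)" "inv_arr (Coalg F) (Arrow x u y) = Arrow y (inv_arr B u) x"
  by (rule is_isoI[of _ _ "Arrow y (inv_arr B u) x"];
      use assms in \<open>cases x; cases y; auto intro: coalg_hom_inv dest: coalg_homD\<close>)+

lemma iso_Alg:
  assumes "Arrow x u y \<in> Arr (Alg F)" "is_iso A u"
  shows "is_iso (Alg F) (Arrow x u y)" "inv_arr (Alg F) (Arrow x u y) = Arrow y (inv_arr A u) x"
  by (rule is_isoI[of _ _ "Arrow y (inv_arr A u) x"];
      use assms in \<open>cases x; cases y; auto intro: alg_hom_inv dest: alg_homD\<close>)+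

end

section \<open>The comparison functors and the adjunction of the nucleus\<close>

lemma kappa_simps [simp]:
  "Fo (kappa0 F) a = (Fo (left F) a, Fa (left F) (aunit F a))"
  "Fa (kappa0 F) f = Arrow (Fo (kappa0 F) (Dom (catA F) f)) (Fa (left F) f) (Fo (kappa0 F) (Cod (catA F) f))"
  "Fo (kappa1 F) b = (Fo (right F) b, Fa (right F) (acounit F b))"
  "Fa (kappa1 F) g = Arrow (Fo (kappa1 F) (Dom (catB F) g)) (Fa (right F) g) (Fo (kappa1 F) (Cod (catB F) g))"
  by (simp_all add: kappa0_def kappa1_def Let_def)

lemma forget_simps [simp]: "Fo forget x = fst x" "Fa forget f = base f"
  by (simp_all add: forget_def)

lemma nuc_simps [simp]:
  "catA (nuc F) = Coalg F" "catB (nuc F) = Alg F"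
  "left (nuc F) = kappa1 F \<bullet> forget" "right (nuc F) = kappa0 F \<bullet> forget"
  "aunit (nuc F) (b, \<beta>) = Arrow (b, \<beta>) \<beta> (Fo (kappa0 F) (Fo (right F) b))"
  "acounit (nuc F) (a, \<alpha>) = Arrow (Fo (kappa1 F) (Fo (left F) a)) \<alpha> (a, \<alpha>)"
  by (simp_all add: nuc_def Let_def)

lemma comparison_simps [simp]:
  "mH (comparison F) = kappa0 F" "mK (comparison F) = kappa1 F"
  "upL (comparison F) a = Ide (Alg F) (Fo (kappa1 F) (Fo (left F) a))"
  "upR (comparison F) b = Ide (Coalg F) (Fo (kappa0 F) (Fo (right F) b))"
  by (simp_all add: comparison_def)

context adjunction
begin

lemma is_functor_kappa0: "is_functor A (Coalg F) (kappa0 F)"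
  by (rule is_functorI) (simp_all add: coalg_cofree coalg_hom_cofree)

lemma is_functor_kappa1: "is_functor B (Alg F) (kappa1 F)"
  by (rule is_functorI) (simp_all add: alg_free alg_hom_free)

lemma is_functor_forget_Coalg: "is_functor (Coalg F) B forget"
  by (rule is_functorI) (auto elim!: ObE_Coalg ArrE_Coalg)

lemma is_functor_forget_Alg: "is_functor (Alg F) A forget"
  by (rule is_functorI) (auto elim!: ObE_Alg ArrE_Alg)

text \<open>The triangle identities are the image under \<open>Ra\<close> of the counit law of a
  coalgebra and the image under \<open>La\<close> of the unit law of an algebra.\<close>

lemma is_adjunction_nuc: "is_adjunction (nuc F)"
proof (rule is_adjunctionI)
  show "is_functor (catA (nuc F)) (catB (nuc F)) (left (nuc F))" "is_functor (catB (nuc F)) (catA (nuc F)) (right (nuc F))"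
    using is_functor_fcomp[OF is_functor_forget_Coalg is_functor_kappa1]
      is_functor_fcomp[OF is_functor_forget_Alg is_functor_kappa0] by simp_all
qed (auto elim!: ObE_Coalg ArrE_Coalg ObE_Alg ArrE_Alg
    simp: coalg_cofree alg_free coalg_hom_structure alg_hom_structure R.Fa_eq[OF coalg_counit(1)] L.Fa_eq[OF alg_unit])

text \<open>Both squares commute strictly: along either path \<open>a\<close> goes to its free
  algebra and \<open>b\<close> to its cofree coalgebra, so identities serve as 2-cells.\<close>

lemma adj_morphism_comparison: "adj_morphism F (nuc F) (comparison F)"
proof (rule adj_morphismI)
  fix a assume a: "a \<in> Ob A"
  then show "is_iso (catB (nuc F)) (upL (comparison F) a) \<and>
       Dom (catB (nuc F)) (upL (comparison F) a) = Fo (mK (comparison F)) (Lo a) \<and>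
       Cod (catB (nuc F)) (upL (comparison F) a) = Fo (left (nuc F)) (Fo (mH (comparison F)) a)"
    using iso_Ide[of "Alg F" "Fo (kappa1 F) (Lo a)"] by (simp add: alg_free)
next
  fix b assume b: "b \<in> Ob B"
  then show "is_iso (catA (nuc F)) (upR (comparison F) b) \<and>
       Dom (catA (nuc F)) (upR (comparison F) b) = Fo (mH (comparison F)) (Ro b) \<and>
       Cod (catA (nuc F)) (upR (comparison F) b) = Fo (right (nuc F)) (Fo (mK (comparison F)) b)"
    using iso_Ide[of "Coalg F" "Fo (kappa0 F) (Ro b)"] by (simp add: coalg_cofree)
qed (simp_all add: is_adjunction is_adjunction_nuc is_functor_kappa0 is_functor_kappa1)

end

section \<open>Functoriality of the nucleus\<close>

context adj_mor
begin

text \<open>\<open>\<sigma>\<close> is the comparison of comonads through which coalgebras are transported along \<open>mK\<close>.\<close>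

definition "\<sigma> b = G.La (r b) \<cdot>\<^bsub>G.B\<^esub> l (F.Ro b)"

lemma \<sigma>_Arr [simp]: "b \<in> Ob F.B \<Longrightarrow> \<sigma> b \<in> Arr G.B"
  and Dom_\<sigma> [simp]: "b \<in> Ob F.B \<Longrightarrow> Dom G.B (\<sigma> b) = Ko (F.Lo (F.Ro b))"
  and Cod_\<sigma> [simp]: "b \<in> Ob F.B \<Longrightarrow> Cod G.B (\<sigma> b) = G.Lo (G.Ro (Ko b))"
  by (simp_all add: \<sigma>_def)

lemma \<sigma>_nat: "g \<in> Arr F.B \<Longrightarrow>
    \<sigma> (Cod F.B g) \<cdot>\<^bsub>G.B\<^esub> Ka (F.La (F.Ra g)) = G.La (G.Ra (Ka g)) \<cdot>\<^bsub>G.B\<^esub> \<sigma> (Dom F.B g)"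
  by (simp add: \<sigma>_def G.L.Fa_eq2[OF r_nat])

lemma \<sigma>_counit: "b \<in> Ob F.B \<Longrightarrow> G.\<epsilon> (Ko b) \<cdot>\<^bsub>G.B\<^esub> \<sigma> b = Ka (F.\<epsilon> b)"
  by (simp add: \<sigma>_def)

text \<open>With \<open>\<sigma>_nat\<close> and \<open>\<sigma>_counit\<close> this says that
  \<open>\<sigma>\<close> is a morphism of comonads along \<open>mK\<close>. The inner 2-cells
  collapse to \<open>G.\<eta>\<close> by \<open>unit_law\<close>, and naturality of
  \<open>G.\<eta>\<close> moves it past \<open>r b\<close>.\<close>

lemma \<sigma>_comult: "b \<in> Ob F.B \<Longrightarrow>
    G.La (G.Ra (\<sigma> b)) \<cdot>\<^bsub>G.B\<^esub> \<sigma> (F.Lo (F.Ro b)) \<cdot>\<^bsub>G.B\<^esub> Ka (F.La (F.\<eta> (F.Ro b)))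
      = G.La (G.\<eta> (G.Ro (Ko b))) \<cdot>\<^bsub>G.B\<^esub> \<sigma> b"
  by (simp add: \<sigma>_def G.L.Fa_eq3[OF unit_law] G.L.Fa_eq2[OF G.\<eta>_nat])

lemma coalg_lift_\<sigma>:
  assumes "coalg F b \<beta>"
  shows "coalg G (Ko b) (\<sigma> b \<cdot>\<^bsub>G.B\<^esub> Ka \<beta>)"
proof -
  note [simp] = F.coalgD(1-4)[OF assms]
  let ?LR = "\<lambda>g. G.La (G.Ra g)"
  have "?LR (\<sigma> b \<cdot>\<^bsub>G.B\<^esub> Ka \<beta>) \<cdot>\<^bsub>G.B\<^esub> \<sigma> b \<cdot>\<^bsub>G.B\<^esub> Ka \<beta>
      = ?LR (\<sigma> b) \<cdot>\<^bsub>G.B\<^esub> (?LR (Ka \<beta>) \<cdot>\<^bsub>G.B\<^esub> \<sigma> b) \<cdot>\<^bsub>G.B\<^esub> Ka \<beta>"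
    by simp
  \<comment> \<open>Naturality of \<open>\<sigma>\<close> at \<open>\<beta>\<close> makes both
    copies of \<open>\<beta>\<close> adjacent under \<open>mK\<close>, where coassociativity
    applies.\<close>
  also have "?LR (Ka \<beta>) \<cdot>\<^bsub>G.B\<^esub> \<sigma> b = \<sigma> (F.Lo (F.Ro b)) \<cdot>\<^bsub>G.B\<^esub> Ka (F.La (F.Ra \<beta>))"
    using \<sigma>_nat[of \<beta>] by simp
  also have "?LR (\<sigma> b) \<cdot>\<^bsub>G.B\<^esub> (\<sigma> (F.Lo (F.Ro b)) \<cdot>\<^bsub>G.B\<^esub> Ka (F.La (F.Ra \<beta>))) \<cdot>\<^bsub>G.B\<^esub> Ka \<beta>
      = (?LR (\<sigma> b) \<cdot>\<^bsub>G.B\<^esub> \<sigma> (F.Lo (F.Ro b)) \<cdot>\<^bsub>G.B\<^esub> Ka (F.La (F.\<eta> (F.Ro b)))) \<cdot>\<^bsub>G.B\<^esub> Ka \<beta>"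
    by (simp add: K.Fa_eq2[OF F.coalgD(6)[OF assms]])
  also have "\<dots> = G.La (G.\<eta> (G.Ro (Ko b))) \<cdot>\<^bsub>G.B\<^esub> \<sigma> b \<cdot>\<^bsub>G.B\<^esub> Ka \<beta>"
    by (simp only: \<sigma>_comult F.coalgD(1)[OF assms]) simp
  finally have 1: "?LR (\<sigma> b \<cdot>\<^bsub>G.B\<^esub> Ka \<beta>) \<cdot>\<^bsub>G.B\<^esub> \<sigma> b \<cdot>\<^bsub>G.B\<^esub> Ka \<beta>
      = G.La (G.\<eta> (G.Ro (Ko b))) \<cdot>\<^bsub>G.B\<^esub> \<sigma> b \<cdot>\<^bsub>G.B\<^esub> Ka \<beta>" .
  have "G.\<epsilon> (Ko b) \<cdot>\<^bsub>G.B\<^esub> \<sigma> b \<cdot>\<^bsub>G.B\<^esub> Ka \<beta> = Ide G.B (Ko b)"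
    by (simp add: Comp_reduce[OF _ \<sigma>_counit] K.Fa_eq(1)[OF F.coalg_counit(1)[OF assms]])
  with 1 show ?thesis
    by (auto simp: coalg_def)
qed

lemma coalg_hom_lift_\<sigma>:
  assumes "coalg F b \<beta>" "coalg F b' \<beta>'" "coalg_hom F (b, \<beta>) (b', \<beta>') g"
  shows "coalg_hom G (Ko b, \<sigma> b \<cdot>\<^bsub>G.B\<^esub> Ka \<beta>) (Ko b', \<sigma> b' \<cdot>\<^bsub>G.B\<^esub> Ka \<beta>') (Ka g)"
proof -
  note [simp] = F.coalgD(1-4)[OF assms(1)] F.coalgD(1-4)[OF assms(2)] F.coalg_homD(1-3)[OF assms(3)]
  have "(\<sigma> b' \<cdot>\<^bsub>G.B\<^esub> Ka \<beta>') \<cdot>\<^bsub>G.B\<^esub> Ka g = (\<sigma> b' \<cdot>\<^bsub>G.B\<^esub> Ka (F.La (F.Ra g))) \<cdot>\<^bsub>G.B\<^esub> Ka \<beta>"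
    by (simp add: K.Fa_eq2(1)[OF F.coalg_homD(4)[OF assms(3)]])
  also have "\<dots> = (G.La (G.Ra (Ka g)) \<cdot>\<^bsub>G.B\<^esub> \<sigma> b) \<cdot>\<^bsub>G.B\<^esub> Ka \<beta>"
    using \<sigma>_nat[of g] by simp
  finally show ?thesis
    by (simp add: coalg_hom_def)
qed

lemma coalg_lift_obj:
  assumes "coalg F b \<beta>"
  shows "coalg G (Ko b) (G.La (r b) \<cdot>\<^bsub>G.B\<^esub> l (F.Ro b) \<cdot>\<^bsub>G.B\<^esub> Ka \<beta>)"
  using coalg_lift_\<sigma>[OF assms] F.coalgD(1-4)[OF assms] by (simp add: \<sigma>_def)

lemma coalg_lift_hom:
  assumes "coalg F b \<beta>" "coalg F b' \<beta>'" "coalg_hom F (b, \<beta>) (b', \<beta>') g"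
  shows "coalg_hom G (Ko b, G.La (r b) \<cdot>\<^bsub>G.B\<^esub> l (F.Ro b) \<cdot>\<^bsub>G.B\<^esub> Ka \<beta>)
    (Ko b', G.La (r b') \<cdot>\<^bsub>G.B\<^esub> l (F.Ro b') \<cdot>\<^bsub>G.B\<^esub> Ka \<beta>') (Ka g)"
  using coalg_hom_lift_\<sigma>[OF assms] F.coalgD(1-4)[OF assms(1)] F.coalgD(1-4)[OF assms(2)]
  by (simp add: \<sigma>_def)

lemma op: "adj_mor (op_adj F) (op_adj G) (op_amor G \<Upsilon>)"
  by (intro adj_mor_intro adj_morphism_op adj_morphism)

text \<open>The inverse 2-cells in \<open>alg_lift\<close> are the 2-cells of the opposite morphism,
  so lifting algebras is dual to lifting coalgebras.\<close>

lemma alg_lift_obj: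
  assumes "alg F a \<alpha>"
  shows "alg G (Ho a) (Ha \<alpha> \<cdot>\<^bsub>G.A\<^esub> r' (F.Lo a) \<cdot>\<^bsub>G.A\<^esub> G.Ra (l' a))"
  using adj_mor.coalg_lift_obj[OF op assms] F.algD(1-4)[OF assms] by simp

lemma alg_lift_hom:
  assumes "alg F a \<alpha>" "alg F a' \<alpha>'" "alg_hom F (a, \<alpha>) (a', \<alpha>') f"
  shows "alg_hom G (Ho a, Ha \<alpha> \<cdot>\<^bsub>G.A\<^esub> r' (F.Lo a) \<cdot>\<^bsub>G.A\<^esub> G.Ra (l' a))
    (Ho a', Ha \<alpha>' \<cdot>\<^bsub>G.A\<^esub> r' (F.Lo a') \<cdot>\<^bsub>G.A\<^esub> G.Ra (l' a')) (Ha f)"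
  using adj_mor.coalg_lift_hom[OF op assms(2,1,3)] F.algD(1-4)[OF assms(1)] F.algD(1-4)[OF assms(2)]
  by simp

text \<open>By this lemma and \<open>alg_hom_r\<close> the 2-cells of \<open>\<Upsilon>\<close> are
  homomorphisms. They then serve twice: as 2-cells of \<open>nuc_amor\<close> and as the isomorphism
  witnessing naturality of the comparison.\<close>

lemma coalg_hom_l:
  assumes "a \<in> Ob F.A"
  shows "coalg_hom G (Ko (F.Lo a), G.La (r (F.Lo a)) \<cdot>\<^bsub>G.B\<^esub> l (F.Ro (F.Lo a)) \<cdot>\<^bsub>G.B\<^esub> Ka (F.La (F.\<eta> a)))
    (G.Lo (Ho a), G.La (G.\<eta> (Ho a))) (l a)"
  using assms by (simp add: coalg_hom_def G.L.Fa_eq3[OF unit_law])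

lemma alg_hom_r:
  assumes "b \<in> Ob F.B"
  shows "alg_hom G (Ho (F.Ro b), Ha (F.Ra (F.\<epsilon> b)) \<cdot>\<^bsub>G.A\<^esub> r' (F.Lo (F.Ro b)) \<cdot>\<^bsub>G.A\<^esub> G.Ra (l' (F.Ro b)))
    (G.Ro (Ko b), G.Ra (G.\<epsilon> (Ko b))) (r b)"
proof -
  \<comment> \<open>This is \<open>counit_law\<close> with \<open>l\<close> taken to the other side;
    its image under \<open>G.Ra\<close> is the homomorphism equation for \<open>r b\<close>.\<close>
  have "Ka (F.\<epsilon> b) \<cdot>\<^bsub>G.B\<^esub> l' (F.Ro b) = G.\<epsilon> (Ko b) \<cdot>\<^bsub>G.B\<^esub> G.La (r b)"
    using assms by (simp flip: counit_law del: counit_law_simp)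
  from G.R.Fa_eq2(1)[OF this] show ?thesis
    using assms by (simp add: alg_hom_iff)
qed

end

lemma coalg_lift_simps [simp]:
  "Fo (coalg_lift F G \<Upsilon>) (b, \<beta>) = (Fo (mK \<Upsilon>) b, Fa (left G) (upR \<Upsilon> b) \<cdot>\<^bsub>catB G\<^esub>
      upL \<Upsilon> (Fo (right F) b) \<cdot>\<^bsub>catB G\<^esub> Fa (mK \<Upsilon>) \<beta>)"
  "Fa (coalg_lift F G \<Upsilon>) f = Arrow (Fo (coalg_lift F G \<Upsilon>) (asrc f)) (Fa (mK \<Upsilon>) (base f))
      (Fo (coalg_lift F G \<Upsilon>) (atgt f))"
  by (simp_all add: coalg_lift_def Let_def)

lemma alg_lift_simps [simp]:
  "Fo (alg_lift F G \<Upsilon>) (a, \<alpha>) = (Fo (mH \<Upsilon>) a, Fa (mH \<Upsilon>) \<alpha> \<cdot>\<^bsub>catA G\<^esub>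
      inv_arr (catA G) (upR \<Upsilon> (Fo (left F) a)) \<cdot>\<^bsub>catA G\<^esub> Fa (right G) (inv_arr (catB G) (upL \<Upsilon> a)))"
  "Fa (alg_lift F G \<Upsilon>) f = Arrow (Fo (alg_lift F G \<Upsilon>) (asrc f)) (Fa (mH \<Upsilon>) (base f))
      (Fo (alg_lift F G \<Upsilon>) (atgt f))"
  by (simp_all add: alg_lift_def Let_def)

lemma nuc_amor_simps [simp]:
  "mH (nuc_amor F G \<Upsilon>) = coalg_lift F G \<Upsilon>" "mK (nuc_amor F G \<Upsilon>) = alg_lift F G \<Upsilon>"
  "upL (nuc_amor F G \<Upsilon>) (b, \<beta>) = Arrow (Fo (alg_lift F G \<Upsilon>) (Fo (left (nuc F)) (b, \<beta>))) (upR \<Upsilon> b)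
      (Fo (left (nuc G)) (Fo (coalg_lift F G \<Upsilon>) (b, \<beta>)))"
  "upR (nuc_amor F G \<Upsilon>) (a, \<alpha>) = Arrow (Fo (coalg_lift F G \<Upsilon>) (Fo (right (nuc F)) (a, \<alpha>))) (upL \<Upsilon> a)
      (Fo (right (nuc G)) (Fo (alg_lift F G \<Upsilon>) (a, \<alpha>)))"
  by (simp_all add: nuc_amor_def Let_def)

context adj_mor
begin

lemma is_functor_coalg_lift: "is_functor (Coalg F) (Coalg G) (coalg_lift F G \<Upsilon>)"
  by (rule is_functorI) (auto elim!: F.ObE_Coalg F.ArrE_Coalg intro: coalg_lift_obj coalg_lift_hom)

lemma is_functor_alg_lift: "is_functor (Alg F) (Alg G) (alg_lift F G \<Upsilon>)"
  by (rule is_functorI) (auto elim!: F.ObE_Alg F.ArrE_Alg intro: alg_lift_obj alg_lift_hom)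

lemma iso_l:
  "a \<in> Ob F.A \<Longrightarrow> is_iso (Coalg G) (Arrow (Fo (coalg_lift F G \<Upsilon>) (Fo (kappa0 F) a)) (l a) (Fo (kappa0 G) (Ho a)))"
  using coalg_lift_obj[OF F.coalg_cofree, of a] coalg_hom_l[of a] G.coalg_cofree[of "Ho a"]
  by (intro G.iso_Coalg) simp_all

lemma iso_r:
  "b \<in> Ob F.B \<Longrightarrow> is_iso (Alg G) (Arrow (Fo (alg_lift F G \<Upsilon>) (Fo (kappa1 F) b)) (r b) (Fo (kappa1 G) (Ko b)))"
  using alg_lift_obj[OF F.alg_free, of b] alg_hom_r[of b] G.alg_free[of "Ko b"]
  by (intro G.iso_Alg) simp_all

lemma adj_morphism_nuc: "adj_morphism (nuc F) (nuc G) (nuc_amor F G \<Upsilon>)"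
proof (rule adj_morphismI)
  fix x assume "x \<in> Ob (catA (nuc F))"
  then obtain b \<beta> where x: "x = (b, \<beta>)" "coalg F b \<beta>" and [simp]: "b \<in> Ob F.B"
    by (auto elim!: F.ObE_Coalg)
  show "is_iso (catB (nuc G)) (upL (nuc_amor F G \<Upsilon>) x) \<and>
      Dom (catB (nuc G)) (upL (nuc_amor F G \<Upsilon>) x) = Fo (mK (nuc_amor F G \<Upsilon>)) (Fo (left (nuc F)) x) \<and>
      Cod (catB (nuc G)) (upL (nuc_amor F G \<Upsilon>) x) = Fo (left (nuc G)) (Fo (mH (nuc_amor F G \<Upsilon>)) x)"
    using x iso_r[of b] by simp
next
  fix x assume "x \<in> Ob (catB (nuc F))"
  then obtain a \<alpha> where x: "x = (a, \<alpha>)" "alg F a \<alpha>" and [simp]: "a \<in> Ob F.A"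
    by (auto elim!: F.ObE_Alg)
  show "is_iso (catA (nuc G)) (upR (nuc_amor F G \<Upsilon>) x) \<and>
      Dom (catA (nuc G)) (upR (nuc_amor F G \<Upsilon>) x) = Fo (mH (nuc_amor F G \<Upsilon>)) (Fo (right (nuc F)) x) \<and>
      Cod (catA (nuc G)) (upR (nuc_amor F G \<Upsilon>) x) = Fo (right (nuc G)) (Fo (mK (nuc_amor F G \<Upsilon>)) x)"
    using x iso_l[of a] by simp
qed (auto elim!: F.ObE_Coalg F.ObE_Alg F.ArrE_Coalg F.ArrE_Alg
    simp: is_functor_coalg_lift is_functor_alg_lift F.is_adjunction_nuc G.is_adjunction_nuc)

end

text \<open>Completion preserves identities and composites up to \<open>amor_eq\<close>; this
  congruence passes those equalities on to the nucleus.\<close>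

lemma nuc_amor_cong:
  assumes "adj_morphism F G \<Upsilon>" "amor_eq F \<Upsilon> \<Upsilon>'"
  shows "amor_eq (nuc F) (nuc_amor F G \<Upsilon>) (nuc_amor F G \<Upsilon>')"
proof -
  interpret adj_mor F G \<Upsilon> using assms(1) by (rule adj_mor_intro)
  have [simp]:
    "\<And>a. a \<in> Ob F.A \<Longrightarrow> Fo (mH \<Upsilon>') a = Ho a" "\<And>a. a \<in> Ob F.A \<Longrightarrow> upL \<Upsilon>' a = l a"
    "\<And>f. f \<in> Arr F.A \<Longrightarrow> Fa (mH \<Upsilon>') f = Ha f"
    "\<And>b. b \<in> Ob F.B \<Longrightarrow> Fo (mK \<Upsilon>') b = Ko b" "\<And>b. b \<in> Ob F.B \<Longrightarrow> upR \<Upsilon>' b = r b"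
    "\<And>g. g \<in> Arr F.B \<Longrightarrow> Fa (mK \<Upsilon>') g = Ka g"
    using assms(2) by (simp_all add: amor_eq_def)
  show ?thesis
    by (auto simp: amor_eq_def elim!: F.ObE_Coalg F.ObE_Alg F.ArrE_Coalg F.ArrE_Alg)
qed

lemma nuc_amor_id:
  assumes "is_adjunction F"
  shows "amor_eq (nuc F) (nuc_amor F F (amor_id F)) (amor_id (nuc F))"
proof -
  interpret adjunction F by unfold_locales fact
  show ?thesis
    by (auto simp: amor_eq_def elim!: ObE_Coalg ObE_Alg ArrE_Coalg ArrE_Alg)
qed

lemma nuc_amor_comp:
  assumes "adj_morphism F G \<Upsilon>" "adj_morphism G L \<Psi>"
  shows "amor_eq (nuc F) (nuc_amor F L (amor_comp L \<Psi> \<Upsilon>))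
    (amor_comp (nuc L) (nuc_amor G L \<Psi>) (nuc_amor F G \<Upsilon>))"
proof -
  interpret U: adj_mor F G \<Upsilon> using assms(1) by (rule adj_mor_intro)
  interpret P: adj_mor G L \<Psi> using assms(2) by (rule adj_mor_intro)
  show ?thesis
    by (auto simp: amor_eq_def iso_Comp P.H.Fa_inv P.K.Fa_inv P.K.Fa_eq2[OF U.l_nat] P.H.Fa_eq2[OF U.r'_nat]
        elim!: U.F.ObE_Coalg U.F.ObE_Alg U.F.ArrE_Coalg U.F.ArrE_Alg)
qed

text \<open>The two components change places, since coalgebras live over \<open>catB\<close> and
  algebras over \<open>catA\<close>. The compatibility squares of \<open>\<theta>\<close> and
  \<open>\<phi>\<close> turn into the homomorphism equations.\<close>

lemma nuc_amor_iso:
  assumes "amor_iso F G \<Upsilon> \<Upsilon>'"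
  shows "amor_iso (nuc F) (nuc G) (nuc_amor F G \<Upsilon>) (nuc_amor F G \<Upsilon>')"
proof -
  obtain \<theta> \<phi> where "adj_mor_iso F G \<Upsilon> \<Upsilon>' \<theta> \<phi>" using assms by (rule amor_isoE)
  then interpret adj_mor_iso F G \<Upsilon> \<Upsilon>' \<theta> \<phi> .
  have coalg_hom_\<phi>: "coalg_hom G (Fo (coalg_lift F G \<Upsilon>) (b, \<beta>)) (Fo (coalg_lift F G \<Upsilon>') (b, \<beta>)) (\<phi> b)"
    if "coalg F b \<beta>" for b \<beta>
  proof -
    note [simp] = U.F.coalgD(1-4)[OF that]
    have "U'.Ka \<beta> \<cdot>\<^bsub>U.G.B\<^esub> \<phi> b = \<phi> (U.F.Lo (U.F.Ro b)) \<cdot>\<^bsub>U.G.B\<^esub> U.Ka \<beta>"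
      by simp
    then show ?thesis
      by (simp add: coalg_hom_def Comp_reduce2[OF _ compat_l] U.G.L.Fa_eq2[OF compat_r] del: p.\<tau>_nat_simp)
  qed
  have alg_hom_\<theta>: "alg_hom G (Fo (alg_lift F G \<Upsilon>) (a, \<alpha>)) (Fo (alg_lift F G \<Upsilon>') (a, \<alpha>)) (\<theta> a)"
    if "alg F a \<alpha>" for a \<alpha>
  proof -
    note [simp] = U.F.algD(1-4)[OF that]
    \<comment> \<open>Algebra structures are transported along inverse 2-cells, so both
      compatibilities are solved for those first.\<close>
    have "\<phi> (U.F.Lo a) = U'.l' a \<cdot>\<^bsub>U.G.B\<^esub> U.G.La (\<theta> a) \<cdot>\<^bsub>U.G.B\<^esub> U.l a"
      using compat_l[of a, symmetric] by simp
    then have 1: "U'.l' a \<cdot>\<^bsub>U.G.B\<^esub> U.G.La (\<theta> a) = \<phi> (U.F.Lo a) \<cdot>\<^bsub>U.G.B\<^esub> U.l' a"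
      by simp
    have "\<theta> (U.F.Ro (U.F.Lo a)) = U'.r' (U.F.Lo a) \<cdot>\<^bsub>U.G.A\<^esub> U.G.Ra (\<phi> (U.F.Lo a)) \<cdot>\<^bsub>U.G.A\<^esub> U.r (U.F.Lo a)"
      using compat_r[of "U.F.Lo a", symmetric] by simp
    then have 2: "U'.r' (U.F.Lo a) \<cdot>\<^bsub>U.G.A\<^esub> U.G.Ra (\<phi> (U.F.Lo a)) = \<theta> (U.F.Ro (U.F.Lo a)) \<cdot>\<^bsub>U.G.A\<^esub> U.r' (U.F.Lo a)"
      by simp
    show ?thesis
      by (simp add: alg_hom_iff U.G.R.Fa_eq2[OF 1] Comp_reduce2[OF _ 2])
  qed
  show ?thesis
  proof (rule amor_isoI[OF U.adj_morphism_nuc U'.adj_morphism_nuc,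
        where \<theta> = "\<lambda>x. Arrow (Fo (coalg_lift F G \<Upsilon>) x) (\<phi> (fst x)) (Fo (coalg_lift F G \<Upsilon>') x)" and
          \<phi> = "\<lambda>x. Arrow (Fo (alg_lift F G \<Upsilon>) x) (\<theta> (fst x)) (Fo (alg_lift F G \<Upsilon>') x)"])
    fix x assume "x \<in> Ob (catA (nuc F))"
    then obtain b \<beta> where x: "x = (b, \<beta>)" "coalg F b \<beta>" and [simp]: "b \<in> Ob U.F.B"
      by (auto elim!: U.F.ObE_Coalg)
    show "is_iso (catA (nuc G)) (Arrow (Fo (coalg_lift F G \<Upsilon>) x) (\<phi> (fst x)) (Fo (coalg_lift F G \<Upsilon>') x)) \<and>
         Dom (catA (nuc G)) (Arrow (Fo (coalg_lift F G \<Upsilon>) x) (\<phi> (fst x)) (Fo (coalg_lift F G \<Upsilon>') x))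
           = Fo (mH (nuc_amor F G \<Upsilon>)) x \<and>
         Cod (catA (nuc G)) (Arrow (Fo (coalg_lift F G \<Upsilon>) x) (\<phi> (fst x)) (Fo (coalg_lift F G \<Upsilon>') x))
           = Fo (mH (nuc_amor F G \<Upsilon>')) x"
      using x U.coalg_lift_obj[of b \<beta>] U'.coalg_lift_obj[of b \<beta>] coalg_hom_\<phi>[of b \<beta>]
      by (auto intro!: U.G.iso_Coalg)
  next
    fix x assume "x \<in> Ob (catB (nuc F))"
    then obtain a \<alpha> where x: "x = (a, \<alpha>)" "alg F a \<alpha>" and [simp]: "a \<in> Ob U.F.A"
      by (auto elim!: U.F.ObE_Alg)
    show "is_iso (catB (nuc G)) (Arrow (Fo (alg_lift F G \<Upsilon>) x) (\<theta> (fst x)) (Fo (alg_lift F G \<Upsilon>') x)) \<and>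
         Dom (catB (nuc G)) (Arrow (Fo (alg_lift F G \<Upsilon>) x) (\<theta> (fst x)) (Fo (alg_lift F G \<Upsilon>') x))
           = Fo (mK (nuc_amor F G \<Upsilon>)) x \<and>
         Cod (catB (nuc G)) (Arrow (Fo (alg_lift F G \<Upsilon>) x) (\<theta> (fst x)) (Fo (alg_lift F G \<Upsilon>') x))
           = Fo (mK (nuc_amor F G \<Upsilon>')) x"
      using x U.alg_lift_obj[of a \<alpha>] U'.alg_lift_obj[of a \<alpha>] alg_hom_\<theta>[of a \<alpha>]
      by (auto intro!: U.G.iso_Alg)
  qed (auto elim!: U.F.ObE_Coalg U.F.ObE_Alg U.F.ArrE_Coalg U.F.ArrE_Alg simp: compat_l compat_r)
qed

text \<open>The 2-cells \<open>l\<close> and \<open>r\<close> themselves fill the square, being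
  homomorphisms from the lifted cofree coalgebra or free algebra to the cofree or free one over
  \<open>G\<close>.\<close>

lemma comparison_natural:
  assumes "adj_morphism F G \<Upsilon>"
  shows "amor_iso F (nuc G) (amor_comp (nuc G) (nuc_amor F G \<Upsilon>) (comparison F))
    (amor_comp (nuc G) (comparison G) \<Upsilon>)"
proof -
  interpret adj_mor F G \<Upsilon> using assms by (rule adj_mor_intro)
  show ?thesis
  proof (rule amor_isoI[where
        \<theta> = "\<lambda>a. Arrow (Fo (coalg_lift F G \<Upsilon>) (Fo (kappa0 F) a)) (l a) (Fo (kappa0 G) (Ho a))" and
        \<phi> = "\<lambda>b. Arrow (Fo (alg_lift F G \<Upsilon>) (Fo (kappa1 F) b)) (r b) (Fo (kappa1 G) (Ko b))"])
    show "adj_morphism F (nuc G) (amor_comp (nuc G) (nuc_amor F G \<Upsilon>) (comparison F))"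
      by (rule adj_morphism_comp[OF F.adj_morphism_comparison adj_morphism_nuc])
    show "adj_morphism F (nuc G) (amor_comp (nuc G) (comparison G) \<Upsilon>)"
      by (rule adj_morphism_comp[OF assms G.adj_morphism_comparison])
  next
    fix a assume "a \<in> Ob F.A"
    then show "is_iso (catA (nuc G)) (Arrow (Fo (coalg_lift F G \<Upsilon>) (Fo (kappa0 F) a)) (l a) (Fo (kappa0 G) (Ho a))) \<and>
         Dom (catA (nuc G)) (Arrow (Fo (coalg_lift F G \<Upsilon>) (Fo (kappa0 F) a)) (l a) (Fo (kappa0 G) (Ho a))) =
         Fo (mH (amor_comp (nuc G) (nuc_amor F G \<Upsilon>) (comparison F))) a \<and>
         Cod (catA (nuc G)) (Arrow (Fo (coalg_lift F G \<Upsilon>) (Fo (kappa0 F) a)) (l a) (Fo (kappa0 G) (Ho a))) =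
         Fo (mH (amor_comp (nuc G) (comparison G) \<Upsilon>)) a"
      using iso_l[of a] by simp
  next
    fix b assume "b \<in> Ob F.B"
    then show "is_iso (catB (nuc G)) (Arrow (Fo (alg_lift F G \<Upsilon>) (Fo (kappa1 F) b)) (r b) (Fo (kappa1 G) (Ko b))) \<and>
         Dom (catB (nuc G)) (Arrow (Fo (alg_lift F G \<Upsilon>) (Fo (kappa1 F) b)) (r b) (Fo (kappa1 G) (Ko b))) =
         Fo (mK (amor_comp (nuc G) (nuc_amor F G \<Upsilon>) (comparison F))) b \<and>
         Cod (catB (nuc G)) (Arrow (Fo (alg_lift F G \<Upsilon>) (Fo (kappa1 F) b)) (r b) (Fo (kappa1 G) (Ko b))) =
         Fo (mK (amor_comp (nuc G) (comparison G) \<Upsilon>)) b"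
      using iso_r[of b] by simp
  qed auto
qed

text \<open>The lift of \<open>kappa1 F\<close> and the functor \<open>kappa0 (nuc F)\<close> both
  send \<open>(b, \<beta>)\<close> to the algebra \<open>(Ro b, Ra (\<epsilon> b))\<close> with
  coalgebra structure \<open>Ra \<beta>\<close>, and dually for algebras. All 2-cells are
  identities.\<close>

lemma nuc_amor_comparison:
  assumes "is_adjunction F"
  shows "amor_eq (nuc F) (nuc_amor F (nuc F) (comparison F)) (comparison (nuc F))"
proof -
  interpret adjunction F by unfold_locales fact
  show ?thesis
    by (auto simp: amor_eq_def iso_Coalg iso_Alg coalg_hom_id alg_hom_id coalg_cofree alg_free
        elim!: ObE_Coalg ObE_Alg ArrE_Coalg ArrE_Alg)
qed

section \<open>Weak equivalences\<close>

text \<open>Fullness and faithfulness are stated as one unique existence so that \<open>lift\<close>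
  is a definite description. A concrete quasi-inverse \<open>Q\<close> is built from it, because a
  quasi-inverse of adjunctions has 2-cells that must be computed with.\<close>

locale weak_equiv = cat_functor C D H
  for C :: "('o, 'm) cat" and D :: "('p, 'n) cat" and H :: "('o, 'm, 'p, 'n) fctr" +
  assumes fully_faithful: "\<lbrakk>x \<in> Ob C; y \<in> Ob C; g \<in> Arr D; Dom D g = Fo H x; Cod D g = Fo H y\<rbrakk>
      \<Longrightarrow> \<exists>!f. f \<in> Arr C \<and> Dom C f = x \<and> Cod C f = y \<and> Fa H f = g"
    and ess_surj: "d \<in> Ob D \<Longrightarrow> \<exists>c e. c \<in> Ob C \<and> is_iso D e \<and> Dom D e = Fo H c \<and> Cod D e = d"
begin

definition "lift x y g = (THE f. f \<in> Arr C \<and> Dom C f = x \<and> Cod C f = y \<and> Fa H f = g)"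

lemma lift_simps [simp]:
  assumes "x \<in> Ob C" "y \<in> Ob C" "g \<in> Arr D" "Dom D g = Fo H x" "Cod D g = Fo H y"
  shows "lift x y g \<in> Arr C" "Dom C (lift x y g) = x" "Cod C (lift x y g) = y" "Fa H (lift x y g) = g"
  using theI'[OF fully_faithful[OF assms]] by (simp_all add: lift_def)

lemma faithful:
  assumes "f \<in> Arr C" "g \<in> Arr C" "Dom C f = Dom C g" "Cod C f = Cod C g" "Fa H f = Fa H g"
  shows "f = g"
  using fully_faithful[of "Dom C g" "Cod C g" "Fa H g"] assms by auto

lemma reflects_iso:
  assumes "f \<in> Arr C" "is_iso D (Fa H f)"
  shows "is_iso C f"
proof (rule is_isoI(1)[of _ _ "lift (Cod C f) (Dom C f) (inv_arr D (Fa H f))"])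
  show "lift (Cod C f) (Dom C f) (inv_arr D (Fa H f)) \<cdot>\<^bsub>C\<^esub> f = Ide C (Dom C f)"
    by (rule faithful) (use assms in simp_all)
  show "f \<cdot>\<^bsub>C\<^esub> lift (Cod C f) (Dom C f) (inv_arr D (Fa H f)) = Ide C (Cod C f)"
    by (rule faithful) (use assms in simp_all)
qed (use assms in simp_all)

definition "qo d = (SOME c. c \<in> Ob C \<and> (\<exists>e. is_iso D e \<and> Dom D e = Fo H c \<and> Cod D e = d))"

definition "ev d = (SOME e. is_iso D e \<and> Dom D e = Fo H (qo d) \<and> Cod D e = d)"

lemma qo_ev:
  assumes "d \<in> Ob D"
  shows "qo d \<in> Ob C" "is_iso D (ev d) \<and> Dom D (ev d) = Fo H (qo d) \<and> Cod D (ev d) = d"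
proof -
  have *: "qo d \<in> Ob C \<and> (\<exists>e. is_iso D e \<and> Dom D e = Fo H (qo d) \<and> Cod D e = d)"
    unfolding qo_def by (rule someI_ex) (use ess_surj[OF assms] in blast)
  then show "qo d \<in> Ob C" by blast
  show "is_iso D (ev d) \<and> Dom D (ev d) = Fo H (qo d) \<and> Cod D (ev d) = d"
    unfolding ev_def by (rule someI_ex) (use * in blast)
qed

lemma ev_simps [simp]:
  assumes "d \<in> Ob D"
  shows "qo d \<in> Ob C" "is_iso D (ev d)" "Dom D (ev d) = Fo H (qo d)" "Cod D (ev d) = d" "ev d \<in> Arr D"
  using qo_ev[OF assms] is_iso_Arr[OF cats(2)] by auto

definition "Q = \<lparr>Fo = qo, Fa = (\<lambda>f. lift (qo (Dom D f)) (qo (Cod D f))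
    (inv_arr D (ev (Cod D f)) \<cdot>\<^bsub>D\<^esub> f \<cdot>\<^bsub>D\<^esub> ev (Dom D f)))\<rparr>"

lemma Fo_Q [simp]: "Fo Q = qo"
  by (simp add: Q_def)

lemma Fa_Q [simp]:
  assumes "f \<in> Arr D"
  shows "Fa Q f \<in> Arr C" "Dom C (Fa Q f) = qo (Dom D f)" "Cod C (Fa Q f) = qo (Cod D f)"
    "Fa H (Fa Q f) = inv_arr D (ev (Cod D f)) \<cdot>\<^bsub>D\<^esub> f \<cdot>\<^bsub>D\<^esub> ev (Dom D f)"
  using assms by (simp_all add: Q_def)

lemma is_functor_Q: "is_functor D C Q"
proof (rule is_functorI)
  show "Fa Q (Ide D x) = Ide C (Fo Q x)" if "x \<in> Ob D" for x
    by (rule faithful) (use that in simp_all)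
  show "Fa Q (g \<cdot>\<^bsub>D\<^esub> f) = Fa Q g \<cdot>\<^bsub>C\<^esub> Fa Q f" if "f \<in> Arr D" "g \<in> Arr D" "Dom D g = Cod D f" for f g
    by (rule faithful) (use that in simp_all)
qed simp_all

text \<open>Chosen to satisfy a triangle identity: the image of \<open>un c\<close> is inverse to
  \<open>ev\<close> at \<open>Fo H c\<close>. Equations about \<open>un\<close> can then be checked
  in \<open>D\<close>.\<close>

definition "un c = lift c (qo (Fo H c)) (inv_arr D (ev (Fo H c)))"

lemma un_simps [simp]:
  assumes "c \<in> Ob C"
  shows "un c \<in> Arr C" "Dom C (un c) = c" "Cod C (un c) = qo (Fo H c)" "Fa H (un c) = inv_arr D (ev (Fo H c))"
  using assms by (simp_all add: un_def)

lemma un_iso [simp]: "c \<in> Ob C \<Longrightarrow> is_iso C (un c)"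
  by (rule reflects_iso) simp_all

lemma un_nat: "f \<in> Arr C \<Longrightarrow> un (Cod C f) \<cdot>\<^bsub>C\<^esub> f = Fa Q (Fa H f) \<cdot>\<^bsub>C\<^esub> un (Dom C f)"
  by (rule faithful) simp_all

end

section \<open>Quasi-inverses of morphisms of adjunctions\<close>

text \<open>The condition by which \<open>Nuc_mult\<close> is chosen, with \<open>\<Upsilon>\<close>
  required to be a morphism. Unlike \<open>adj_equivalence\<close> it is symmetric and passes
  through composites and through \<open>Nuc_amor\<close>.\<close>

definition amor_qinv ::
  "('oa, 'ma, 'ob, 'mb) adj \<Rightarrow> ('oc, 'mc, 'od, 'md) adj
    \<Rightarrow> ('oa, 'ma, 'ob, 'mb, 'oc, 'mc, 'od, 'md) amor \<Rightarrow> ('oc, 'mc, 'od, 'md, 'oa, 'ma, 'ob, 'mb) amor \<Rightarrow> bool" where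
  "amor_qinv F G \<Upsilon> M \<longleftrightarrow> adj_morphism F G \<Upsilon> \<and> adj_morphism G F M \<and>
     amor_iso F F (amor_comp F M \<Upsilon>) (amor_id F) \<and> amor_iso G G (amor_comp G \<Upsilon> M) (amor_id G)"

lemma amor_qinvD:
  assumes "amor_qinv F G \<Upsilon> M"
  shows "adj_morphism F G \<Upsilon>" "adj_morphism G F M"
    "amor_iso F F (amor_comp F M \<Upsilon>) (amor_id F)" "amor_iso G G (amor_comp G \<Upsilon> M) (amor_id G)"
  using assms by (simp_all add: amor_qinv_def)

lemma amor_qinv_sym: "amor_qinv F G \<Upsilon> M \<Longrightarrow> amor_qinv G F M \<Upsilon>"
  by (simp add: amor_qinv_def)

lemma amor_qinv_equivalence:
  assumes "amor_qinv F G \<Upsilon> M"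
  shows "adj_equivalence F G \<Upsilon>"
proof -
  note q = amor_qinvD[OF assms]
  interpret U: adj_mor F G \<Upsilon> using q(1) by (rule adj_mor_intro)
  interpret M: adj_mor G F M using q(2) by (rule adj_mor_intro)
  \<comment> \<open>\<open>is_equivalence\<close> directs its unit away from the identity functor,
    hence the symmetric form of the isomorphism.\<close>
  obtain \<theta> \<phi> where 1: "adj_mor_iso F F (amor_id F) (amor_comp F M \<Upsilon>) \<theta> \<phi>"
    using amor_iso_sym[OF q(3)] by (rule amor_isoE)
  obtain \<theta>' \<phi>' where 2: "adj_mor_iso G G (amor_comp G \<Upsilon> M) (amor_id G) \<theta>' \<phi>'"
    using q(4) by (rule amor_isoE)
  show ?thesis
    unfolding adj_equivalence_def is_equivalence_def
    using q(1) U.H.is_functor U.K.is_functor M.H.is_functor M.K.is_functor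
      adj_mor_iso.nat_\<theta>[OF 1] adj_mor_iso.nat_\<phi>[OF 1] adj_mor_iso.nat_\<theta>[OF 2] adj_mor_iso.nat_\<phi>[OF 2]
    unfolding amor_comp_simps amor_id_simps by blast
qed

locale adj_weak_equiv = adj_mor F G \<Upsilon>
  for F :: "('oa, 'ma, 'ob, 'mb) adj" and G :: "('oc, 'mc, 'od, 'md) adj" and \<Upsilon> +
  assumes weak_equiv_H: "weak_equiv (catA F) (catA G) (mH \<Upsilon>)"
    and weak_equiv_K: "weak_equiv (catB F) (catB G) (mK \<Upsilon>)"
begin

sublocale EH: weak_equiv "catA F" "catA G" "mH \<Upsilon>"
  by (rule weak_equiv_H)

sublocale EK: weak_equiv "catB F" "catB G" "mK \<Upsilon>"
  by (rule weak_equiv_K)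

text \<open>If \<open>EH.ev\<close> and \<open>EK.ev\<close> are to form an isomorphism to the
  identity, the image under \<open>mK\<close> must be this composite: it is the compatibility square
  for upper-left 2-cells, solved for \<open>Ka (ql c)\<close>. The formula for \<open>qr\<close>
  arises in the same way from the other square.\<close>

definition "ql c = EK.lift (EK.qo (G.Lo c)) (F.Lo (EH.qo c))
  (l' (EH.qo c) \<cdot>\<^bsub>G.B\<^esub> G.La (inv_arr G.A (EH.ev c)) \<cdot>\<^bsub>G.B\<^esub> EK.ev (G.Lo c))"

definition "qr d = EH.lift (EH.qo (G.Ro d)) (F.Ro (EK.qo d))
  (r' (EK.qo d) \<cdot>\<^bsub>G.A\<^esub> G.Ra (inv_arr G.B (EK.ev d)) \<cdot>\<^bsub>G.A\<^esub> EH.ev (G.Ro d))"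

lemma ql_simps [simp]:
  assumes "c \<in> Ob G.A"
  shows "ql c \<in> Arr F.B" "Dom F.B (ql c) = EK.qo (G.Lo c)" "Cod F.B (ql c) = F.Lo (EH.qo c)"
    "Ka (ql c) = l' (EH.qo c) \<cdot>\<^bsub>G.B\<^esub> G.La (inv_arr G.A (EH.ev c)) \<cdot>\<^bsub>G.B\<^esub> EK.ev (G.Lo c)"
  using assms by (simp_all add: ql_def)

lemma qr_simps [simp]:
  assumes "d \<in> Ob G.B"
  shows "qr d \<in> Arr F.A" "Dom F.A (qr d) = EH.qo (G.Ro d)" "Cod F.A (qr d) = F.Ro (EK.qo d)"
    "Ha (qr d) = r' (EK.qo d) \<cdot>\<^bsub>G.A\<^esub> G.Ra (inv_arr G.B (EK.ev d)) \<cdot>\<^bsub>G.A\<^esub> EH.ev (G.Ro d)"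
  using assms by (simp_all add: qr_def)

lemma ql_iso [simp]: "c \<in> Ob G.A \<Longrightarrow> is_iso F.B (ql c)"
  and qr_iso [simp]: "d \<in> Ob G.B \<Longrightarrow> is_iso F.A (qr d)"
  by (rule EK.reflects_iso EH.reflects_iso; simp add: iso_Comp)+

definition "qinv = \<lparr>mH = EH.Q, mK = EK.Q, upL = ql, upR = qr\<rparr>"

lemma qinv_simps [simp]: "mH qinv = EH.Q" "mK qinv = EK.Q" "upL qinv = ql" "upR qinv = qr"
  by (simp_all add: qinv_def)

text \<open>The equations are tested under the faithful functors \<open>mH\<close> and
  \<open>mK\<close>. There \<open>Ha_Ra\<close> and \<open>Ka_La\<close> express everything through
  \<open>G\<close>, where the images of the liftings are known.\<close>

lemma adj_morphism_qinv: "adj_morphism G F qinv"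
proof (rule adj_morphismI)
  show "upL qinv (Cod G.A f) \<cdot>\<^bsub>F.B\<^esub> Fa (mK qinv) (G.La f) = F.La (Fa (mH qinv) f) \<cdot>\<^bsub>F.B\<^esub> upL qinv (Dom G.A f)"
    if "f \<in> Arr G.A" for f
    by (rule EK.faithful) (use that in \<open>simp_all add: Ka_La del: l'_nat l'_nat2\<close>)
  show "upR qinv (Cod G.B g) \<cdot>\<^bsub>F.A\<^esub> Fa (mH qinv) (G.Ra g) = F.Ra (Fa (mK qinv) g) \<cdot>\<^bsub>F.A\<^esub> upR qinv (Dom G.B g)"
    if "g \<in> Arr G.B" for g
    by (rule EH.faithful) (use that in \<open>simp_all add: Ha_Ra del: r'_nat r'_nat2\<close>)
  show "F.Ra (upL qinv a) \<cdot>\<^bsub>F.A\<^esub> upR qinv (G.Lo a) \<cdot>\<^bsub>F.A\<^esub> Fa (mH qinv) (G.\<eta> a) = F.\<eta> (Fo (mH qinv) a)"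
    if "a \<in> Ob G.A" for a
    by (rule EH.faithful)
      (use that unit_law'[of "EH.qo a"] in \<open>simp_all add: Ha_Ra G.R.Fa_eq[OF G.L.Fa_inv_cancel(2)] del: r'_nat r'_nat2\<close>)
  show "F.\<epsilon> (Fo (mK qinv) b) \<cdot>\<^bsub>F.B\<^esub> F.La (upR qinv b) \<cdot>\<^bsub>F.B\<^esub> upL qinv (G.Ro b) = Fa (mK qinv) (G.\<epsilon> b)"
    if "b \<in> Ob G.B" for b
    by (rule EK.faithful)
      (use that in \<open>simp_all add: Ka_La Comp_reduce3[OF _ counit_law'] del: l'_nat l'_nat2\<close>)
qed (simp_all add: F.is_adjunction G.is_adjunction EH.is_functor_Q EK.is_functor_Q)

lemma amor_qinv: "amor_qinv F G \<Upsilon> qinv"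
  unfolding amor_qinv_def
proof (intro conjI adj_morphism adj_morphism_qinv)
  have "amor_iso F F (amor_id F) (amor_comp F qinv \<Upsilon>)"
  proof (rule amor_isoI[OF adj_morphism_id[OF F.is_adjunction] adj_morphism_comp[OF adj_morphism adj_morphism_qinv],
        where \<theta> = EH.un and \<phi> = EK.un])
    show "upL (amor_comp F qinv \<Upsilon>) a \<cdot>\<^bsub>F.B\<^esub> EK.un (F.Lo a) = F.La (EH.un a) \<cdot>\<^bsub>F.B\<^esub> upL (amor_id F) a"
      if "a \<in> Ob F.A" for a
      by (rule EK.faithful) (use that EK.is_functor_Q in \<open>simp_all add: Ka_La del: l'_nat l'_nat2\<close>)
    show "upR (amor_comp F qinv \<Upsilon>) b \<cdot>\<^bsub>F.A\<^esub> EH.un (F.Ro b) = F.Ra (EK.un b) \<cdot>\<^bsub>F.A\<^esub> upR (amor_id F) b"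
      if "b \<in> Ob F.B" for b
      by (rule EH.faithful) (use that in \<open>simp_all add: Ha_Ra del: r'_nat r'_nat2\<close>)
  qed (simp_all add: EH.un_nat EK.un_nat)
  then show "amor_iso F F (amor_comp F qinv \<Upsilon>) (amor_id F)"
    by (rule amor_iso_sym)
  show "amor_iso G G (amor_comp G \<Upsilon> qinv) (amor_id G)"
    by (rule amor_isoI[OF adj_morphism_comp[OF adj_morphism_qinv adj_morphism] adj_morphism_id[OF G.is_adjunction],
          where \<theta> = EH.ev and \<phi> = EK.ev]) simp_all
qed

end

lemma ex_amor_qinv:
  assumes "adj_morphism F G \<Upsilon>" "weak_equiv (catA F) (catA G) (mH \<Upsilon>)" "weak_equiv (catB F) (catB G) (mK \<Upsilon>)"
  shows "\<exists>M. amor_qinv F G \<Upsilon> M"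
proof -
  have "adj_weak_equiv F G \<Upsilon>"
    using assms by (intro adj_weak_equiv.intro adj_weak_equiv_axioms.intro adj_mor_intro)
  then show ?thesis
    using adj_weak_equiv.amor_qinv by blast
qed

lemma op_cat_op [simp]: "op_cat (op_cat C) = C"
  by (simp add: op_cat_def)

text \<open>Since \<open>alg F\<close> stands for \<open>coalg (op_adj F)\<close>, dualising a
  statement about both algebras and coalgebras produces double opposites.\<close>

lemma op_adj_op [simp]: "op_adj (op_adj F) = F"
  by (simp add: op_adj_def)

section \<open>Split idempotents\<close>

lemma split_idempotentsE:
  assumes "split_idempotents C" "e \<in> Arr C" "Dom C e = x" "Cod C e = x" "e \<cdot>\<^bsub>C\<^esub> e = e"
  obtains r i where "r \<in> Arr C" "i \<in> Arr C" "Dom C r = x" "Cod C i = x" "Dom C i = Cod C r"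
    "i \<cdot>\<^bsub>C\<^esub> r = e" "r \<cdot>\<^bsub>C\<^esub> i = Ide C (Cod C r)"
  using assms unfolding split_idempotents_def by metis

lemma split_idempotents_op:
  assumes "split_idempotents C"
  shows "split_idempotents (op_cat C)"
  unfolding split_idempotents_def
proof (intro ballI impI, elim conjE)
  fix e assume "e \<in> Arr (op_cat C)" "Cod (op_cat C) e = Dom (op_cat C) e" "e \<cdot>\<^bsub>op_cat C\<^esub> e = e"
  then obtain r i where "r \<in> Arr C" "i \<in> Arr C" "Dom C r = Cod C e" "Cod C i = Cod C e" "Dom C i = Cod C r"
    "i \<cdot>\<^bsub>C\<^esub> r = e" "r \<cdot>\<^bsub>C\<^esub> i = Ide C (Cod C r)"
    using split_idempotentsE[OF assms, of e "Cod C e"] by (metis op_cat_simps(2-6))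
  then show "\<exists>r i. r \<in> Arr (op_cat C) \<and> i \<in> Arr (op_cat C) \<and> Dom (op_cat C) r = Dom (op_cat C) e \<and>
      Cod (op_cat C) i = Dom (op_cat C) e \<and> Dom (op_cat C) i = Cod (op_cat C) r \<and>
      i \<cdot>\<^bsub>op_cat C\<^esub> r = e \<and> r \<cdot>\<^bsub>op_cat C\<^esub> i = Ide (op_cat C) (Cod (op_cat C) r)"
    by (intro exI[of _ i] exI[of _ r]) simp
qed

lemma weak_equiv_karoubi_embed:
  assumes C: "is_category C" and s: "split_idempotents C"
  shows "weak_equiv C (karoubi C) (karoubi_embed C)"
proof unfold_locales
  note [simp] = C
  show "is_functor C (karoubi C) (karoubi_embed C)"
    using C by (rule is_functor_karoubi_embed)
  fix x y g
  assume xy: "x \<in> Ob C" "y \<in> Ob C" and g: "g \<in> Arr (karoubi C)" "Dom (karoubi C) g = Fo (karoubi_embed C) x"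
    "Cod (karoubi C) g = Fo (karoubi_embed C) y"
  then obtain u where "g = Arrow (x, Ide C x) u (y, Ide C y)"
    by (cases g) auto
  then show "\<exists>!f. f \<in> Arr C \<and> Dom C f = x \<and> Cod C f = y \<and> Fa (karoubi_embed C) f = g"
    using xy g by (intro ex1I[of _ u]) auto
next
  note [simp] = C
  fix d assume "d \<in> Ob (karoubi C)"
  then obtain x p where d: "d = (x, p)" "x \<in> Ob C" "p \<in> Arr C" "Dom C p = x" "Cod C p = x" "p \<cdot>\<^bsub>C\<^esub> p = p"
    by (cases d) auto
  obtain r i where ri: "r \<in> Arr C" "i \<in> Arr C" "Dom C r = x" "Cod C i = x" "Dom C i = Cod C r"
    "i \<cdot>\<^bsub>C\<^esub> r = p" "r \<cdot>\<^bsub>C\<^esub> i = Ide C (Cod C r)"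
    using split_idempotentsE[OF s d(3-6)] by metis
  let ?y = "Cod C r"
  have 1: "p \<cdot>\<^bsub>C\<^esub> i = i" "r \<cdot>\<^bsub>C\<^esub> p = r"
    using ri Comp_reduce[OF C ri(7), of r] by (simp_all flip: ri(6))
  \<comment> \<open>The object through which \<open>p\<close> splits represents
    \<open>(x, p)\<close>: in the completion the two halves are mutually inverse, as
    \<open>i r = p\<close> is the identity of \<open>(x, p)\<close>.\<close>
  have "is_iso (karoubi C) (Arrow (?y, Ide C ?y) i (x, p))"
    by (rule is_isoI(1)[of _ _ "Arrow (x, p) r (?y, Ide C ?y)"]) (use d ri 1 in simp_all)
  then show "\<exists>c e. c \<in> Ob C \<and> is_iso (karoubi C) e \<and> Dom (karoubi C) e = Fo (karoubi_embed C) c \<and> Cod (karoubi C) e = d"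
    using d ri by (intro exI[of _ ?y] exI[of _ "Arrow (?y, Ide C ?y) i (x, p)"]) simp
qed

context adjunction
begin

text \<open>For \<open>r\<close> to be a homomorphism the structure on the retract must be
  \<open>La (Ra r) \<beta> i\<close>. It is coassociative because the \<open>i r = e\<close> arising
  in the middle is absorbed by \<open>\<beta> i\<close>, as \<open>e\<close> is a homomorphism with
  \<open>e i = i\<close>.\<close>

lemma coalg_split:
  assumes s: "split_idempotents B" and c: "coalg F b \<beta>" and e: "coalg_hom F (b, \<beta>) (b, \<beta>) e" "e \<cdot>\<^bsub>B\<^esub> e = e"
  obtains y \<gamma> r i where "coalg F y \<gamma>" "coalg_hom F (b, \<beta>) (y, \<gamma>) r" "coalg_hom F (y, \<gamma>) (b, \<beta>) i"
    "i \<cdot>\<^bsub>B\<^esub> r = e" "r \<cdot>\<^bsub>B\<^esub> i = Ide B y"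
proof -
  note [simp] = coalgD(1-4)[OF c] coalg_homD(1-3)[OF e(1)]
  obtain r i where ri: "r \<in> Arr B" "i \<in> Arr B" "Dom B r = b" "Cod B i = b" "Dom B i = Cod B r"
    "i \<cdot>\<^bsub>B\<^esub> r = e" "r \<cdot>\<^bsub>B\<^esub> i = Ide B (Cod B r)"
    using split_idempotentsE[OF s coalg_homD(1-3)[OF e(1)] e(2)] by metis
  note [simp] = ri(1-5)
  let ?LR = "\<lambda>g. La (Ra g)"
  have 1: "e \<cdot>\<^bsub>B\<^esub> i = i" "r \<cdot>\<^bsub>B\<^esub> e = r"
    using ri(7) Comp_reduce[OF _ ri(7), of r] by (simp_all flip: ri(6))
  have LR: "?LR r \<cdot>\<^bsub>B\<^esub> ?LR e = ?LR r" "?LR i \<cdot>\<^bsub>B\<^esub> ?LR r = ?LR e"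
    by (simp_all add: 1 ri(6) L.Fa_eq R.Fa_eq[OF 1(2)] flip: L.Fa_Comp R.Fa_Comp)
  have i: "?LR e \<cdot>\<^bsub>B\<^esub> \<beta> \<cdot>\<^bsub>B\<^esub> i = \<beta> \<cdot>\<^bsub>B\<^esub> i"
    using Comp_reduce2[OF _ coalg_homD(4)[OF e(1)], of i] by (simp add: 1)
  have r: "?LR r \<cdot>\<^bsub>B\<^esub> \<beta> \<cdot>\<^bsub>B\<^esub> e = ?LR r \<cdot>\<^bsub>B\<^esub> \<beta>"
    by (simp add: coalg_homD(4)[OF e(1)] Comp_reduce[OF _ LR(1)])
  let ?\<gamma> = "?LR r \<cdot>\<^bsub>B\<^esub> \<beta> \<cdot>\<^bsub>B\<^esub> i"
  have "?LR ?\<gamma> \<cdot>\<^bsub>B\<^esub> ?\<gamma> = ?LR (?LR r) \<cdot>\<^bsub>B\<^esub> ?LR \<beta> \<cdot>\<^bsub>B\<^esub> (?LR i \<cdot>\<^bsub>B\<^esub> ?LR r) \<cdot>\<^bsub>B\<^esub> \<beta> \<cdot>\<^bsub>B\<^esub> i"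
    by simp
  also have "\<dots> = ?LR (?LR r) \<cdot>\<^bsub>B\<^esub> (?LR \<beta> \<cdot>\<^bsub>B\<^esub> \<beta>) \<cdot>\<^bsub>B\<^esub> i"
    by (simp add: LR i)
  also have "\<dots> = ?LR (?LR r) \<cdot>\<^bsub>B\<^esub> (La (\<eta> (Ro b)) \<cdot>\<^bsub>B\<^esub> \<beta>) \<cdot>\<^bsub>B\<^esub> i"
    by (simp only: coalgD(6)[OF c])
  also have "\<dots> = La (\<eta> (Ro (Cod B r))) \<cdot>\<^bsub>B\<^esub> ?\<gamma>"
    by (simp add: L.Fa_eq2[OF \<eta>_nat])
  finally have "?LR ?\<gamma> \<cdot>\<^bsub>B\<^esub> ?\<gamma> = La (\<eta> (Ro (Cod B r))) \<cdot>\<^bsub>B\<^esub> ?\<gamma>" .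
  then have "coalg F (Cod B r) ?\<gamma>"
    by (simp add: coalg_def ri(7) coalg_counit(2)[OF c])
  moreover have "coalg_hom F (b, \<beta>) (Cod B r, ?\<gamma>) r"
    by (simp add: coalg_hom_def ri(6) r)
  moreover have "coalg_hom F (Cod B r, ?\<gamma>) (b, \<beta>) i"
    by (simp add: coalg_hom_def Comp_reduce[OF _ LR(2)] i)
  ultimately show thesis
    using that ri(6,7) by blast
qed

lemmas alg_split = adjunction.coalg_split[OF op, simplified]

lemma split_idempotents_Coalg:
  assumes "split_idempotents B"
  shows "split_idempotents (Coalg F)"
  unfolding split_idempotents_def
proof (intro ballI impI, elim conjE)
  fix e assume e: "e \<in> Arr (Coalg F)" "Cod (Coalg F) e = Dom (Coalg F) e" "e \<cdot>\<^bsub>Coalg F\<^esub> e = e"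
  obtain b \<beta> u where *: "e = Arrow (b, \<beta>) u (b, \<beta>)" "coalg F b \<beta>" "coalg_hom F (b, \<beta>) (b, \<beta>) u"
    using e(1,2) by (cases rule: ArrE_Coalg[OF e(1)]) auto
  moreover have "u \<cdot>\<^bsub>B\<^esub> u = u" using e(3) * by simp
  ultimately obtain y \<gamma> r i where "coalg F y \<gamma>" "coalg_hom F (b, \<beta>) (y, \<gamma>) r" "coalg_hom F (y, \<gamma>) (b, \<beta>) i"
    "i \<cdot>\<^bsub>B\<^esub> r = u" "r \<cdot>\<^bsub>B\<^esub> i = Ide B y"
    using coalg_split[OF assms] by metis
  then show "\<exists>r i. r \<in> Arr (Coalg F) \<and> i \<in> Arr (Coalg F) \<and> Dom (Coalg F) r = Dom (Coalg F) e \<and>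
      Cod (Coalg F) i = Dom (Coalg F) e \<and> Dom (Coalg F) i = Cod (Coalg F) r \<and>
      i \<cdot>\<^bsub>Coalg F\<^esub> r = e \<and> r \<cdot>\<^bsub>Coalg F\<^esub> i = Ide (Coalg F) (Cod (Coalg F) r)"
    by (intro exI[of _ "Arrow (b, \<beta>) r (y, \<gamma>)"] exI[of _ "Arrow (y, \<gamma>) i (b, \<beta>)"]) (simp add: *)
qed

lemma split_idempotents_Alg:
  assumes "split_idempotents A"
  shows "split_idempotents (Alg F)"
  unfolding split_idempotents_def
proof (intro ballI impI, elim conjE)
  fix e assume e: "e \<in> Arr (Alg F)" "Cod (Alg F) e = Dom (Alg F) e" "e \<cdot>\<^bsub>Alg F\<^esub> e = e"
  obtain b \<beta> u where *: "e = Arrow (b, \<beta>) u (b, \<beta>)" "alg F b \<beta>" "alg_hom F (b, \<beta>) (b, \<beta>) u"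
    using e(1,2) by (cases rule: ArrE_Alg[OF e(1)]) auto
  moreover have "u \<cdot>\<^bsub>A\<^esub> u = u" using e(3) * by simp
  ultimately obtain y \<gamma> r i where "alg F y \<gamma>" "alg_hom F (y, \<gamma>) (b, \<beta>) r" "alg_hom F (b, \<beta>) (y, \<gamma>) i"
    "r \<cdot>\<^bsub>A\<^esub> i = u" "i \<cdot>\<^bsub>A\<^esub> r = Ide A y"
    using alg_split[OF split_idempotents_op[OF assms]] by metis
  then show "\<exists>r i. r \<in> Arr (Alg F) \<and> i \<in> Arr (Alg F) \<and> Dom (Alg F) r = Dom (Alg F) e \<and>
      Cod (Alg F) i = Dom (Alg F) e \<and> Dom (Alg F) i = Cod (Alg F) r \<and>
      i \<cdot>\<^bsub>Alg F\<^esub> r = e \<and> r \<cdot>\<^bsub>Alg F\<^esub> i = Ide (Alg F) (Cod (Alg F) r)"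
    \<comment> \<open>Dualising exchanges the two halves of a splitting, so here \<open>i\<close> is
      the retraction and \<open>r\<close> the section.\<close>
    by (intro exI[of _ "Arrow (b, \<beta>) i (y, \<gamma>)"] exI[of _ "Arrow (y, \<gamma>) r (b, \<beta>)"]) (simp add: *)
qed

section \<open>The comparison of a nucleus\<close>

lemma nuc_coalg_ess_surj:
  assumes s: "split_idempotents B" and alg: "alg F a \<alpha>" and hom: "alg_hom F (a, \<alpha>) (Ro (Lo a), Ra (\<epsilon> (Lo a))) \<gamma>"
    and counit: "\<alpha> \<cdot>\<^bsub>A\<^esub> \<gamma> = Ide A a" and coassoc: "Ra (La \<gamma>) \<cdot>\<^bsub>A\<^esub> \<gamma> = Ra (La (\<eta> a)) \<cdot>\<^bsub>A\<^esub> \<gamma>"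
  obtains b \<beta> \<phi> where "coalg F b \<beta>" "is_iso A \<phi>" "Dom A \<phi> = Ro b" "Cod A \<phi> = a"
    "alg_hom F (Ro b, Ra (\<epsilon> b)) (a, \<alpha>) \<phi>" "\<gamma> \<cdot>\<^bsub>A\<^esub> \<phi> = Ra (La \<phi>) \<cdot>\<^bsub>A\<^esub> Ra \<beta>"
proof -
  note [simp] = algD(1-4)[OF alg] alg_homD(1-3)[OF hom]
  define e where "e = \<epsilon> (Lo a) \<cdot>\<^bsub>B\<^esub> La \<gamma>"
  have e [simp]: "e \<in> Arr B" "Dom B e = Lo a" "Cod B e = Lo a"
    by (simp_all add: e_def)
  have Re: "Ra e = \<gamma> \<cdot>\<^bsub>A\<^esub> \<alpha>"
    using alg_homD(4)[OF hom] by (simp add: e_def)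
  \<comment> \<open>Naturality of \<open>\<epsilon>\<close> turns coassociativity of
    \<open>\<gamma>\<close> into this equation. It gives idempotence of \<open>e\<close> by a
    triangle identity and later the coassociativity of the coalgebra constructed on
    \<open>b\<close>.\<close>
  have L\<gamma>: "La \<gamma> \<cdot>\<^bsub>B\<^esub> e = La (\<eta> a) \<cdot>\<^bsub>B\<^esub> e"
  proof -
    have "La \<gamma> \<cdot>\<^bsub>B\<^esub> e = \<epsilon> (Lo (Ro (Lo a))) \<cdot>\<^bsub>B\<^esub> La (Ra (La \<gamma>)) \<cdot>\<^bsub>B\<^esub> La \<gamma>"
      by (simp add: e_def)
    also have "\<dots> = \<epsilon> (Lo (Ro (Lo a))) \<cdot>\<^bsub>B\<^esub> La (Ra (La (\<eta> a))) \<cdot>\<^bsub>B\<^esub> La \<gamma>"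
      using coassoc by (simp add: L.Fa_eq2(1)[OF coassoc] del: \<epsilon>_nat2)
    also have "\<dots> = La (\<eta> a) \<cdot>\<^bsub>B\<^esub> e"
      by (simp add: e_def)
    finally show ?thesis .
  qed
  have "e \<cdot>\<^bsub>B\<^esub> e = \<epsilon> (Lo a) \<cdot>\<^bsub>B\<^esub> La \<gamma> \<cdot>\<^bsub>B\<^esub> e"
    by (subst (1) e_def) simp
  also have "\<dots> = e"
    by (simp add: L\<gamma>)
  finally have ee: "e \<cdot>\<^bsub>B\<^esub> e = e" .
  obtain r i where ri: "r \<in> Arr B" "i \<in> Arr B" "Dom B r = Lo a" "Cod B i = Lo a" "Dom B i = Cod B r"
    "i \<cdot>\<^bsub>B\<^esub> r = e" "r \<cdot>\<^bsub>B\<^esub> i = Ide B (Cod B r)"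
    using split_idempotentsE[OF s e ee] by metis
  define b where "b = Cod B r"
  have [simp]: "b \<in> Ob B" "r \<in> Arr B" "i \<in> Arr B" "Dom B r = Lo a" "Cod B i = Lo a" "Dom B i = b" "Cod B r = b"
    using ri by (simp_all add: b_def)
  have ri: "i \<cdot>\<^bsub>B\<^esub> r = e" "r \<cdot>\<^bsub>B\<^esub> i = Ide B b"
    using ri by simp_all
  have ei: "e \<cdot>\<^bsub>B\<^esub> i = i" and re: "r \<cdot>\<^bsub>B\<^esub> e = r"
    using ri(2) Comp_reduce[OF _ ri(2), of r] by (simp_all flip: ri(1))
  have L\<gamma>i: "La \<gamma> \<cdot>\<^bsub>B\<^esub> i = La (\<eta> a) \<cdot>\<^bsub>B\<^esub> i"
    using Comp_reduce2[OF _ L\<gamma>, of i] by (simp add: ei)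
  \<comment> \<open>The idempotent \<open>Ra e = \<gamma> \<alpha>\<close> is split by
    \<open>Ra r\<close>, \<open>Ra i\<close> through \<open>Ro b\<close> and by
    \<open>\<alpha>\<close>, \<open>\<gamma>\<close> through \<open>a\<close>. These are the
    canonical comparison maps between two splittings.\<close>
  let ?\<phi> = "\<alpha> \<cdot>\<^bsub>A\<^esub> Ra i" and ?\<psi> = "Ra r \<cdot>\<^bsub>A\<^esub> \<gamma>"
  have Ri\<psi>: "Ra i \<cdot>\<^bsub>A\<^esub> ?\<psi> = \<gamma>"
    by (simp add: R.Fa_eq[OF ri(1)] Re counit)
  have \<gamma>\<phi>: "\<gamma> \<cdot>\<^bsub>A\<^esub> ?\<phi> = Ra i"
    using R.Fa_eq(1)[OF ei] by (simp add: Re)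
  have \<phi>\<psi>: "?\<phi> \<cdot>\<^bsub>A\<^esub> ?\<psi> = Ide A a"
    using Ri\<psi> by (simp add: counit)
  have \<psi>\<phi>: "?\<psi> \<cdot>\<^bsub>A\<^esub> ?\<phi> = Ide A (Ro b)"
    using \<gamma>\<phi> R.Fa_eq(1)[OF ri(2)] by simp
  have iso: "is_iso A ?\<phi>"
    by (rule is_isoI(1)[of _ _ ?\<psi>]) (use \<phi>\<psi> \<psi>\<phi> in simp_all)
  \<comment> \<open>The inclusion of \<open>b\<close> into \<open>Lo a\<close>, followed by
    \<open>La\<close> of the isomorphism from \<open>a\<close> to \<open>Ro b\<close>.\<close>
  let ?\<beta> = "La ?\<psi> \<cdot>\<^bsub>B\<^esub> i"
  have "La (Ra ?\<beta>) \<cdot>\<^bsub>B\<^esub> ?\<beta> = La (Ra (La ?\<psi>)) \<cdot>\<^bsub>B\<^esub> La (Ra i \<cdot>\<^bsub>A\<^esub> ?\<psi>) \<cdot>\<^bsub>B\<^esub> i"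
    by simp
  also have "\<dots> = La (Ra (La ?\<psi>)) \<cdot>\<^bsub>B\<^esub> La (\<eta> a) \<cdot>\<^bsub>B\<^esub> i"
    unfolding Ri\<psi> L\<gamma>i ..
  also have "\<dots> = La (\<eta> (Ro b)) \<cdot>\<^bsub>B\<^esub> ?\<beta>"
    by (simp add: L.Fa_eq2[OF \<eta>_nat])
  finally have co: "La (Ra ?\<beta>) \<cdot>\<^bsub>B\<^esub> ?\<beta> = La (\<eta> (Ro b)) \<cdot>\<^bsub>B\<^esub> ?\<beta>" .
  have "\<epsilon> b \<cdot>\<^bsub>B\<^esub> ?\<beta> = r \<cdot>\<^bsub>B\<^esub> e \<cdot>\<^bsub>B\<^esub> i"
    by (simp add: e_def)
  then have "\<epsilon> b \<cdot>\<^bsub>B\<^esub> ?\<beta> = Ide B b"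
    by (simp add: ei ri)
  with co have "coalg F b ?\<beta>"
    unfolding coalg_def by simp
  moreover have "?\<phi> \<cdot>\<^bsub>A\<^esub> Ra (\<epsilon> b) = \<alpha> \<cdot>\<^bsub>A\<^esub> Ra (La ?\<phi>)"
  proof -
    have "Ra i \<cdot>\<^bsub>A\<^esub> Ra (\<epsilon> b) = Ra (\<epsilon> (Lo a)) \<cdot>\<^bsub>A\<^esub> Ra (La (Ra i))"
      using R.Fa_eq2(1)[OF \<epsilon>_nat, of i "Lo a"] by simp
    then show ?thesis
      using Comp_reduce2[OF _ algD(6)[OF alg], of "Ra (La (Ra i))"] by simp
  qed
  then have "alg_hom F (Ro b, Ra (\<epsilon> b)) (a, \<alpha>) ?\<phi>"
    by (simp add: alg_hom_iff)
  moreover have "Ra (La ?\<phi>) \<cdot>\<^bsub>A\<^esub> Ra ?\<beta> = Ra (La (?\<phi> \<cdot>\<^bsub>A\<^esub> ?\<psi>)) \<cdot>\<^bsub>A\<^esub> Ra i"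
    by simp
  then have "\<gamma> \<cdot>\<^bsub>A\<^esub> ?\<phi> = Ra (La ?\<phi>) \<cdot>\<^bsub>A\<^esub> Ra ?\<beta>"
    unfolding \<phi>\<psi> \<gamma>\<phi> by simp
  ultimately show thesis
    using that iso by simp
qed

text \<open>As \<open>\<beta>\<close> is a section of \<open>\<epsilon> b\<close>, an arrow
  \<open>g\<close> out of \<open>b\<close> is recovered from \<open>Ra g\<close> by the formula
  \<open>\<epsilon> b' La (Ra g) \<beta>\<close>; the preimage of \<open>f\<close> is this formula
  with \<open>f\<close> for \<open>Ra g\<close>. The algebra equation shows that its image is
  \<open>f\<close>, the coalgebra equation that it is a homomorphism.\<close>

lemma nuc_coalg_full:
  assumes c: "coalg F b \<beta>" "coalg F b' \<beta>'" and hom: "alg_hom F (Ro b, Ra (\<epsilon> b)) (Ro b', Ra (\<epsilon> b')) f"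
    and f: "Ra \<beta>' \<cdot>\<^bsub>A\<^esub> f = Ra (La f) \<cdot>\<^bsub>A\<^esub> Ra \<beta>"
  shows "coalg_hom F (b, \<beta>) (b', \<beta>') (\<epsilon> b' \<cdot>\<^bsub>B\<^esub> La f \<cdot>\<^bsub>B\<^esub> \<beta>)" "Ra (\<epsilon> b' \<cdot>\<^bsub>B\<^esub> La f \<cdot>\<^bsub>B\<^esub> \<beta>) = f"
proof -
  note [simp] = coalgD(1-4)[OF c(1)] coalgD(1-4)[OF c(2)] alg_homD(1-3)[OF hom]
  have "Ra (\<epsilon> b' \<cdot>\<^bsub>B\<^esub> La f \<cdot>\<^bsub>B\<^esub> \<beta>) = (Ra (\<epsilon> b') \<cdot>\<^bsub>A\<^esub> Ra (La f)) \<cdot>\<^bsub>A\<^esub> Ra \<beta>"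
    by simp
  also have "\<dots> = (f \<cdot>\<^bsub>A\<^esub> Ra (\<epsilon> b)) \<cdot>\<^bsub>A\<^esub> Ra \<beta>"
    unfolding alg_homD(4)[OF hom] ..
  also have "\<dots> = f"
    using R.Fa_eq(1)[OF coalg_counit(1)[OF c(1)]] by simp
  finally show 1: "Ra (\<epsilon> b' \<cdot>\<^bsub>B\<^esub> La f \<cdot>\<^bsub>B\<^esub> \<beta>) = f" .
  have "\<beta>' \<cdot>\<^bsub>B\<^esub> \<epsilon> b' \<cdot>\<^bsub>B\<^esub> La f \<cdot>\<^bsub>B\<^esub> \<beta> = \<epsilon> (Lo (Ro b')) \<cdot>\<^bsub>B\<^esub> La (Ra \<beta>' \<cdot>\<^bsub>A\<^esub> f) \<cdot>\<^bsub>B\<^esub> \<beta>"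
    by simp
  also have "\<dots> = La f \<cdot>\<^bsub>B\<^esub> \<epsilon> (Lo (Ro b)) \<cdot>\<^bsub>B\<^esub> La (Ra \<beta>) \<cdot>\<^bsub>B\<^esub> \<beta>"
    unfolding f by simp
  also have "\<dots> = La f \<cdot>\<^bsub>B\<^esub> \<beta>"
    by (simp only: coalgD(6)[OF c(1)]) simp
  finally show "coalg_hom F (b, \<beta>) (b', \<beta>') (\<epsilon> b' \<cdot>\<^bsub>B\<^esub> La f \<cdot>\<^bsub>B\<^esub> \<beta>)"
    unfolding coalg_hom_def fst_conv snd_conv 1 by simp
qed

lemma nuc_coalg_faithful:
  assumes "coalg F b \<beta>" "coalg F b' \<beta>'" "coalg_hom F (b, \<beta>) (b', \<beta>') g"
  shows "\<epsilon> b' \<cdot>\<^bsub>B\<^esub> La (Ra g) \<cdot>\<^bsub>B\<^esub> \<beta> = g"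
proof -
  note [simp] = coalgD(1-4)[OF assms(1)] coalgD(1-4)[OF assms(2)] coalg_homD(1-3)[OF assms(3)]
  show ?thesis
    using coalg_counit(1)[OF assms(1)] by simp
qed

lemmas nuc_alg_ess_surj = adjunction.nuc_coalg_ess_surj[OF op, simplified]
lemmas nuc_alg_full = adjunction.nuc_coalg_full[OF op, simplified]
lemmas nuc_alg_faithful = adjunction.nuc_coalg_faithful[OF op, simplified]

lemma weak_equiv_kappa0:
  assumes s: "split_idempotents B"
  shows "weak_equiv (Coalg F) (Coalg (nuc F)) (kappa0 (nuc F))"
proof -
  interpret N: adjunction "nuc F" by unfold_locales (rule is_adjunction_nuc)
  interpret k: cat_functor "Coalg F" "Coalg (nuc F)" "kappa0 (nuc F)"
    using N.is_functor_kappa0 by unfold_locales simp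
  show ?thesis
  proof unfold_locales
    fix x y g
    assume "x \<in> Ob (Coalg F)" "y \<in> Ob (Coalg F)" and g: "g \<in> Arr (Coalg (nuc F))"
      "Dom (Coalg (nuc F)) g = Fo (kappa0 (nuc F)) x" "Cod (Coalg (nuc F)) g = Fo (kappa0 (nuc F)) y"
    then obtain b \<beta> b' \<beta>' where x: "x = (b, \<beta>)" and y: "y = (b', \<beta>')" and c: "coalg F b \<beta>" "coalg F b' \<beta>'"
      by (auto elim!: ObE_Coalg)
    note [simp] = coalgD(1-4)[OF c(1)] coalgD(1-4)[OF c(2)]
    obtain u where u: "g = Arrow (Fo (kappa0 (nuc F)) x) u (Fo (kappa0 (nuc F)) y)"
      using g(2,3) by (cases g) auto
    have hu: "coalg_hom (nuc F) (Fo (kappa0 (nuc F)) x) (Fo (kappa0 (nuc F)) y) u"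
      using g(1) by (simp add: u x y)
    \<comment> \<open>There are two layers to remove: \<open>g\<close> lies over an algebra
      homomorphism \<open>u\<close>, and \<open>u\<close> over an arrow \<open>f\<close> of
      \<open>A\<close>.\<close>
    then obtain f where f: "u = Arrow (Ro b, Ra (\<epsilon> b)) f (Ro b', Ra (\<epsilon> b'))"
      by (cases u) (simp add: coalg_hom_def x y)
    have fh: "alg_hom F (Ro b, Ra (\<epsilon> b)) (Ro b', Ra (\<epsilon> b')) f"
      using hu by (simp add: coalg_hom_def[of "nuc F"] x y f)
    note [simp] = alg_homD(1-3)[OF fh]
    have "Ra \<beta>' \<cdot>\<^bsub>A\<^esub> f = Ra (La f) \<cdot>\<^bsub>A\<^esub> Ra \<beta>"
      using hu by (simp add: coalg_hom_def[of "nuc F"] x y f)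
    note full = nuc_coalg_full[OF c fh this]
    let ?h = "\<epsilon> b' \<cdot>\<^bsub>B\<^esub> La f \<cdot>\<^bsub>B\<^esub> \<beta>"
    show "\<exists>!h. h \<in> Arr (Coalg F) \<and> Dom (Coalg F) h = x \<and> Cod (Coalg F) h = y \<and> Fa (kappa0 (nuc F)) h = g"
    proof (rule ex1I[of _ "Arrow x ?h y"])
      show "Arrow x ?h y \<in> Arr (Coalg F) \<and> Dom (Coalg F) (Arrow x ?h y) = x \<and>
          Cod (Coalg F) (Arrow x ?h y) = y \<and> Fa (kappa0 (nuc F)) (Arrow x ?h y) = g"
        using c full by (simp add: x y u f)
      fix h assume h: "h \<in> Arr (Coalg F) \<and> Dom (Coalg F) h = x \<and> Cod (Coalg F) h = y \<and> Fa (kappa0 (nuc F)) h = g"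
      then obtain v where v: "h = Arrow (b, \<beta>) v (b', \<beta>')"
        by (cases h) (auto simp: x y)
      then have "coalg_hom F (b, \<beta>) (b', \<beta>') v" "Ra v = f"
        using h by (auto simp: u f x y)
      then show "h = Arrow x ?h y"
        using nuc_coalg_faithful[OF c, of v] by (simp add: x y v)
    qed
  next
    fix d assume "d \<in> Ob (Coalg (nuc F))"
    then obtain a \<alpha> \<xi> where d: "d = ((a, \<alpha>), \<xi>)" and \<xi>: "coalg (nuc F) (a, \<alpha>) \<xi>"
      by (cases d) auto
    note c = N.coalgD[OF \<xi>]
    have alg: "alg F a \<alpha>"
      using c(1) by simp
    note [simp] = algD(1-4)[OF alg]
    obtain \<gamma> where \<gamma>: "\<xi> = Arrow (a, \<alpha>) \<gamma> (Ro (Lo a), Ra (\<epsilon> (Lo a)))"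
      using c(3,4) by (cases \<xi>) auto
    have hom: "alg_hom F (a, \<alpha>) (Ro (Lo a), Ra (\<epsilon> (Lo a))) \<gamma>"
      using c(2) by (simp add: \<gamma>)
    note [simp] = alg_homD(1-3)[OF hom]
    have "\<alpha> \<cdot>\<^bsub>A\<^esub> \<gamma> = Ide A a" "Ra (La \<gamma>) \<cdot>\<^bsub>A\<^esub> \<gamma> = Ra (La (\<eta> a)) \<cdot>\<^bsub>A\<^esub> \<gamma>"
      using c(5,6) by (simp_all add: \<gamma>)
    then obtain b \<beta> \<phi> where b: "coalg F b \<beta>" "is_iso A \<phi>" "Dom A \<phi> = Ro b" "Cod A \<phi> = a"
      "alg_hom F (Ro b, Ra (\<epsilon> b)) (a, \<alpha>) \<phi>" "\<gamma> \<cdot>\<^bsub>A\<^esub> \<phi> = Ra (La \<phi>) \<cdot>\<^bsub>A\<^esub> Ra \<beta>"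
      using nuc_coalg_ess_surj[OF s alg hom] by metis
    note [simp] = coalgD(1-4)[OF b(1)] alg_homD(1-3)[OF b(5)]
    let ?k = "Fo (kappa0 (nuc F)) (b, \<beta>)" and ?\<phi> = "Arrow (Ro b, Ra (\<epsilon> b)) \<phi> (a, \<alpha>)"
    have \<phi>: "?\<phi> \<in> Arr (Alg F)"
      using alg b(5) by (simp add: alg_free)
    have "?k \<in> Ob (Coalg (nuc F))"
      by (rule k.Fo_Ob) (simp add: b)
    then have "Arrow ?k ?\<phi> d \<in> Arr (Coalg (nuc F))"
      using \<phi> \<xi> b(6) by (simp add: d coalg_hom_def[of "nuc F"] \<gamma>)
    then have "is_iso (Coalg (nuc F)) (Arrow ?k ?\<phi> d)"
      by (rule N.iso_Coalg) (use iso_Alg(1)[OF \<phi> b(2)] in simp)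
    then show "\<exists>c e. c \<in> Ob (Coalg F) \<and> is_iso (Coalg (nuc F)) e \<and>
        Dom (Coalg (nuc F)) e = Fo (kappa0 (nuc F)) c \<and> Cod (Coalg (nuc F)) e = d"
      using b(1) by (intro exI[of _ "(b, \<beta>)"] exI[of _ "Arrow ?k ?\<phi> d"]) simp
  qed
qed

text \<open>Duality ends at the base categories: an \<open>Arrow\<close> records its source and
  target, so \<open>Alg F\<close> is only isomorphic to the opposite of
  \<open>Coalg (op_adj F)\<close>, not equal to it. The argument for \<open>kappa0\<close> is
  therefore repeated, with the dual base lemmas.\<close>

lemma weak_equiv_kappa1:
  assumes s: "split_idempotents A"
  shows "weak_equiv (Alg F) (Alg (nuc F)) (kappa1 (nuc F))"
proof -
  interpret N: adjunction "nuc F" by unfold_locales (rule is_adjunction_nuc)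
  interpret k: cat_functor "Alg F" "Alg (nuc F)" "kappa1 (nuc F)"
    using N.is_functor_kappa1 by unfold_locales simp
  show ?thesis
  proof unfold_locales
    fix x y g
    assume "x \<in> Ob (Alg F)" "y \<in> Ob (Alg F)" and g: "g \<in> Arr (Alg (nuc F))"
      "Dom (Alg (nuc F)) g = Fo (kappa1 (nuc F)) x" "Cod (Alg (nuc F)) g = Fo (kappa1 (nuc F)) y"
    then obtain a \<alpha> a' \<alpha>' where x: "x = (a, \<alpha>)" and y: "y = (a', \<alpha>')" and c: "alg F a \<alpha>" "alg F a' \<alpha>'"
      by (auto elim!: ObE_Alg)
    note [simp] = algD(1-4)[OF c(1)] algD(1-4)[OF c(2)]
    obtain u where u: "g = Arrow (Fo (kappa1 (nuc F)) x) u (Fo (kappa1 (nuc F)) y)"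
      using g(2,3) by (cases g) auto
    have hu: "alg_hom (nuc F) (Fo (kappa1 (nuc F)) x) (Fo (kappa1 (nuc F)) y) u"
      using g(1) by (simp add: u x y)
    then obtain f where f: "u = Arrow (Lo a, La (\<eta> a)) f (Lo a', La (\<eta> a'))"
      by (cases u) (simp add: coalg_hom_def x y)
    have fh: "coalg_hom F (Lo a, La (\<eta> a)) (Lo a', La (\<eta> a')) f"
      using hu by (simp add: alg_hom_iff[of "nuc F"] x y f)
    note [simp] = coalg_homD(1-3)[OF fh]
    have "f \<cdot>\<^bsub>B\<^esub> La \<alpha> = La \<alpha>' \<cdot>\<^bsub>B\<^esub> La (Ra f)"
      using hu by (simp add: alg_hom_iff[of "nuc F"] x y f)
    note full = nuc_alg_full[OF c(2,1) fh this]
    let ?h = "(\<alpha>' \<cdot>\<^bsub>A\<^esub> Ra f) \<cdot>\<^bsub>A\<^esub> \<eta> a"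
    show "\<exists>!h. h \<in> Arr (Alg F) \<and> Dom (Alg F) h = x \<and> Cod (Alg F) h = y \<and> Fa (kappa1 (nuc F)) h = g"
    proof (rule ex1I[of _ "Arrow x ?h y"])
      show "Arrow x ?h y \<in> Arr (Alg F) \<and> Dom (Alg F) (Arrow x ?h y) = x \<and>
          Cod (Alg F) (Arrow x ?h y) = y \<and> Fa (kappa1 (nuc F)) (Arrow x ?h y) = g"
        using c full by (simp add: x y u f)
      fix h assume h: "h \<in> Arr (Alg F) \<and> Dom (Alg F) h = x \<and> Cod (Alg F) h = y \<and> Fa (kappa1 (nuc F)) h = g"
      then obtain v where v: "h = Arrow (a, \<alpha>) v (a', \<alpha>')"
        by (cases h) (auto simp: x y)
      then have "alg_hom F (a, \<alpha>) (a', \<alpha>') v" "La v = f"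
        using h by (auto simp: u f x y)
      then show "h = Arrow x ?h y"
        using nuc_alg_faithful[OF c(2,1), of v] by (simp add: x y v)
    qed
  next
    fix d assume "d \<in> Ob (Alg (nuc F))"
    then obtain b \<beta> \<xi> where d: "d = ((b, \<beta>), \<xi>)" and \<xi>: "alg (nuc F) (b, \<beta>) \<xi>"
      by (cases d) auto
    note c = N.algD[OF \<xi>]
    have coalg: "coalg F b \<beta>"
      using c(1) by simp
    note [simp] = coalgD(1-4)[OF coalg]
    obtain \<gamma> where \<gamma>: "\<xi> = Arrow (Lo (Ro b), La (\<eta> (Ro b))) \<gamma> (b, \<beta>)"
      using c(3,4) by (cases \<xi>) auto
    have hom: "coalg_hom F (Lo (Ro b), La (\<eta> (Ro b))) (b, \<beta>) \<gamma>"
      using c(2) by (simp add: \<gamma>)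
    note [simp] = coalg_homD(1-3)[OF hom]
    have "\<gamma> \<cdot>\<^bsub>B\<^esub> \<beta> = Ide B b" "\<gamma> \<cdot>\<^bsub>B\<^esub> La (Ra \<gamma>) = \<gamma> \<cdot>\<^bsub>B\<^esub> La (Ra (\<epsilon> b))"
      using c(5,6) by (simp_all add: \<gamma>)
    then obtain a \<alpha> \<phi> where a: "alg F a \<alpha>" "is_iso B \<phi>" "Cod B \<phi> = Lo a" "Dom B \<phi> = b"
      "coalg_hom F (b, \<beta>) (Lo a, La (\<eta> a)) \<phi>" "\<phi> \<cdot>\<^bsub>B\<^esub> \<gamma> = La \<alpha> \<cdot>\<^bsub>B\<^esub> La (Ra \<phi>)"
      using nuc_alg_ess_surj[OF split_idempotents_op[OF s] coalg hom] by metis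
    note [simp] = algD(1-4)[OF a(1)] coalg_homD(1-3)[OF a(5)]
    let ?k = "Fo (kappa1 (nuc F)) (a, \<alpha>)" and ?\<phi> = "Arrow (b, \<beta>) \<phi> (Lo a, La (\<eta> a))"
    have \<phi>: "?\<phi> \<in> Arr (Coalg F)"
      using coalg a(5) by (simp add: coalg_cofree)
    have "?k \<in> Ob (Alg (nuc F))"
      by (rule k.Fo_Ob) (simp add: a)
    then have "Arrow d ?\<phi> ?k \<in> Arr (Alg (nuc F))"
      using \<phi> \<xi> a(6) by (simp add: d alg_hom_iff[of "nuc F"] \<gamma>)
    then have "is_iso (Alg (nuc F)) (Arrow d ?\<phi> ?k)"
      by (rule N.iso_Alg) (use iso_Coalg(1)[OF \<phi> a(2)] in simp)
    \<comment> \<open>The dual lemma yields an isomorphism out of \<open>d\<close>, while essential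
      surjectivity asks for one into \<open>d\<close>.\<close>
    then have "is_iso (Alg (nuc F)) (inv_arr (Alg (nuc F)) (Arrow d ?\<phi> ?k)) \<and>
        Dom (Alg (nuc F)) (inv_arr (Alg (nuc F)) (Arrow d ?\<phi> ?k)) = ?k \<and>
        Cod (Alg (nuc F)) (inv_arr (Alg (nuc F)) (Arrow d ?\<phi> ?k)) = d"
      using is_iso_inv[OF N.is_category_Alg] Dom_inv[OF N.is_category_Alg] Cod_inv[OF N.is_category_Alg]
      by simp
    then show "\<exists>c e. c \<in> Ob (Alg F) \<and> is_iso (Alg (nuc F)) e \<and>
        Dom (Alg (nuc F)) e = Fo (kappa1 (nuc F)) c \<and> Cod (Alg (nuc F)) e = d"
      using a(1) by (intro exI[of _ "(a, \<alpha>)"] exI[of _ "inv_arr (Alg (nuc F)) (Arrow d ?\<phi> ?k)"]) simp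
  qed
qed

lemma comparison_nuc_qinv:
  assumes "split_idempotents A" "split_idempotents B"
  shows "\<exists>M. amor_qinv (nuc F) (nuc (nuc F)) (comparison (nuc F)) M"
proof -
  interpret N: adjunction "nuc F" by unfold_locales (rule is_adjunction_nuc)
  show ?thesis
    using ex_amor_qinv[OF N.adj_morphism_comparison] weak_equiv_kappa0[OF assms(2)] weak_equiv_kappa1[OF assms(1)]
    by simp
qed

lemma adj_embed_qinv:
  assumes "split_idempotents A" "split_idempotents B"
  shows "\<exists>M. amor_qinv F (karoubi_adj F) (adj_embed F) M"
  using ex_amor_qinv[OF adj_morphism_embed[OF is_adjunction]] weak_equiv_karoubi_embed[OF L.cats(1) assms(1)]
    weak_equiv_karoubi_embed[OF L.cats(2) assms(2)] by simp

end

section \<open>The nucleus monad\<close>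

lemma amor_isoD:
  assumes "amor_iso F G \<Upsilon> \<Upsilon>'"
  shows "adj_morphism F G \<Upsilon>" "adj_morphism F G \<Upsilon>'"
  using assms by (simp_all add: amor_iso_def)

lemma adj_morphismD: "adj_morphism F G \<Upsilon> \<Longrightarrow> is_adjunction F" "adj_morphism F G \<Upsilon> \<Longrightarrow> is_adjunction G"
  by (simp_all add: adj_morphism_def)

lemma amor_eq_trans: "\<lbrakk>amor_eq F \<Upsilon> \<Upsilon>'; amor_eq F \<Upsilon>' \<Upsilon>''\<rbrakk> \<Longrightarrow> amor_eq F \<Upsilon> \<Upsilon>''"
  by (simp add: amor_eq_def)

declare amor_iso_trans [trans]

text \<open>Insert \<open>m' u'\<close> in front of \<open>a m\<close>, exchange \<open>u' a\<close>
  for \<open>b u\<close>, and cancel \<open>u m\<close>. Naturality of the multiplication follows in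
  this way from naturality of the unit.\<close>

lemma amor_qinv_square:
  assumes u: "amor_qinv F G u m" and u': "amor_qinv F' G' u' m'"
    and a: "adj_morphism F F' a" and b: "adj_morphism G G' b"
    and sq: "amor_iso F G' (amor_comp G' b u) (amor_comp G' u' a)"
  shows "amor_iso G F' (amor_comp F' a m) (amor_comp F' m' b)"
proof -
  note U = amor_qinvD[OF u] and U' = amor_qinvD[OF u']
  note am = adj_morphism_comp[OF U(2) a]
  have "amor_iso G F' (amor_comp F' a m) (amor_comp F' (amor_id F') (amor_comp F' a m))"
    by (rule amor_iso_sym[OF amor_iso_id_left[OF am]])
  also have "amor_iso G F' \<dots> (amor_comp F' (amor_comp F' m' u') (amor_comp F' a m))"
    by (rule amor_iso_comp_right[OF am amor_iso_sym[OF U'(3)]])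
  also have "amor_iso G F' \<dots> (amor_comp F' m' (amor_comp G' u' (amor_comp F' a m)))"
    by (rule amor_iso_assoc[OF am U'(1,2)])
  also have "amor_iso G F' \<dots> (amor_comp F' m' (amor_comp G' (amor_comp G' u' a) m))"
    by (rule amor_iso_comp_left[OF amor_iso_sym[OF amor_iso_assoc[OF U(2) a U'(1)]] U'(2)])
  also have "amor_iso G F' \<dots> (amor_comp F' m' (amor_comp G' (amor_comp G' b u) m))"
    by (rule amor_iso_comp_left[OF amor_iso_comp_right[OF U(2) amor_iso_sym[OF sq]] U'(2)])
  also have "amor_iso G F' \<dots> (amor_comp F' m' (amor_comp G' b (amor_comp G u m)))"
    by (rule amor_iso_comp_left[OF amor_iso_assoc[OF U(2,1) b] U'(2)])
  also have "amor_iso G F' \<dots> (amor_comp F' m' (amor_comp G' b (amor_id G)))"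
    by (rule amor_iso_comp_left[OF amor_iso_comp_left[OF U(4) b] U'(2)])
  also have "amor_iso G F' \<dots> (amor_comp F' m' b)"
    by (rule amor_iso_comp_left[OF amor_iso_id_right[OF b] U'(2)])
  finally show ?thesis .
qed

text \<open>The case of \<open>amor_qinv_square\<close> in which both vertical sides are
  identities.\<close>

lemma amor_qinv_unique:
  assumes u: "amor_qinv F G u m" and u': "amor_qinv F G u' m'" and iso: "amor_iso F G u u'"
  shows "amor_iso G F m m'"
proof -
  note U = amor_qinvD[OF u] and U' = amor_qinvD[OF u']
  note adj = adj_morphismD[OF U(1)]
  have "amor_iso F G (amor_comp G (amor_id G) u) (amor_comp G u' (amor_id F))"
    using amor_iso_id_left[OF U(1)] iso amor_iso_sym[OF amor_iso_id_right[OF U'(1)]] amor_iso_trans by blast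
  from amor_qinv_square[OF u u' adj_morphism_id[OF adj(1)] adj_morphism_id[OF adj(2)] this]
  have "amor_iso G F (amor_comp F (amor_id F) m) (amor_comp F m' (amor_id G))" .
  then show ?thesis
    using amor_iso_sym[OF amor_iso_id_left[OF U(2)]] amor_iso_id_right[OF U'(2)] amor_iso_trans by blast
qed

lemma amor_qinv_comp_left:
  assumes "amor_qinv F G u m" "amor_qinv G L v n"
  shows "amor_iso F F (amor_comp F (amor_comp F m n) (amor_comp L v u)) (amor_id F)"
proof -
  note U = amor_qinvD[OF assms(1)] and V = amor_qinvD[OF assms(2)]
  note vu = adj_morphism_comp[OF U(1) V(1)]
  have "amor_iso F F (amor_comp F (amor_comp F m n) (amor_comp L v u)) (amor_comp F m (amor_comp G n (amor_comp L v u)))"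
    by (rule amor_iso_assoc[OF vu V(2) U(2)])
  also have "amor_iso F F \<dots> (amor_comp F m (amor_comp G (amor_comp G n v) u))"
    by (rule amor_iso_comp_left[OF amor_iso_sym[OF amor_iso_assoc[OF U(1) V(1,2)]] U(2)])
  also have "amor_iso F F \<dots> (amor_comp F m (amor_comp G (amor_id G) u))"
    by (rule amor_iso_comp_left[OF amor_iso_comp_right[OF U(1) V(3)] U(2)])
  also have "amor_iso F F \<dots> (amor_comp F m u)"
    by (rule amor_iso_comp_left[OF amor_iso_id_left[OF U(1)] U(2)])
  also note U(3)
  finally show ?thesis .
qed

lemma amor_qinv_comp:
  assumes u: "amor_qinv F G u m" and v: "amor_qinv G L v n"
  shows "amor_qinv F L (amor_comp L v u) (amor_comp F m n)"
  unfolding amor_qinv_def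
  using adj_morphism_comp[OF amor_qinvD(1)[OF u] amor_qinvD(1)[OF v]]
    adj_morphism_comp[OF amor_qinvD(2)[OF v] amor_qinvD(2)[OF u]]
    amor_qinv_comp_left[OF u v] amor_qinv_comp_left[OF amor_qinv_sym[OF v] amor_qinv_sym[OF u]] by blast

lemma amor_qinv_iso:
  assumes u: "amor_qinv F G u m" and iso: "amor_iso F G u u'"
  shows "amor_qinv F G u' m"
proof -
  note U = amor_qinvD[OF u]
  have "amor_iso F F (amor_comp F m u') (amor_id F)"
    using amor_iso_comp_left[OF amor_iso_sym[OF iso] U(2)] U(3) by (rule amor_iso_trans)
  moreover have "amor_iso G G (amor_comp G u' m) (amor_id G)"
    using amor_iso_comp_right[OF U(2) amor_iso_sym[OF iso]] U(4) by (rule amor_iso_trans)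
  ultimately show ?thesis
    using U(2) amor_isoD(2)[OF iso] by (simp add: amor_qinv_def)
qed

section \<open>Preservation of quasi-inverses by \<open>nuc_amor\<close>\<close>

lemma nuc_amor_comp_iso:
  assumes "adj_morphism F G \<Upsilon>" "adj_morphism G L \<Psi>"
  shows "amor_iso (nuc F) (nuc L) (nuc_amor F L (amor_comp L \<Psi> \<Upsilon>))
    (amor_comp (nuc L) (nuc_amor G L \<Psi>) (nuc_amor F G \<Upsilon>))"
  by (rule amor_eq_imp_iso[OF _ nuc_amor_comp[OF assms]])
    (rule adj_mor.adj_morphism_nuc[OF adj_mor_intro[OF adj_morphism_comp[OF assms]]])

lemma nuc_amor_qinv_left:
  assumes "adj_morphism F G u" "adj_morphism G F m" "amor_iso F F (amor_comp F m u) (amor_id F)"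
  shows "amor_iso (nuc F) (nuc F) (amor_comp (nuc F) (nuc_amor G F m) (nuc_amor F G u)) (amor_id (nuc F))"
proof -
  have F: "is_adjunction F"
    using assms(1) by (rule adj_morphismD)
  have "amor_iso (nuc F) (nuc F) (amor_comp (nuc F) (nuc_amor G F m) (nuc_amor F G u)) (nuc_amor F F (amor_comp F m u))"
    by (rule amor_iso_sym[OF nuc_amor_comp_iso[OF assms(1,2)]])
  also have "amor_iso (nuc F) (nuc F) \<dots> (nuc_amor F F (amor_id F))"
    by (rule nuc_amor_iso[OF assms(3)])
  also have "amor_iso (nuc F) (nuc F) \<dots> (amor_id (nuc F))"
    by (rule amor_eq_imp_iso[OF _ nuc_amor_id[OF F]])
      (rule adj_mor.adj_morphism_nuc[OF adj_mor_intro[OF adj_morphism_id[OF F]]])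
  finally show ?thesis .
qed

lemma nuc_amor_qinv:
  assumes "amor_qinv F G u m"
  shows "amor_qinv (nuc F) (nuc G) (nuc_amor F G u) (nuc_amor G F m)"
proof -
  note U = amor_qinvD[OF assms]
  show ?thesis
    unfolding amor_qinv_def
    using adj_mor.adj_morphism_nuc[OF adj_mor_intro[OF U(1)]] adj_mor.adj_morphism_nuc[OF adj_mor_intro[OF U(2)]]
      nuc_amor_qinv_left[OF U(1-3)] nuc_amor_qinv_left[OF U(2,1,4)] by blast
qed

section \<open>The nucleus after completion\<close>

lemma is_adjunction_Nuc: "is_adjunction F \<Longrightarrow> is_adjunction (Nuc F)"
  unfolding Nuc_def by (intro adjunction.is_adjunction_nuc adjunction.intro is_adjunction_karoubi)

lemma adj_morphism_Nuc: "adj_morphism F G \<Upsilon> \<Longrightarrow> adj_morphism (Nuc F) (Nuc G) (Nuc_amor F G \<Upsilon>)"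
  unfolding Nuc_def Nuc_amor_def by (intro adj_mor.adj_morphism_nuc adj_mor_intro adj_morphism_karoubi)

lemma Nuc_amor_id:
  assumes "is_adjunction F"
  shows "amor_eq (Nuc F) (Nuc_amor F F (amor_id F)) (amor_id (Nuc F))"
  unfolding Nuc_def Nuc_amor_def
  by (rule amor_eq_trans[OF nuc_amor_cong[OF adj_morphism_karoubi[OF adj_morphism_id[OF assms]] karoubi_amor_id[OF assms]]
        nuc_amor_id[OF is_adjunction_karoubi[OF assms]]])

lemma Nuc_amor_comp:
  assumes "adj_morphism F G \<Upsilon>" "adj_morphism G L \<Psi>"
  shows "amor_eq (Nuc F) (Nuc_amor F L (amor_comp L \<Psi> \<Upsilon>)) (amor_comp (Nuc L) (Nuc_amor G L \<Psi>) (Nuc_amor F G \<Upsilon>))"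
  unfolding Nuc_def Nuc_amor_def
  by (rule amor_eq_trans[OF nuc_amor_cong[OF adj_morphism_karoubi[OF adj_morphism_comp[OF assms]] karoubi_amor_comp[OF assms]]
        nuc_amor_comp[OF adj_morphism_karoubi[OF assms(1)] adj_morphism_karoubi[OF assms(2)]]])

lemma Nuc_amor_iso:
  "amor_iso F G \<Upsilon> \<Upsilon>' \<Longrightarrow> amor_iso (Nuc F) (Nuc G) (Nuc_amor F G \<Upsilon>) (Nuc_amor F G \<Upsilon>')"
  unfolding Nuc_def Nuc_amor_def by (intro nuc_amor_iso karoubi_amor_iso)

lemma Nuc_amor_comp_iso:
  assumes "adj_morphism F G \<Upsilon>" "adj_morphism G L \<Psi>"
  shows "amor_iso (Nuc F) (Nuc L) (Nuc_amor F L (amor_comp L \<Psi> \<Upsilon>))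
    (amor_comp (Nuc L) (Nuc_amor G L \<Psi>) (Nuc_amor F G \<Upsilon>))"
  by (rule amor_eq_imp_iso[OF adj_morphism_Nuc[OF adj_morphism_comp[OF assms]] Nuc_amor_comp[OF assms]])

lemma Nuc_amor_qinv_left:
  assumes "adj_morphism F G u" "adj_morphism G F m" "amor_iso F F (amor_comp F m u) (amor_id F)"
  shows "amor_iso (Nuc F) (Nuc F) (amor_comp (Nuc F) (Nuc_amor G F m) (Nuc_amor F G u)) (amor_id (Nuc F))"
proof -
  have F: "is_adjunction F"
    using assms(1) by (rule adj_morphismD)
  have "amor_iso (Nuc F) (Nuc F) (amor_comp (Nuc F) (Nuc_amor G F m) (Nuc_amor F G u)) (Nuc_amor F F (amor_comp F m u))"
    by (rule amor_iso_sym[OF Nuc_amor_comp_iso[OF assms(1,2)]])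
  also have "amor_iso (Nuc F) (Nuc F) \<dots> (Nuc_amor F F (amor_id F))"
    by (rule Nuc_amor_iso[OF assms(3)])
  also have "amor_iso (Nuc F) (Nuc F) \<dots> (amor_id (Nuc F))"
    by (rule amor_eq_imp_iso[OF adj_morphism_Nuc[OF adj_morphism_id[OF F]] Nuc_amor_id[OF F]])
  finally show ?thesis .
qed

lemma Nuc_amor_qinv:
  assumes "amor_qinv F G u m"
  shows "amor_qinv (Nuc F) (Nuc G) (Nuc_amor F G u) (Nuc_amor G F m)"
proof -
  note U = amor_qinvD[OF assms]
  show ?thesis
    unfolding amor_qinv_def
    using adj_morphism_Nuc[OF U(1)] adj_morphism_Nuc[OF U(2)]
      Nuc_amor_qinv_left[OF U(1-3)] Nuc_amor_qinv_left[OF U(2,1,4)] by blast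
qed

lemma adj_morphism_comparison: "is_adjunction F \<Longrightarrow> adj_morphism F (nuc F) (comparison F)"
  by (rule adjunction.adj_morphism_comparison) (rule adjunction.intro)

lemma adj_morphism_Nuc_unit: "is_adjunction F \<Longrightarrow> adj_morphism F (Nuc F) (Nuc_unit F)"
  unfolding Nuc_def Nuc_unit_def
  by (intro adj_morphism_comp[OF adj_morphism_embed adj_morphism_comparison] is_adjunction_karoubi)

text \<open>The squares of \<open>adj_embed_natural\<close> and \<open>comparison_natural\<close>,
  pasted side by side.\<close>

lemma Nuc_unit_natural:
  assumes U: "adj_morphism F G \<Upsilon>"
  shows "amor_iso F (Nuc G) (amor_comp (Nuc G) (Nuc_amor F G \<Upsilon>) (Nuc_unit F)) (amor_comp (Nuc G) (Nuc_unit G) \<Upsilon>)"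
proof -
  let ?KF = "karoubi_adj F" and ?KG = "karoubi_adj G" and ?K\<Upsilon> = "karoubi_amor F G \<Upsilon>"
  note adj = adj_morphismD[OF U]
  note eF = adj_morphism_embed[OF adj(1)] and eG = adj_morphism_embed[OF adj(2)]
    and cF = adj_morphism_comparison[OF is_adjunction_karoubi[OF adj(1)]]
    and cG = adj_morphism_comparison[OF is_adjunction_karoubi[OF adj(2)]]
    and N = adj_morphism_Nuc[OF U, unfolded Nuc_def] and K = adj_morphism_karoubi[OF U]
  have "amor_iso F (nuc ?KG) (amor_comp (nuc ?KG) (Nuc_amor F G \<Upsilon>) (amor_comp (nuc ?KF) (comparison ?KF) (adj_embed F)))
      (amor_comp (nuc ?KG) (amor_comp (nuc ?KG) (Nuc_amor F G \<Upsilon>) (comparison ?KF)) (adj_embed F))"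
    by (rule amor_iso_sym[OF amor_iso_assoc[OF eF cF N]])
  also have "amor_iso F (nuc ?KG) \<dots> (amor_comp (nuc ?KG) (amor_comp (nuc ?KG) (comparison ?KG) ?K\<Upsilon>) (adj_embed F))"
    unfolding Nuc_amor_def by (rule amor_iso_comp_right[OF eF comparison_natural[OF K]])
  also have "amor_iso F (nuc ?KG) \<dots> (amor_comp (nuc ?KG) (comparison ?KG) (amor_comp ?KG ?K\<Upsilon> (adj_embed F)))"
    by (rule amor_iso_assoc[OF eF K cG])
  also have "amor_iso F (nuc ?KG) \<dots> (amor_comp (nuc ?KG) (comparison ?KG) (amor_comp ?KG (adj_embed G) \<Upsilon>))"
    by (rule amor_iso_comp_left[OF adj_embed_natural[OF U] cG])
  also have "amor_iso F (nuc ?KG) \<dots> (amor_comp (nuc ?KG) (amor_comp (nuc ?KG) (comparison ?KG) (adj_embed G)) \<Upsilon>)"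
    by (rule amor_iso_sym[OF amor_iso_assoc[OF U eG cG]])
  finally show ?thesis
    unfolding Nuc_def Nuc_unit_def .
qed

text \<open>This justifies the convention that identifies the categories of a nucleus with their
  completions: through it the embedding of \<open>Nuc F\<close> acquires a quasi-inverse.\<close>

lemma split_idempotents_Nuc:
  assumes "is_adjunction F"
  shows "split_idempotents (catA (Nuc F))" "split_idempotents (catB (Nuc F))"
proof -
  interpret adjunction F by unfold_locales fact
  interpret K: adjunction "karoubi_adj F" by unfold_locales (rule is_adjunction_karoubi[OF assms])
  show "split_idempotents (catA (Nuc F))" "split_idempotents (catB (Nuc F))"
    using K.split_idempotents_Coalg K.split_idempotents_Alg
    by (simp_all add: Nuc_def split_idempotents_karoubi)
qed

lemma adj_embed_Nuc_qinv:
  assumes "is_adjunction F"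
  shows "\<exists>M. amor_qinv (Nuc F) (karoubi_adj (Nuc F)) (adj_embed (Nuc F)) M"
  using adjunction.adj_embed_qinv[OF adjunction.intro[OF is_adjunction_Nuc[OF assms]]]
    split_idempotents_Nuc[OF assms] by blast

lemma comparison_Nuc_qinv:
  assumes "is_adjunction F"
  shows "\<exists>M. amor_qinv (Nuc F) (nuc (Nuc F)) (comparison (Nuc F)) M"
  unfolding Nuc_def
  by (rule adjunction.comparison_nuc_qinv[OF adjunction.intro[OF is_adjunction_karoubi[OF assms]]])
    (use assms in \<open>auto intro!: split_idempotents_karoubi simp: is_adjunction_def is_functor_def\<close>)

text \<open>\<open>Nuc_unit (Nuc F)\<close> embeds first and compares afterwards. Naturality of the
  comparison along the embedding interchanges the two, which brings out the comparison of
  \<open>Nuc F\<close> itself.\<close>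

lemma Nuc_unit_Nuc:
  assumes "is_adjunction F"
  shows "amor_iso (Nuc F) (Nuc (Nuc F)) (Nuc_unit (Nuc F))
    (amor_comp (Nuc (Nuc F)) (nuc_amor (Nuc F) (karoubi_adj (Nuc F)) (adj_embed (Nuc F))) (comparison (Nuc F)))"
  using amor_iso_sym[OF comparison_natural[OF adj_morphism_embed[OF is_adjunction_Nuc[OF assms]]]]
  by (simp only: Nuc_unit_def Nuc_def[of "Nuc F"])

text \<open>Both factors supplied by \<open>Nuc_unit_Nuc\<close> have quasi-inverses: the comparison
  because completions have split idempotents, and the other because \<open>nuc_amor\<close>
  preserves the quasi-inverse of the embedding.\<close>

lemma Nuc_unit_qinv:
  assumes "is_adjunction F"
  shows "\<exists>M. amor_qinv (Nuc F) (Nuc (Nuc F)) (Nuc_unit (Nuc F)) M"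
proof -
  obtain M M' where "amor_qinv (Nuc F) (karoubi_adj (Nuc F)) (adj_embed (Nuc F)) M"
    "amor_qinv (Nuc F) (nuc (Nuc F)) (comparison (Nuc F)) M'"
    using adj_embed_Nuc_qinv[OF assms] comparison_Nuc_qinv[OF assms] by blast
  from amor_qinv_comp[OF this(2) nuc_amor_qinv[OF this(1)]] show ?thesis
    using amor_qinv_iso[OF _ amor_iso_sym[OF Nuc_unit_Nuc[OF assms]]] unfolding Nuc_def[of "Nuc F"] by blast
qed

lemma Nuc_mult_qinv:
  assumes "is_adjunction F"
  shows "amor_qinv (Nuc F) (Nuc (Nuc F)) (Nuc_unit (Nuc F)) (Nuc_mult F)"
proof -
  obtain M where M: "amor_qinv (Nuc F) (Nuc (Nuc F)) (Nuc_unit (Nuc F)) M"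
    using Nuc_unit_qinv[OF assms] by blast
  show ?thesis
    unfolding amor_qinv_def
    using someI[of "\<lambda>M. adj_morphism (Nuc (Nuc F)) (Nuc F) M \<and>
        amor_iso (Nuc F) (Nuc F) (amor_comp (Nuc F) M (Nuc_unit (Nuc F))) (amor_id (Nuc F)) \<and>
        amor_iso (Nuc (Nuc F)) (Nuc (Nuc F))
          (amor_comp (Nuc (Nuc F)) (Nuc_unit (Nuc F)) M) (amor_id (Nuc (Nuc F)))" M]
      amor_qinvD[OF M] unfolding Nuc_mult_def by blast
qed

text \<open>The unit law for \<open>Nuc_amor F (Nuc F) (Nuc_unit F)\<close> and associativity rest on this well-pointedness;
  the other laws are formal.\<close>

lemma Nuc_amor_unit:
  assumes "is_adjunction F"
  shows "amor_iso (Nuc F) (Nuc (Nuc F)) (Nuc_amor F (Nuc F) (Nuc_unit F)) (Nuc_unit (Nuc F))"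
proof -
  let ?K = "karoubi_adj F" and ?N = "Nuc F"
  let ?KK = "karoubi_adj ?K" and ?KN = "karoubi_adj ?N"
  note K = is_adjunction_karoubi[OF assms] and N = is_adjunction_Nuc[OF assms]
  have c: "adj_morphism ?K ?N (comparison ?K)"
    unfolding Nuc_def by (rule adj_morphism_comparison[OF K])
  note e = adj_morphism_embed[OF assms] and eK = adj_morphism_embed[OF K] and eN = adj_morphism_embed[OF N]
    and Kc = adj_morphism_karoubi[OF c]
  have "amor_iso ?N (Nuc ?N) (Nuc_amor F ?N (Nuc_unit F))
      (amor_comp (Nuc ?N) (Nuc_amor ?K ?N (comparison ?K)) (Nuc_amor F ?K (adj_embed F)))"
    unfolding Nuc_unit_def by (rule Nuc_amor_comp_iso[OF e c])
  \<comment> \<open>Replacing the completed embedding by the embedding of the completion makes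
    \<open>adj_embed_natural\<close> applicable to the comparison.\<close>
  also have "amor_iso ?N (Nuc ?N) \<dots> (amor_comp (Nuc ?N) (Nuc_amor ?K ?N (comparison ?K)) (nuc_amor ?K ?KK (adj_embed ?K)))"
    using amor_iso_comp_left[OF nuc_amor_iso[OF amor_iso_sym[OF adj_embed_karoubi[OF assms]]]
        adj_morphism_Nuc[OF c, unfolded Nuc_def[of ?K]]]
    unfolding Nuc_amor_def[of F ?K] Nuc_def[of F] .
  also have "amor_iso ?N (Nuc ?N) \<dots> (nuc_amor ?K ?KN (amor_comp ?KN (karoubi_amor ?K ?N (comparison ?K)) (adj_embed ?K)))"
    using amor_iso_sym[OF nuc_amor_comp_iso[OF eK Kc]]
    unfolding Nuc_amor_def Nuc_def .
  also have "amor_iso ?N (Nuc ?N) \<dots> (nuc_amor ?K ?KN (amor_comp ?KN (adj_embed ?N) (comparison ?K)))"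
    using nuc_amor_iso[OF adj_embed_natural[OF c]] unfolding Nuc_def .
  also have "amor_iso ?N (Nuc ?N) \<dots> (amor_comp (Nuc ?N) (nuc_amor ?N ?KN (adj_embed ?N)) (nuc_amor ?K ?N (comparison ?K)))"
    using nuc_amor_comp_iso[OF c eN] unfolding Nuc_def .
  \<comment> \<open>Here the well-pointedness of \<open>nuc\<close> enters, through
    \<open>nuc_amor_comparison\<close>; what results is the factorisation in
    \<open>Nuc_unit_Nuc\<close>.\<close>
  also have "amor_iso ?N (Nuc ?N) \<dots> (amor_comp (Nuc ?N) (nuc_amor ?N ?KN (adj_embed ?N)) (comparison ?N))"
    unfolding Nuc_def[of ?N]
  proof (rule amor_iso_comp_left)
    show "adj_morphism (nuc ?N) (nuc ?KN) (nuc_amor ?N ?KN (adj_embed ?N))"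
      by (rule adj_mor.adj_morphism_nuc[OF adj_mor_intro[OF eN]])
    show "amor_iso ?N (nuc ?N) (nuc_amor ?K ?N (comparison ?K)) (comparison ?N)"
      using amor_eq_imp_iso[OF adj_mor.adj_morphism_nuc[OF adj_mor_intro[OF c]]] nuc_amor_comparison[OF K]
      unfolding Nuc_def by blast
  qed
  also have "amor_iso ?N (Nuc ?N) \<dots> (Nuc_unit ?N)"
    by (rule amor_iso_sym[OF Nuc_unit_Nuc[OF assms]])
  finally show ?thesis .
qed

lemma Nuc_mult_natural:
  assumes "adj_morphism F G \<Upsilon>"
  shows "amor_iso (Nuc (Nuc F)) (Nuc G) (amor_comp (Nuc G) (Nuc_amor F G \<Upsilon>) (Nuc_mult F))
    (amor_comp (Nuc G) (Nuc_mult G) (Nuc_amor (Nuc F) (Nuc G) (Nuc_amor F G \<Upsilon>)))"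
proof -
  note adj = adj_morphismD[OF assms] and N = adj_morphism_Nuc[OF assms]
  show ?thesis
    by (rule amor_qinv_square[OF Nuc_mult_qinv[OF adj(1)] Nuc_mult_qinv[OF adj(2)] N adj_morphism_Nuc[OF N]
          Nuc_unit_natural[OF N]])
qed

text \<open>Both sides are quasi-inverse to \<open>Nuc_unit (Nuc (Nuc F))\<close>: the first by
  choice, the second because \<open>Nuc_amor\<close> preserves quasi-inverses and
  \<open>Nuc_amor_unit\<close> identifies the image of the unit. Composing with
  \<open>Nuc_mult F\<close> gives associativity.\<close>

lemma Nuc_amor_mult:
  assumes "is_adjunction F"
  shows "amor_iso (Nuc (Nuc (Nuc F))) (Nuc (Nuc F)) (Nuc_mult (Nuc F)) (Nuc_amor (Nuc (Nuc F)) (Nuc F) (Nuc_mult F))"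
  by (rule amor_qinv_unique[OF Nuc_mult_qinv[OF is_adjunction_Nuc[OF assms]] Nuc_amor_qinv[OF Nuc_mult_qinv[OF assms]]
        amor_iso_sym[OF Nuc_amor_unit[OF is_adjunction_Nuc[OF assms]]]])

theorem corollary5p2:
  fixes F :: "('oa, 'ma, 'ob, 'mb) adj"
  assumes "is_adjunction F"
  shows
    \<comment> \<open>the nucleus is a functor on adjunctions, compatible with isomorphism of parallel morphisms\<close>
    "is_adjunction (Nuc F) \<and>
     amor_eq (Nuc F) (Nuc_amor F F (amor_id F)) (amor_id (Nuc F)) \<and>
     (\<forall>(G :: ('oc, 'mc, 'od, 'md) adj) \<Upsilon>.
        adj_morphism F G \<Upsilon> \<longrightarrow> adj_morphism (Nuc F) (Nuc G) (Nuc_amor F G \<Upsilon>)) \<and>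
     (\<forall>(G :: ('oc, 'mc, 'od, 'md) adj) (L :: ('oe, 'me, 'of, 'mf) adj) \<Upsilon> \<Psi>.
        adj_morphism F G \<Upsilon> \<and> adj_morphism G L \<Psi> \<longrightarrow>
        amor_eq (Nuc F) (Nuc_amor F L (amor_comp L \<Psi> \<Upsilon>))
                        (amor_comp (Nuc L) (Nuc_amor G L \<Psi>) (Nuc_amor F G \<Upsilon>))) \<and>
     (\<forall>(G :: ('oc, 'mc, 'od, 'md) adj) \<Upsilon> \<Upsilon>'.
        amor_iso F G \<Upsilon> \<Upsilon>' \<longrightarrow> amor_iso (Nuc F) (Nuc G) (Nuc_amor F G \<Upsilon>) (Nuc_amor F G \<Upsilon>')) \<and>

     \<comment> \<open>the unit and the multiplication are natural transformations\<close>
     adj_morphism F (Nuc F) (Nuc_unit F) \<and>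
     (\<forall>(G :: ('oc, 'mc, 'od, 'md) adj) \<Upsilon>. adj_morphism F G \<Upsilon> \<longrightarrow>
        amor_iso F (Nuc G)
          (amor_comp (Nuc G) (Nuc_amor F G \<Upsilon>) (Nuc_unit F))
          (amor_comp (Nuc G) (Nuc_unit G) \<Upsilon>)) \<and>
     adj_morphism (Nuc (Nuc F)) (Nuc F) (Nuc_mult F) \<and>
     (\<forall>(G :: ('oc, 'mc, 'od, 'md) adj) \<Upsilon>. adj_morphism F G \<Upsilon> \<longrightarrow>
        amor_iso (Nuc (Nuc F)) (Nuc G)
          (amor_comp (Nuc G) (Nuc_amor F G \<Upsilon>) (Nuc_mult F))
          (amor_comp (Nuc G) (Nuc_mult G) (Nuc_amor (Nuc F) (Nuc G) (Nuc_amor F G \<Upsilon>)))) \<and>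

     \<comment> \<open>the monad laws\<close>
     amor_iso (Nuc F) (Nuc F)
       (amor_comp (Nuc F) (Nuc_mult F) (Nuc_unit (Nuc F))) (amor_id (Nuc F)) \<and>
     amor_iso (Nuc F) (Nuc F)
       (amor_comp (Nuc F) (Nuc_mult F) (Nuc_amor F (Nuc F) (Nuc_unit F))) (amor_id (Nuc F)) \<and>
     amor_iso (Nuc (Nuc (Nuc F))) (Nuc F)
       (amor_comp (Nuc F) (Nuc_mult F) (Nuc_mult (Nuc F)))
       (amor_comp (Nuc F) (Nuc_mult F) (Nuc_amor (Nuc (Nuc F)) (Nuc F) (Nuc_mult F))) \<and>

     \<comment> \<open>the monad is idempotent\<close>
     adj_equivalence (Nuc (Nuc F)) (Nuc F) (Nuc_mult F) \<and>
     adj_equivalence (Nuc F) (Nuc (Nuc F)) (Nuc_unit (Nuc F)) \<and>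

     \<comment> \<open>\<open>Nuc F\<close> is equivalent to its own completion, and under this identification the unit
        component at \<open>Nuc F\<close> is the pair of comparison functors of \<open>Nuc F\<close>\<close>
     adj_equivalence (Nuc F) (karoubi_adj (Nuc F)) (adj_embed (Nuc F)) \<and>
     amor_iso (Nuc F) (Nuc (Nuc F))
       (Nuc_unit (Nuc F))
       (amor_comp (Nuc (Nuc F))
          (nuc_amor (Nuc F) (karoubi_adj (Nuc F)) (adj_embed (Nuc F))) (comparison (Nuc F))) \<and>

     \<comment> \<open>this comparison is an equivalence of adjunctions, natural in \<open>F\<close>\<close>
     adj_equivalence (Nuc F) (nuc (Nuc F)) (comparison (Nuc F)) \<and>
     (\<forall>(G :: ('oc, 'mc, 'od, 'md) adj) \<Upsilon>. adj_morphism F G \<Upsilon> \<longrightarrow>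
        amor_iso (Nuc F) (nuc (Nuc G))
          (amor_comp (nuc (Nuc G)) (nuc_amor (Nuc F) (Nuc G) (Nuc_amor F G \<Upsilon>)) (comparison (Nuc F)))
          (amor_comp (nuc (Nuc G)) (comparison (Nuc G)) (Nuc_amor F G \<Upsilon>)))"
proof -
  note N = is_adjunction_Nuc[OF assms] and q = Nuc_mult_qinv[OF assms]
  note Q = amor_qinvD[OF q]
  have m1: "amor_iso (Nuc F) (Nuc F)
       (amor_comp (Nuc F) (Nuc_mult F) (Nuc_amor F (Nuc F) (Nuc_unit F))) (amor_id (Nuc F))"
    by (rule amor_iso_trans[OF amor_iso_comp_left[OF Nuc_amor_unit[OF assms] Q(2)] Q(3)])
  have m2: "amor_iso (Nuc (Nuc (Nuc F))) (Nuc F)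
       (amor_comp (Nuc F) (Nuc_mult F) (Nuc_mult (Nuc F)))
       (amor_comp (Nuc F) (Nuc_mult F) (Nuc_amor (Nuc (Nuc F)) (Nuc F) (Nuc_mult F)))"
    by (rule amor_iso_comp_left[OF Nuc_amor_mult[OF assms] Q(2)])
  have e: "adj_equivalence (Nuc F) (karoubi_adj (Nuc F)) (adj_embed (Nuc F))"
    "adj_equivalence (Nuc F) (nuc (Nuc F)) (comparison (Nuc F))"
    using adj_embed_Nuc_qinv[OF assms] comparison_Nuc_qinv[OF assms] amor_qinv_equivalence by blast+
  show ?thesis
  proof (intro conjI allI impI; (elim conjE)?)
  qed (fact N Nuc_amor_id[OF assms] adj_morphism_Nuc_unit[OF assms] Q m1 m2 e Nuc_unit_Nuc[OF assms]
      amor_qinv_equivalence[OF q] amor_qinv_equivalence[OF amor_qinv_sym[OF q]]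
    | rule adj_morphism_Nuc Nuc_amor_comp Nuc_amor_iso Nuc_unit_natural Nuc_mult_natural
      comparison_natural[OF adj_morphism_Nuc]; assumption)+
qed

end
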